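(* Let $X,Y$ be finite sets, let $P(X)$ and $P(Y)$ be regular path complexes on $X$ and $Y$, and let $P(Z)=P(X)\boxplus P(Y)$ be their Cartesian product, a path complex on $Z=X\times Y$. Then there is an isomorphism of chain complexes $$\Omega_\bullet(Z)\cong\Omega_\bullet(X)\otimes\Omega_\bullet(Y),$$ where the mapping $\Omega_\bullet(X)\otimes\Omega_\bullet(Y)\to\Omega_\bullet(Z)$ is given by $u\otimes v\mapsto u\times v$. Consequently $H_\bullet(Z)\cong H_\bullet(X)\otimes H_\bullet(Y)$, that is, for every $r\ge 0$, $$H_r(Z)\cong\bigoplus_{p,q\ge0,\ p+q=r}H_p(X)\otimes H_q(Y).$$
   Context: Fix a field $\mathbb K$; all vector spaces are over $\mathbb K$. For a finite set $V$ and $p\ge 0$, an elementary $p$-path is a sequence $i_0\dots i_p$ of vertices of $V$; it is regular if $i_{k-1}\ne i_k$ for all $k$. $\mathcal R_p(V)$ is the vector space with basis $\{e_{i_0\dots i_p}: i_0\dots i_p \text{ regular}\}$; $u^{x}$ denotes the $e_x$-coefficient of $u$. The regular truncated boundary operator $\partial:\mathcal R_p(V)\to\mathcal R_{p-1}(V)$, $p\ge1$, is $\partial e_{i_0\dots i_p}=\sum_{q=0}^p(-1)^q e_{i_0\dots\widehat{i_q}\dots i_p}$, where every term with a non-regular index sequence is replaced by $0$; $\partial=0$ on $\mathcal R_0(V)$, $\mathcal R_{-1}=\{0\}$. One has $\partial^2=0$. A path complex $P(V)$ over $V$ is a non-empty collection of elementary paths (the empty path, viewed as a $(-1)$-path,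 included) such that if $i_0\dots i_n\in P(V)$, $n\ge 0$, then $i_0\dots i_{n-1}$ and $i_1\dots i_n$ are in $P(V)$; the vertex set is always taken so that all vertices of $V$ are in $P(V)$. It is regular if it contains no $1$-path $ii$. The paths in $P(V)$ are called allowed. $\mathcal A_n(V)$ is the span of $e_x$ over allowed $n$-paths $x$ ($\mathcal A_{-1}=\{0\}$ here), $\Omega_n(V)=\{v\in\mathcal A_n(V):\partial v\in\mathcal A_{n-1}(V)\}$, and $H_n(V)$, $n\ge 0$, is the homology of the chain complex $0\leftarrow\Omega_0(V)\leftarrow\Omega_1(V)\leftarrow\cdots$ with differential $\partial$. Let $Z=X\times Y$. A regular elementary path $z=z_0\dots z_r$ on $Z$, $z_k=(x_k,y_k)$, is step-like if for each $k=1,\dots,r$ either $x_{k-1}=x_k$ (vertical couple) or $y_{k-1}=y_k$ (horizontal couple). Its projection onto $X$ is obtained by taking the sequence of $X$-components and collapsing every run of repeated consecutive vertices to one vertex; similarly for $Y$. If the projections are $x_0\dots x_p$ and $y_0\dots y_q$ then $p+q=r$, and $z$ is represented by a staircase in $\mathbb Z^2$ from $(0,0)$ to $(p,q)$ (the vertex $(x_i,y_j)$ being represented by $(i,j)$). The elevation $L(z)$ is the number of unit cells in $\mathbb Z_+^2$ below this staircase, i.e. the number of pairs (vertical couple, later horizontal couple) in $z$. For $u\in\mathcal R_p(X)$, $v\in\mathcal R_q(Y)$, the cross product $u\times v\in\mathcal R_{p+q}(Z)$ is defined by $(u\times v)^z=(-1)^{L(z)}u^xv^y$ if $z$ is a step-like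 $(p+q)$-path with projections $x$ on $X$ and $y$ on $Y$ (with $u^x=0$ if $x$ is not a $p$-path and $v^y=0$ if $y$ is not a $q$-path), and $(u\times v)^z=0$ if $z$ is not step-like. The Cartesian product $P(X)\boxplus P(Y)$ is the path complex on $Z$ consisting of all step-like paths on $Z$ whose projections on $X$ and $Y$ belong to $P(X)$ and $P(Y)$, respectively. The tensor product of chain complexes $A_\bullet,B_\bullet$ is $C_r=\bigoplus_{p+q=r}A_p\otimes B_q$ with $\partial(u\otimes v)=(\partial u)\otimes v+(-1)^pu\otimes\partial v$ for $u\in A_p$, $v\in B_q$. *)

theory Defs
  imports "HOL-Library.Poly_Mapping" "HOL-Algebra.Module" "HOL-Algebra.AbelCoset"
    Complex_Main
begin

section \<open>Vector spaces\<close>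

text \<open>
  The scalars are a type of class \<open>field\<close>. The vector space with basis \<open>S\<close> is realised inside
  the finitely supported functions \<open>'s \<Rightarrow>\<^sub>0 'k\<close>: the basis vector \<open>e\<^sub>x\<close> is
  \<open>Poly_Mapping.single x 1\<close>, and the \<open>e\<^sub>x\<close>-coefficient of \<open>u\<close> is \<open>Poly_Mapping.lookup u x\<close>.
  Vector spaces with an explicit carrier are records of type \<open>('k, 'v) module\<close>; the ring fields
  \<open>mult\<close> and \<open>one\<close> play no role for modules and are left undefined.
\<close>

definition pscale :: "'k::field \<Rightarrow> ('s \<Rightarrow>\<^sub>0 'k) \<Rightarrow> ('s \<Rightarrow>\<^sub>0 'k)" where
  "pscale c u = Poly_Mapping.map ((*) c) u"

lemma lookup_pscale [simp]: "Poly_Mapping.lookup (pscale c u) x = c * Poly_Mapping.lookup u x"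
  by (simp add: pscale_def map.rep_eq when_def)

global_interpretation pm: vector_space "pscale :: 'k::field \<Rightarrow> ('s \<Rightarrow>\<^sub>0 'k) \<Rightarrow> _"
  by unfold_locales (auto intro!: poly_mapping_eqI simp: lookup_add algebra_simps)

definition pm_module :: "('s \<Rightarrow>\<^sub>0 'k) set \<Rightarrow> ('k::field, 's \<Rightarrow>\<^sub>0 'k) module" where
  "pm_module U =
    \<lparr>carrier = U, mult = undefined, one = undefined, zero = 0, add = (+), smult = pscale\<rparr>"

text \<open>In \<open>smult\<close> all the cosets in the union coincide when \<open>A\<close> is a coset of a subspace \<open>N\<close>;
  taking \<open>(\<odot>) c ` A\<close> instead would be wrong for \<open>c = 0\<close>.\<close>

definition quot_module :: "('k, 'v) module \<Rightarrow> 'v set \<Rightarrow> ('k, 'v set) module" where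
  "quot_module M N =
    \<lparr>carrier = a_rcosets\<^bsub>M\<^esub> N, mult = undefined, one = undefined, zero = N, add = set_add M,
     smult = (\<lambda>c A. \<Union>a\<in>A. N +>\<^bsub>M\<^esub> (c \<odot>\<^bsub>M\<^esub> a))\<rparr>"

definition direct_sum :: "'i set \<Rightarrow> ('i \<Rightarrow> ('k, 'v) module) \<Rightarrow> ('k, 'i \<Rightarrow> 'v) module" where
  "direct_sum I M =
    \<lparr>carrier = {f \<in> \<Pi>\<^sub>E i\<in>I. carrier (M i). finite {i \<in> I. f i \<noteq> \<zero>\<^bsub>M i\<^esub>}},
     mult = undefined, one = undefined,
     zero = (\<lambda>i\<in>I. \<zero>\<^bsub>M i\<^esub>),
     add = (\<lambda>f g. \<lambda>i\<in>I. f i \<oplus>\<^bsub>M i\<^esub> g i),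
     smult = (\<lambda>c f. \<lambda>i\<in>I. c \<odot>\<^bsub>M i\<^esub> f i)\<rparr>"

definition direct_sum_incl ::
    "'i set \<Rightarrow> ('i \<Rightarrow> ('k, 'v) module) \<Rightarrow> 'i \<Rightarrow> 'v \<Rightarrow> ('i \<Rightarrow> 'v)" where
  "direct_sum_incl I M i x = (\<lambda>j\<in>I. if j = i then x else \<zero>\<^bsub>M j\<^esub>)"

definition module_iso :: "('k, 'v) module \<Rightarrow> ('k, 'w) module \<Rightarrow> ('v \<Rightarrow> 'w) set" where
  "module_iso M N =
    {h \<in> iso (add_monoid M) (add_monoid N).
       \<forall>c. \<forall>x\<in>carrier M. h (c \<odot>\<^bsub>M\<^esub> x) = c \<odot>\<^bsub>N\<^esub> h x}"

definition isomorphic_modules :: "('k, 'v) module \<Rightarrow> ('k, 'w) module \<Rightarrow> bool" where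
  "isomorphic_modules M N \<longleftrightarrow> module_iso M N \<noteq> {}"

text \<open>The tensor product is the free vector space on the product of the carriers modulo the
  subspace spanned by the bilinearity relations.\<close>

definition tensor_free ::
    "('k::field, 'v) module \<Rightarrow> ('k, 'w) module \<Rightarrow> ('k, ('v \<times> 'w) \<Rightarrow>\<^sub>0 'k) module" where
  "tensor_free M N = pm_module {t. Poly_Mapping.keys t \<subseteq> carrier M \<times> carrier N}"

definition tensor_rel ::
    "('k::field, 'v) module \<Rightarrow> ('k, 'w) module \<Rightarrow> (('v \<times> 'w) \<Rightarrow>\<^sub>0 'k) set" where
  "tensor_rel M N = pm.span
    ({Poly_Mapping.single (u \<oplus>\<^bsub>M\<^esub> u', v) 1 - Poly_Mapping.single (u, v) 1
        - Poly_Mapping.single (u', v) 1 | u u' v.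
        u \<in> carrier M \<and> u' \<in> carrier M \<and> v \<in> carrier N} \<union>
     {Poly_Mapping.single (u, v \<oplus>\<^bsub>N\<^esub> v') 1 - Poly_Mapping.single (u, v) 1
        - Poly_Mapping.single (u, v') 1 | u v v'.
        u \<in> carrier M \<and> v \<in> carrier N \<and> v' \<in> carrier N} \<union>
     {Poly_Mapping.single (c \<odot>\<^bsub>M\<^esub> u, v) 1 - pscale c (Poly_Mapping.single (u, v) 1) | c u v.
        u \<in> carrier M \<and> v \<in> carrier N} \<union>
     {Poly_Mapping.single (u, c \<odot>\<^bsub>N\<^esub> v) 1 - pscale c (Poly_Mapping.single (u, v) 1) | c u v.
        u \<in> carrier M \<and> v \<in> carrier N})"

definition tensor ::
    "('k::field, 'v) module \<Rightarrow> ('k, 'w) module \<Rightarrow> ('k, (('v \<times> 'w) \<Rightarrow>\<^sub>0 'k) set) module" where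
  "tensor M N = quot_module (tensor_free M N) (tensor_rel M N)"

definition pure_tensor ::
    "('k::field, 'v) module \<Rightarrow> ('k, 'w) module \<Rightarrow> 'v \<Rightarrow> 'w \<Rightarrow> (('v \<times> 'w) \<Rightarrow>\<^sub>0 'k) set" where
  "pure_tensor M N u v = tensor_rel M N +>\<^bsub>tensor_free M N\<^esub> Poly_Mapping.single (u, v) 1"

text \<open>The map \<open>f \<otimes> g\<close> into \<open>M \<otimes> N\<close> induced by linear maps \<open>f\<close> into \<open>M\<close> and \<open>g\<close> into \<open>N\<close>:
  for linear \<open>f\<close>, \<open>g\<close> and a coset \<open>T\<close> of the tensor relations of the domains, all the cosets in
  the union coincide.\<close>

definition tensor_map ::
    "('k::field, 'v1) module \<Rightarrow> ('k, 'w1) module \<Rightarrow> ('v \<Rightarrow> 'v1) \<Rightarrow> ('w \<Rightarrow> 'w1)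
      \<Rightarrow> (('v \<times> 'w) \<Rightarrow>\<^sub>0 'k) set \<Rightarrow> (('v1 \<times> 'w1) \<Rightarrow>\<^sub>0 'k) set" where
  "tensor_map M N f g T =
    (\<Union>t\<in>T. tensor_rel M N +>\<^bsub>tensor_free M N\<^esub>
       (\<Sum>(u, v)\<in>Poly_Mapping.keys t. Poly_Mapping.single (f u, g v) (Poly_Mapping.lookup t (u, v))))"


section \<open>Chain complexes\<close>

text \<open>A complex \<open>0 \<leftarrow> C\<^sub>0 \<leftarrow> C\<^sub>1 \<leftarrow> \<dots>\<close>; note the index shift: \<open>cdiff C n\<close> maps \<open>cobj C (Suc n)\<close>
  to \<open>cobj C n\<close>, and the zero map out of \<open>C\<^sub>0\<close> is implicit.\<close>

record ('k, 'v) chain_cplx =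
  cobj :: "nat \<Rightarrow> ('k, 'v) module"
  cdiff :: "nat \<Rightarrow> 'v \<Rightarrow> 'v"

definition chain_iso ::
    "('k, 'v) chain_cplx \<Rightarrow> ('k, 'w) chain_cplx \<Rightarrow> (nat \<Rightarrow> 'v \<Rightarrow> 'w) set" where
  "chain_iso C D =
    {\<phi>. (\<forall>n. \<phi> n \<in> module_iso (cobj C n) (cobj D n)) \<and>
        (\<forall>n. \<forall>x\<in>carrier (cobj C (Suc n)). \<phi> n (cdiff C n x) = cdiff D n (\<phi> (Suc n) x))}"

definition cycles :: "('k, 'v) chain_cplx \<Rightarrow> nat \<Rightarrow> 'v set" where
  "cycles C n = (case n of
     0 \<Rightarrow> carrier (cobj C 0)
   | Suc m \<Rightarrow> {x \<in> carrier (cobj C (Suc m)). cdiff C m x = \<zero>\<^bsub>cobj C m\<^esub>})"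

definition boundaries :: "('k, 'v) chain_cplx \<Rightarrow> nat \<Rightarrow> 'v set" where
  "boundaries C n = cdiff C n ` carrier (cobj C (Suc n))"

definition homology :: "('k, 'v) chain_cplx \<Rightarrow> nat \<Rightarrow> ('k, 'v set) module" where
  "homology C n = quot_module ((cobj C n)\<lparr>carrier := cycles C n\<rparr>) (boundaries C n)"

definition bidegrees :: "nat \<Rightarrow> (nat \<times> nat) set" where
  "bidegrees r = {(p, q). p + q = r}"

text \<open>The component of \<open>\<partial>w\<close> in bidegree \<open>(p, q)\<close> comes from the components of \<open>w\<close> in bidegrees
  \<open>(p + 1, q)\<close> and \<open>(p, q + 1)\<close>, via \<open>\<partial> \<otimes> id\<close> and \<open>(-1)\<^sup>p id \<otimes> \<partial>\<close> respectively.\<close>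

definition tensor_complex ::
    "('k::field, 'v) chain_cplx \<Rightarrow> ('k, 'w) chain_cplx
      \<Rightarrow> ('k, nat \<times> nat \<Rightarrow> (('v \<times> 'w) \<Rightarrow>\<^sub>0 'k) set) chain_cplx" where
  "tensor_complex A B =
    \<lparr>cobj = (\<lambda>r. direct_sum (bidegrees r) (\<lambda>(p, q). tensor (cobj A p) (cobj B q))),
     cdiff = (\<lambda>r w. \<lambda>(p, q)\<in>bidegrees r.
       tensor_map (cobj A p) (cobj B q) (cdiff A p) id (w (Suc p, q))
       \<oplus>\<^bsub>tensor (cobj A p) (cobj B q)\<^esub>
       ((-1) ^ p \<odot>\<^bsub>tensor (cobj A p) (cobj B q)\<^esub>
         tensor_map (cobj A p) (cobj B q) id (cdiff B q) (w (p, Suc q))))\<rparr>"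


section \<open>Path complexes\<close>

text \<open>An elementary \<open>p\<close>-path is a list of length \<open>p + 1\<close>; the empty list is the \<open>(-1)\<close>-path.
  A path is regular if it is \<open>distinct_adj\<close>.\<close>

definition path_complex :: "'a set \<Rightarrow> 'a list set \<Rightarrow> bool" where
  "path_complex V P \<longleftrightarrow>
     [] \<in> P \<and> (\<forall>x\<in>P. set x \<subseteq> V) \<and> (\<forall>i\<in>V. [i] \<in> P) \<and>
     (\<forall>x\<in>P. x \<noteq> [] \<longrightarrow> butlast x \<in> P \<and> tl x \<in> P)"

definition regular_path_complex :: "'a set \<Rightarrow> 'a list set \<Rightarrow> bool" where
  "regular_path_complex V P \<longleftrightarrow> path_complex V P \<and> (\<forall>i. [i, i] \<notin> P)"

definition delete_nth :: "nat \<Rightarrow> 'a list \<Rightarrow> 'a list" where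
  "delete_nth q x = take q x @ drop (Suc q) x"

definition path_boundary :: "'a list \<Rightarrow> ('a list \<Rightarrow>\<^sub>0 'k::field)" where
  "path_boundary x =
    (if length x \<le> 1 then 0
     else \<Sum>q<length x. if distinct_adj (delete_nth q x)
                      then pscale ((-1) ^ q) (Poly_Mapping.single (delete_nth q x) 1) else 0)"

definition boundary :: "('a list \<Rightarrow>\<^sub>0 'k::field) \<Rightarrow> ('a list \<Rightarrow>\<^sub>0 'k)" where
  "boundary u = (\<Sum>x\<in>Poly_Mapping.keys u. pscale (Poly_Mapping.lookup u x) (path_boundary x))"

definition allowed_chains :: "'a list set \<Rightarrow> nat \<Rightarrow> ('a list \<Rightarrow>\<^sub>0 'k::field) set" where
  "allowed_chains P n = pm.span {Poly_Mapping.single x 1 | x. x \<in> P \<and> length x = Suc n}"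

definition Omega_set :: "'a list set \<Rightarrow> nat \<Rightarrow> ('a list \<Rightarrow>\<^sub>0 'k::field) set" where
  "Omega_set P n =
    {v \<in> allowed_chains P n. boundary v \<in> (case n of 0 \<Rightarrow> {0} | Suc m \<Rightarrow> allowed_chains P m)}"

definition Omega :: "'k itself \<Rightarrow> 'a list set \<Rightarrow> ('k::field, 'a list \<Rightarrow>\<^sub>0 'k) chain_cplx" where
  "Omega _ P = \<lparr>cobj = (\<lambda>n. pm_module (Omega_set P n)), cdiff = (\<lambda>n. boundary)\<rparr>"


section \<open>Step-like paths and the cross product\<close>

definition step_like :: "('a \<times> 'b) list \<Rightarrow> bool" where
  "step_like z \<longleftrightarrow> distinct_adj z \<and> successively (\<lambda>a b. fst a = fst b \<or> snd a = snd b) z"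

definition proj_X :: "('a \<times> 'b) list \<Rightarrow> 'a list" where
  "proj_X z = remdups_adj (map fst z)"

definition proj_Y :: "('a \<times> 'b) list \<Rightarrow> 'b list" where
  "proj_Y z = remdups_adj (map snd z)"

text \<open>The cells below the staircase correspond to the pairs consisting of a vertical couple at
  position \<open>k\<close> and a horizontal couple at a later position \<open>l\<close>.\<close>

definition elevation :: "('a \<times> 'b) list \<Rightarrow> nat" where
  "elevation z = card {(k, l). k < l \<and> Suc l < length z \<and>
     fst (z ! k) = fst (z ! Suc k) \<and> snd (z ! l) = snd (z ! Suc l)}"

lemma step_like_length:
  "step_like z \<Longrightarrow> z \<noteq> [] \<Longrightarrow> length (proj_X z) + length (proj_Y z) = Suc (length z)"
proof (induction z)
  case (Cons a z)
  show ?case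
  proof (cases z)
    case (Cons b w)
    with Cons.prems have "step_like z" "a \<noteq> b" "fst a = fst b \<or> snd a = snd b"
      by (auto simp: step_like_def distinct_adj_def)
    with Cons.IH Cons show ?thesis
      by (cases a; cases b) (auto simp: proj_X_def proj_Y_def)
  qed (simp add: proj_X_def proj_Y_def)
qed simp

lemma finite_step_like_proj: "finite {z. step_like z \<and> proj_X z = x \<and> proj_Y z = y}"
proof (rule finite_subset)
  show "finite {z. set z \<subseteq> set x \<times> set y \<and> length z \<le> length x + length y}"
    by (rule finite_lists_length_le) auto
  show "{z. step_like z \<and> proj_X z = x \<and> proj_Y z = y}
      \<subseteq> {z. set z \<subseteq> set x \<times> set y \<and> length z \<le> length x + length y}"
  proof safe
    fix z :: "('a \<times> 'b) list" and a b
    assume "(a, b) \<in> set z"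
    then show "a \<in> set (proj_X z)" "b \<in> set (proj_Y z)"
      by (force simp: proj_X_def proj_Y_def)+
  next
    fix z :: "('a \<times> 'b) list"
    assume "step_like z"
    then show "length z \<le> length (proj_X z) + length (proj_Y z)"
      using step_like_length[of z] by (cases "z = []") auto
  qed
qed

lift_definition cross ::
    "('a list \<Rightarrow>\<^sub>0 'k::field) \<Rightarrow> ('b list \<Rightarrow>\<^sub>0 'k) \<Rightarrow> (('a \<times> 'b) list \<Rightarrow>\<^sub>0 'k)" is
  "\<lambda>u v z. if step_like z then (-1) ^ elevation z * u (proj_X z) * v (proj_Y z) else 0"
proof -
  fix u :: "'a list \<Rightarrow> 'k" and v :: "'b list \<Rightarrow> 'k"
  assume "finite {x. u x \<noteq> 0}" "finite {y. v y \<noteq> 0}"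
  then have "finite (\<Union>x\<in>{x. u x \<noteq> 0}. \<Union>y\<in>{y. v y \<noteq> 0}.
      {z. step_like z \<and> proj_X z = x \<and> proj_Y z = y})"
    by (intro finite_UN_I finite_step_like_proj)
  then show "finite {z. (if step_like z
      then (-1) ^ elevation z * u (proj_X z) * v (proj_Y z) else 0) \<noteq> 0}"
    by (rule rev_finite_subset) auto
qed

definition cart_prod :: "'a list set \<Rightarrow> 'b list set \<Rightarrow> ('a \<times> 'b) list set" (infixr \<open>\<boxplus>\<close> 75) where
  "P \<boxplus> Q = {z. step_like z \<and> proj_X z \<in> P \<and> proj_Y z \<in> Q}"

lemma tl_remdups_adj_cases: "remdups_adj (tl x) = remdups_adj x \<or> remdups_adj (tl x) = tl (remdups_adj x)"
  by (induction x rule: remdups_adj.induct) auto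

lemma butlast_remdups_adj_cases:
  "remdups_adj (butlast x) = remdups_adj x \<or> remdups_adj (butlast x) = butlast (remdups_adj x)"
proof -
  have "butlast y = rev (tl (rev y))" for y :: "'a list"
    by (metis butlast_rev rev_rev_ident)
  then show ?thesis
    using tl_remdups_adj_cases[of "rev x"] by (metis remdups_adj_rev rev_rev_ident)
qed

lemma path_complex_cart_prod:
  assumes P: "path_complex V P" and Q: "path_complex W Q"
  shows "regular_path_complex (V \<times> W) (P \<boxplus> Q)"
proof -
  have tl: "tl z \<in> P \<boxplus> Q" and bl: "butlast z \<in> P \<boxplus> Q" if z: "z \<in> P \<boxplus> Q" for z
  proof -
    have s: "step_like (tl z)" "step_like (butlast z)"
      using z by (auto simp: cart_prod_def step_like_def distinct_adj_def successively_conv_nth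
          nth_tl nth_butlast)
    have closed: "tl x \<in> P" "butlast x \<in> P" if "x \<in> P" for x
      using P that by (cases "x = []"; auto simp: path_complex_def)+
    have closed': "tl y \<in> Q" "butlast y \<in> Q" if "y \<in> Q" for y
      using Q that by (cases "y = []"; auto simp: path_complex_def)+
    have "proj_X (tl z) \<in> P" "proj_X (butlast z) \<in> P"
      using z closed[of "proj_X z"] tl_remdups_adj_cases[of "map fst z"]
        butlast_remdups_adj_cases[of "map fst z"]
      by (auto simp: cart_prod_def proj_X_def map_tl map_butlast)
    moreover have "proj_Y (tl z) \<in> Q" "proj_Y (butlast z) \<in> Q"
      using z closed'[of "proj_Y z"] tl_remdups_adj_cases[of "map snd z"]
        butlast_remdups_adj_cases[of "map snd z"]
      by (auto simp: cart_prod_def proj_Y_def map_tl map_butlast)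
    ultimately show "tl z \<in> P \<boxplus> Q" "butlast z \<in> P \<boxplus> Q"
      using s by (auto simp: cart_prod_def)
  qed
  have sub: "set z \<subseteq> V \<times> W" if "z \<in> P \<boxplus> Q" for z
  proof
    fix w assume w: "w \<in> set z"
    have "set (proj_X z) \<subseteq> V" "set (proj_Y z) \<subseteq> W"
      using that P Q by (auto simp: cart_prod_def path_complex_def)
    then have "fst ` set z \<subseteq> V" "snd ` set z \<subseteq> W"
      by (simp_all add: proj_X_def proj_Y_def)
    with w show "w \<in> V \<times> W"
      by (auto simp: mem_Times_iff)
  qed
  show ?thesis
    unfolding regular_path_complex_def path_complex_def
    using tl bl sub P Q
    by (auto simp: path_complex_def cart_prod_def step_like_def proj_X_def proj_Y_def)
qed

end

theory Submission
  imports Defs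
begin

text \<open>
  Write \<open>R(V)\<close> for the space spanned by all paths on \<open>V\<close>. The space with basis the pairs
  \<open>(x, y)\<close> of paths is a model of \<open>R(X) \<otimes> R(Y)\<close>, in which \<open>outer u v\<close> stands for \<open>u \<otimes> v\<close> and
  tensor products of subspaces are honest subspaces (\<open>tspan\<close>). The quotient that defines the tensor
  product is identified with such a subspace once and for all in \<open>tensor_iso\<close>; from then on everything
  is linear algebra of finitely supported functions. Bases of subspaces never appear: the facts about
  tensor products that usually need them follow from the existence of linear projections.

  The cross product extends to a linear map \<open>chi\<close> from this space to \<open>R(Z)\<close>. It is injective on
  pairs of regular paths because \<open>e\<^sub>x \<times> e\<^sub>y\<close> has support exactly the staircases over \<open>(x, y)\<close>, and there
  is one for each such pair. It commutes with the boundary by the product rule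
  \<open>\<partial>(u \<times> v) = \<partial>u \<times> v + (-1)\<^sup>p u \<times> \<partial>v\<close> (\<open>boundary_cross_bv\<close>), proved by induction from recursions for
  \<open>\<partial>\<close> and \<open>\<times>\<close> in the first vertex.

  The heart of the matter is that every \<open>\<partial>\<close>-invariant \<open>w\<close> on \<open>Z\<close> is a combination of products of invariant
  elements (\<open>chi_surj\<close>). Deleting a corner of a staircase leaves a diagonal step, which is not allowed.
  Only the two staircases through that diagonal contribute to its coefficient in \<open>\<partial>w\<close>, so they have
  opposite coefficients in \<open>w\<close> (\<open>Omega_corner\<close>). Flipping corners one cell at a time shows that the coefficient
  of a staircase over \<open>(x, y)\<close> is \<open>(-1)\<^sup>L c(x, y)\<close> with \<open>L\<close> its elevation, that is, \<open>w = chi c\<close>. The product rule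
  then turns the invariance of \<open>w\<close> into the invariance of all slices \<open>c(\<cdot>, y)\<close> and \<open>c(x, \<cdot>)\<close>, and a
  function whose slices lie in \<open>U\<close> and in \<open>U'\<close> belongs to \<open>U \<otimes> U'\<close> (\<open>slices_imp_tspan\<close>).

  For the homology, each complex over a field retracts by a chain homotopy onto a harmonic part with zero
  differential that is isomorphic to its homology (\<open>harmonic_decomposition\<close>). The homotopies of two complexes
  combine to one on the tensor product (\<open>D_homotopy\<close>), whose harmonic part is the tensor product of
  the two harmonic parts; transporting this along \<open>chi\<close> gives the homology of \<open>Z\<close>.
\<close>


section \<open>Linear maps between finitely supported functions\<close>

abbreviation bv :: "'s \<Rightarrow> ('s \<Rightarrow>\<^sub>0 'k::field)" where
  "bv x \<equiv> Poly_Mapping.single x 1"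

lemma pscale_bv: "pscale c (bv x) = Poly_Mapping.single x c"
  by (rule poly_mapping_eqI) (simp add: lookup_single when_def)

abbreviation plinear :: "(('s \<Rightarrow>\<^sub>0 'k::field) \<Rightarrow> ('t \<Rightarrow>\<^sub>0 'k)) \<Rightarrow> bool" where
  "plinear \<equiv> Vector_Spaces.linear pscale pscale"

global_interpretation pmp: vector_space_pair
  "pscale :: 'k::field \<Rightarrow> ('s \<Rightarrow>\<^sub>0 'k) \<Rightarrow> _" "pscale :: 'k \<Rightarrow> ('t \<Rightarrow>\<^sub>0 'k) \<Rightarrow> _"
  by unfold_locales

lemma plinear_iff:
  "plinear f \<longleftrightarrow> (\<forall>u v. f (u + v) = f u + f v) \<and> (\<forall>c u. f (pscale c u) = pscale c (f u))"
  by (auto simp: Vector_Spaces.linear_iff intro: pm.vector_space_axioms)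

lemma plinearI:
  assumes "\<And>u v. f (u + v) = f u + f v" "\<And>c u. f (pscale c u) = pscale c (f u)"
  shows "plinear f"
  using assms by (simp add: plinear_iff)

lemma plinear_add: "plinear f \<Longrightarrow> f (u + v) = f u + f v"
  and plinear_scale: "plinear f \<Longrightarrow> f (pscale c u) = pscale c (f u)"
  by (simp_all add: plinear_iff)

lemma plinear_0: "plinear f \<Longrightarrow> f 0 = 0"
  by (metis pmp.linear_0)

lemma plinear_diff: "plinear f \<Longrightarrow> f (u - v) = f u - f v"
  by (metis pmp.linear_diff)

lemma plinear_sum: "plinear f \<Longrightarrow> f (sum g A) = (\<Sum>x\<in>A. f (g x))"
  by (metis pmp.linear_sum)

lemma plinear_ident: "plinear (\<lambda>u. u)" and plinear_id: "plinear id" and plinear_zero: "plinear (\<lambda>u. 0)"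
  by (auto simp: plinear_iff)

lemma plinear_compose: "plinear f \<Longrightarrow> plinear g \<Longrightarrow> plinear (\<lambda>u. g (f u))"
  by (simp add: plinear_iff)

lemma plinear_plus: "plinear f \<Longrightarrow> plinear g \<Longrightarrow> plinear (\<lambda>u. f u + g u)"
  and plinear_minus: "plinear f \<Longrightarrow> plinear g \<Longrightarrow> plinear (\<lambda>u. f u - g u)"
  by (simp_all add: plinear_iff algebra_simps pm.scale_right_distrib pm.scale_right_diff_distrib)

lemma plinear_scaled: "plinear f \<Longrightarrow> plinear (\<lambda>u. pscale c (f u))"
  by (simp add: plinear_iff pm.scale_right_distrib mult.commute)

lemma subspace_vimage: "plinear f \<Longrightarrow> pm.subspace S \<Longrightarrow> pm.subspace {u. f u \<in> S}"
  by (simp add: pm.subspace_def plinear_0 plinear_add plinear_scale)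

lemma plinear_span_into:
  assumes "plinear f" "pm.subspace S" "\<And>x. x \<in> A \<Longrightarrow> f x \<in> S" "u \<in> pm.span A"
  shows "f u \<in> S"
  using pm.span_minimal[of A "{u. f u \<in> S}"] subspace_vimage[OF assms(1,2)] assms(3,4) by blast

lemma plinear_eq_on_span:
  assumes "plinear f" "plinear g" "\<And>x. x \<in> A \<Longrightarrow> f x = g x" "u \<in> pm.span A"
  shows "f u = g u"
  using pmp.linear_eq_on[OF assms(1,2,4,3)] by blast

definition lin_ext :: "('s \<Rightarrow> ('t \<Rightarrow>\<^sub>0 'k::field)) \<Rightarrow> ('s \<Rightarrow>\<^sub>0 'k) \<Rightarrow> ('t \<Rightarrow>\<^sub>0 'k)" where
  "lin_ext f u = (\<Sum>x\<in>Poly_Mapping.keys u. pscale (Poly_Mapping.lookup u x) (f x))"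

lemma lin_ext_superset:
  assumes "finite K" "Poly_Mapping.keys u \<subseteq> K"
  shows "lin_ext f u = (\<Sum>x\<in>K. pscale (Poly_Mapping.lookup u x) (f x))"
  unfolding lin_ext_def
  by (rule sum.mono_neutral_left) (use assms in \<open>auto simp: in_keys_iff\<close>)

lemma plinear_lin_ext: "plinear (lin_ext f)"
proof (rule plinearI)
  fix u v :: "'b \<Rightarrow>\<^sub>0 'a"
  let ?K = "Poly_Mapping.keys u \<union> Poly_Mapping.keys v"
  have "Poly_Mapping.keys (u + v) \<subseteq> ?K"
    by (rule Poly_Mapping.keys_add)
  then show "lin_ext f (u + v) = lin_ext f u + lin_ext f v"
    by (simp add: lin_ext_superset[of ?K] lookup_add pm.scale_left_distrib sum.distrib)
next
  fix c :: 'a and u :: "'b \<Rightarrow>\<^sub>0 'a"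
  have "Poly_Mapping.keys (pscale c u) \<subseteq> Poly_Mapping.keys u"
    by (auto simp: in_keys_iff)
  then have "lin_ext f (pscale c u) = (\<Sum>x\<in>Poly_Mapping.keys u. pscale (c * Poly_Mapping.lookup u x) (f x))"
    by (simp add: lin_ext_superset[of "Poly_Mapping.keys u"])
  then show "lin_ext f (pscale c u) = pscale c (lin_ext f u)"
    by (simp add: lin_ext_def pm.scale_sum_right)
qed

lemma lin_ext_bv [simp]: "lin_ext f (bv x) = f x"
  by (simp add: lin_ext_def)

lemma lookup_lin_ext:
  "Poly_Mapping.lookup (lin_ext f u) y =
    (\<Sum>x\<in>Poly_Mapping.keys u. Poly_Mapping.lookup u x * Poly_Mapping.lookup (f x) y)"
  by (simp add: lin_ext_def lookup_sum)

lemma pm_expansion: "u = lin_ext bv u"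
proof (rule poly_mapping_eqI)
  fix y
  have "Poly_Mapping.lookup (lin_ext bv u) y =
      (\<Sum>x\<in>Poly_Mapping.keys u. if x = y then Poly_Mapping.lookup u x else 0)"
    unfolding lookup_lin_ext by (rule sum.cong) (auto simp: lookup_single when_def)
  then show "Poly_Mapping.lookup u y = Poly_Mapping.lookup (lin_ext bv u) y"
    by (simp add: in_keys_iff)
qed

text \<open>Induction over the basis: to put all elements supported in \<open>K\<close> into a subspace it suffices to put the basis
  vectors there.\<close>

lemma supported_in_subspace:
  assumes "pm.subspace S" "Poly_Mapping.keys u \<subseteq> K" "\<And>x. x \<in> K \<Longrightarrow> bv x \<in> S"
  shows "u \<in> S"
proof -
  have "lin_ext bv u \<in> S"
    unfolding lin_ext_def using assms by (auto intro!: pm.subspace_sum pm.subspace_scale)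
  then show ?thesis
    using pm_expansion[of u] by simp
qed

lemma plinear_eqI:
  assumes "plinear f" "plinear g" "Poly_Mapping.keys u \<subseteq> K" "\<And>x. x \<in> K \<Longrightarrow> f (bv x) = g (bv x)"
  shows "f u = g u"
proof -
  have "u \<in> {u. f u - g u \<in> {0}}"
    by (rule supported_in_subspace[OF subspace_vimage[OF plinear_minus[OF assms(1,2)]] assms(3)])
      (use assms(4) in \<open>auto simp: pm.subspace_def\<close>)
  then show ?thesis
    by simp
qed

lemma subspace_keys: "pm.subspace {u :: 's \<Rightarrow>\<^sub>0 'k::field. Poly_Mapping.keys u \<subseteq> K}"
proof (rule pm.subspaceI)
  fix u v :: "'s \<Rightarrow>\<^sub>0 'k"
  assume "u \<in> {u. Poly_Mapping.keys u \<subseteq> K}" "v \<in> {u. Poly_Mapping.keys u \<subseteq> K}"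
  then show "u + v \<in> {u. Poly_Mapping.keys u \<subseteq> K}"
    using Poly_Mapping.keys_add[of u v] by blast
qed (auto simp: in_keys_iff)

lemma span_bv_iff:
  "u \<in> pm.span (bv ` K) \<longleftrightarrow> Poly_Mapping.keys u \<subseteq> K"
proof
  have "pm.span (bv ` K) \<subseteq> {u. Poly_Mapping.keys u \<subseteq> K}"
    by (intro pm.span_minimal subspace_keys) auto
  then show "u \<in> pm.span (bv ` K) \<Longrightarrow> Poly_Mapping.keys u \<subseteq> K"
    by blast
  show "Poly_Mapping.keys u \<subseteq> K \<Longrightarrow> u \<in> pm.span (bv ` K)"
    by (rule supported_in_subspace[OF pm.subspace_span]) (auto intro: pm.span_base)
qed

lemma projection_onto:
  assumes "pm.subspace U"
  obtains P where "plinear P" "\<And>u. P u \<in> U" "\<And>u. u \<in> U \<Longrightarrow> P u = u"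
  using pmp.linear_exists_left_inverse_on[OF plinear_ident assms] by auto


section \<open>Outer products\<close>

definition outer :: "('s \<Rightarrow>\<^sub>0 'k::field) \<Rightarrow> ('t \<Rightarrow>\<^sub>0 'k) \<Rightarrow> ('s \<times> 't \<Rightarrow>\<^sub>0 'k)" where
  "outer u v = lin_ext (\<lambda>s. lin_ext (\<lambda>t. bv (s, t)) v) u"

lemma lookup_outer [simp]:
  "Poly_Mapping.lookup (outer u v) (s, t) = Poly_Mapping.lookup u s * Poly_Mapping.lookup v t"
proof -
  have "Poly_Mapping.lookup (lin_ext (\<lambda>t. bv (s', t)) v) (s, t)
      = (if s' = s then Poly_Mapping.lookup v t else 0)" for s'
    using arg_cong[OF pm_expansion[of v], of "\<lambda>v. Poly_Mapping.lookup v t"]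
    by (auto simp: lookup_lin_ext lookup_single when_def)
  then have "Poly_Mapping.lookup (outer u v) (s, t) = 
      (\<Sum>s'\<in>Poly_Mapping.keys u. if s' = s then Poly_Mapping.lookup u s' * Poly_Mapping.lookup v t else 0)"
    unfolding outer_def lookup_lin_ext[of "\<lambda>s. lin_ext (\<lambda>t. bv (s, t)) v" u] by (intro sum.cong) auto
  then show ?thesis
    by (simp add: in_keys_iff)
qed

lemma outer_eqI: "(\<And>s t. Poly_Mapping.lookup c (s, t) = Poly_Mapping.lookup c' (s, t)) \<Longrightarrow> c = c'"
  by (rule poly_mapping_eqI) auto

lemma plinear_outer_left: "plinear (\<lambda>u. outer u v)" and plinear_outer_right: "plinear (outer u)"
  by (auto intro!: plinearI outer_eqI simp: lookup_add algebra_simps)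

lemmas outer_linear_simps [simp] =
  plinear_add[OF plinear_outer_left] plinear_add[OF plinear_outer_right]
  plinear_scale[OF plinear_outer_left] plinear_scale[OF plinear_outer_right]
  plinear_0[OF plinear_outer_left] plinear_0[OF plinear_outer_right]
  plinear_diff[OF plinear_outer_left] plinear_diff[OF plinear_outer_right]

lemma outer_bv [simp]: "outer (bv s) (bv t) = bv (s, t)"
  by (simp add: outer_def)

definition tmap ::
    "(('s \<Rightarrow>\<^sub>0 'k::field) \<Rightarrow> ('s1 \<Rightarrow>\<^sub>0 'k)) \<Rightarrow> (('t \<Rightarrow>\<^sub>0 'k) \<Rightarrow> ('t1 \<Rightarrow>\<^sub>0 'k))
      \<Rightarrow> ('s \<times> 't \<Rightarrow>\<^sub>0 'k) \<Rightarrow> ('s1 \<times> 't1 \<Rightarrow>\<^sub>0 'k)" where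
  "tmap f g = lin_ext (\<lambda>(s, t). outer (f (bv s)) (g (bv t)))"

lemma plinear_tmap: "plinear (tmap f g)"
  by (simp add: tmap_def plinear_lin_ext)

lemma bilinear_eqI:
  assumes "\<And>v. plinear (\<lambda>u. F u v)" "\<And>u. plinear (F u)" "\<And>v. plinear (\<lambda>u. G u v)" "\<And>u. plinear (G u)"
    and "Poly_Mapping.keys u \<subseteq> K" "Poly_Mapping.keys v \<subseteq> L"
    and "\<And>s t. s \<in> K \<Longrightarrow> t \<in> L \<Longrightarrow> F (bv s) (bv t) = G (bv s) (bv t)"
  shows "F u v = G u v"
proof -
  have "F (bv s) v = G (bv s) v" if "s \<in> K" for s
    by (rule plinear_eqI[OF assms(2,4,6)]) (use assms(7) that in blast)
  then show ?thesis
    by (rule plinear_eqI[OF assms(1,3,5)])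
qed

lemma tmap_outer:
  assumes f: "plinear f" and g: "plinear g"
  shows "tmap f g (outer u v) = outer (f u) (g v)"
  by (rule bilinear_eqI[where K = UNIV and L = UNIV])
    (auto simp: tmap_def intro: plinear_compose[OF plinear_outer_left plinear_lin_ext]
       plinear_compose[OF plinear_outer_right plinear_lin_ext]
       plinear_compose[OF f plinear_outer_left] plinear_compose[OF g plinear_outer_right])

text \<open>For subspaces \<open>U\<close> and \<open>U'\<close> this is the image of \<open>U \<otimes> U'\<close> in the space with basis \<open>S \<times> T\<close>.\<close>

definition tspan :: "('s \<Rightarrow>\<^sub>0 'k::field) set \<Rightarrow> ('t \<Rightarrow>\<^sub>0 'k) set \<Rightarrow> ('s \<times> 't \<Rightarrow>\<^sub>0 'k) set" where
  "tspan U U' = pm.span {outer u v | u v. u \<in> U \<and> v \<in> U'}"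

lemma subspace_tspan: "pm.subspace (tspan U U')"
  by (simp add: tspan_def)

lemma outer_in_tspan: "u \<in> U \<Longrightarrow> v \<in> U' \<Longrightarrow> outer u v \<in> tspan U U'"
  unfolding tspan_def by (rule pm.span_base) blast

lemma tspan_into:
  assumes "plinear F" "pm.subspace S" "\<And>u v. u \<in> U \<Longrightarrow> v \<in> U' \<Longrightarrow> F (outer u v) \<in> S" "c \<in> tspan U U'"
  shows "F c \<in> S"
  using assms(4) unfolding tspan_def by (rule plinear_span_into[rotated -1]) (use assms in auto)

lemma tspan_eqI:
  assumes "plinear F" "plinear G" "\<And>u v. u \<in> U \<Longrightarrow> v \<in> U' \<Longrightarrow> F (outer u v) = G (outer u v)"
    and "c \<in> tspan U U'"
  shows "F c = G c"
  using assms(4) unfolding tspan_def by (rule plinear_eq_on_span[rotated -1]) (use assms in auto)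

text \<open>The slices of a two-variable function are its restrictions to one fixed second, respectively
  first, argument.\<close>

definition slice_left :: "'t \<Rightarrow> ('s \<times> 't \<Rightarrow>\<^sub>0 'k::field) \<Rightarrow> ('s \<Rightarrow>\<^sub>0 'k)" where
  "slice_left t = lin_ext (\<lambda>(s, t'). if t' = t then bv s else 0)"

definition slice_right :: "'s \<Rightarrow> ('s \<times> 't \<Rightarrow>\<^sub>0 'k::field) \<Rightarrow> ('t \<Rightarrow>\<^sub>0 'k)" where
  "slice_right s = lin_ext (\<lambda>(s', t). if s' = s then bv t else 0)"

lemma lookup_slice_left [simp]:
  "Poly_Mapping.lookup (slice_left t c) s = Poly_Mapping.lookup c (s, t)"
proof -
  have "Poly_Mapping.lookup (slice_left t c) s =
    (\<Sum>x\<in>Poly_Mapping.keys c. Poly_Mapping.lookup c x * Poly_Mapping.lookup (bv x) (s, t))"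
    unfolding slice_left_def lookup_lin_ext
    by (rule sum.cong) (auto simp: lookup_single when_def split: if_splits)
  then show ?thesis
    using arg_cong[OF pm_expansion[of c], of "\<lambda>v. Poly_Mapping.lookup v (s, t)"]
    by (simp add: lookup_lin_ext)
qed

lemma lookup_slice_right [simp]:
  "Poly_Mapping.lookup (slice_right s c) t = Poly_Mapping.lookup c (s, t)"
proof -
  have "Poly_Mapping.lookup (slice_right s c) t =
    (\<Sum>x\<in>Poly_Mapping.keys c. Poly_Mapping.lookup c x * Poly_Mapping.lookup (bv x) (s, t))"
    unfolding slice_right_def lookup_lin_ext
    by (rule sum.cong) (auto simp: lookup_single when_def split: if_splits)
  then show ?thesis
    using arg_cong[OF pm_expansion[of c], of "\<lambda>v. Poly_Mapping.lookup v (s, t)"]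
    by (simp add: lookup_lin_ext)
qed

lemma slice_left_tmap:
  fixes f :: "('s \<Rightarrow>\<^sub>0 'k::field) \<Rightarrow> ('s1 \<Rightarrow>\<^sub>0 'k)" and c :: "'s \<times> 't \<Rightarrow>\<^sub>0 'k"
  assumes f: "plinear f"
  shows "slice_left t (tmap f id c) = f (slice_left t c)"
proof (rule plinear_eqI[where f = "\<lambda>c. slice_left t (tmap f id c)" and
      g = "\<lambda>c. f (slice_left t c)" and u = c and K = UNIV])
  show "plinear (\<lambda>c. slice_left t (tmap f id c))" "plinear (\<lambda>c. f (slice_left t c))"
    by (auto intro: plinear_compose plinear_tmap f simp: slice_left_def plinear_lin_ext)
  fix x :: "'s \<times> 't"
  have "slice_left t (outer u (bv t')) = (if t' = t then u else 0)" for u :: "'s1 \<Rightarrow>\<^sub>0 'k" and t'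
    by (rule poly_mapping_eqI) (auto simp: lookup_single when_def)
  then show "slice_left t (tmap f id (bv x)) = f (slice_left t (bv x))"
    using plinear_0[OF f] by (cases x) (simp add: tmap_def, simp add: slice_left_def)
qed auto

lemma slice_right_tmap:
  fixes g :: "('t \<Rightarrow>\<^sub>0 'k::field) \<Rightarrow> ('t1 \<Rightarrow>\<^sub>0 'k)" and c :: "'s \<times> 't \<Rightarrow>\<^sub>0 'k"
  assumes g: "plinear g"
  shows "slice_right s (tmap id g c) = g (slice_right s c)"
proof (rule plinear_eqI[where f = "\<lambda>c. slice_right s (tmap id g c)" and
      g = "\<lambda>c. g (slice_right s c)" and u = c and K = UNIV])
  show "plinear (\<lambda>c. slice_right s (tmap id g c))" "plinear (\<lambda>c. g (slice_right s c))"
    by (auto intro: plinear_compose plinear_tmap g simp: slice_right_def plinear_lin_ext)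
  fix x :: "'s \<times> 't"
  have "slice_right s (outer (bv s') v) = (if s' = s then v else 0)" for v :: "'t1 \<Rightarrow>\<^sub>0 'k" and s'
    by (rule poly_mapping_eqI) (auto simp: lookup_single when_def)
  then show "slice_right s (tmap id g (bv x)) = g (slice_right s (bv x))"
    using plinear_0[OF g] by (cases x) (simp add: tmap_def, simp add: slice_right_def)
qed auto

text \<open>A two-variable function whose slices lie in \<open>U\<close> in one direction is fixed by
  \<open>P \<otimes> id\<close> for any projection \<open>P\<close> onto \<open>U\<close>; if its slices in the other direction lie in \<open>U'\<close>, it is
  fixed by \<open>P \<otimes> P'\<close>, whose range is \<open>U \<otimes> U'\<close>.\<close>

lemma slices_imp_tspan:
  assumes U: "pm.subspace U" and U': "pm.subspace U'"
    and left: "\<And>t. slice_left t c \<in> U" and right: "\<And>s. slice_right s c \<in> U'"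
  shows "c \<in> tspan U U'"
proof -
  obtain P where P: "plinear P" "\<And>u. P u \<in> U" "\<And>u. u \<in> U \<Longrightarrow> P u = u"
    using projection_onto[OF U] by blast
  obtain P' where P': "plinear P'" "\<And>u. P' u \<in> U'" "\<And>u. u \<in> U' \<Longrightarrow> P' u = u"
    using projection_onto[OF U'] by blast
  have "tmap P id c = c"
    using slice_left_tmap[OF P(1), of _ c] P(3)[OF left] by (metis lookup_slice_left outer_eqI)
  moreover have "tmap id P' c = c"
    using slice_right_tmap[OF P'(1), of _ c] P'(3)[OF right] by (metis lookup_slice_right outer_eqI)
  moreover have "tmap P id (tmap id P' c) = tmap P P' c"
    by (rule plinear_eqI[OF plinear_compose[OF plinear_tmap plinear_tmap] plinear_tmap, where K = UNIV])
      (auto simp: P(1) P'(1) plinear_id tmap_outer simp flip: outer_bv)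
  moreover have "tmap P P' c \<in> tspan U U'"
    by (rule plinear_span_into[OF plinear_tmap subspace_tspan, where A = "range bv"])
      (auto simp: span_bv_iff tmap_def intro!: outer_in_tspan P(2) P'(2))
  ultimately show ?thesis
    by simp
qed

section \<open>Quotients, tensor products and direct sums\<close>

lemma pm_module_simps [simp]:
  "carrier (pm_module U) = U" "\<zero>\<^bsub>pm_module U\<^esub> = 0" "x \<oplus>\<^bsub>pm_module U\<^esub> y = x + y"
  "c \<odot>\<^bsub>pm_module U\<^esub> x = pscale c x"
  by (simp_all add: pm_module_def)

lemma module_isoI:
  assumes "\<And>x. x \<in> carrier M \<Longrightarrow> h x \<in> carrier N"
    and "\<And>x y. x \<in> carrier M \<Longrightarrow> y \<in> carrier M \<Longrightarrow> h (x \<oplus>\<^bsub>M\<^esub> y) = h x \<oplus>\<^bsub>N\<^esub> h y"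
    and "\<And>c x. x \<in> carrier M \<Longrightarrow> h (c \<odot>\<^bsub>M\<^esub> x) = c \<odot>\<^bsub>N\<^esub> h x"
    and "\<And>x y. x \<in> carrier M \<Longrightarrow> y \<in> carrier M \<Longrightarrow> h x = h y \<Longrightarrow> x = y"
    and "\<And>y. y \<in> carrier N \<Longrightarrow> \<exists>x\<in>carrier M. h x = y"
  shows "h \<in> module_iso M N"
  using assms unfolding module_iso_def iso_def hom_def bij_betw_def
  by (auto intro!: inj_onI simp: image_iff) metis

lemma module_isoD:
  assumes "h \<in> module_iso M N"
  shows "x \<in> carrier M \<Longrightarrow> h x \<in> carrier N"
    and "x \<in> carrier M \<Longrightarrow> y \<in> carrier M \<Longrightarrow> h (x \<oplus>\<^bsub>M\<^esub> y) = h x \<oplus>\<^bsub>N\<^esub> h y"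
    and "x \<in> carrier M \<Longrightarrow> h (c \<odot>\<^bsub>M\<^esub> x) = c \<odot>\<^bsub>N\<^esub> h x"
    and "bij_betw h (carrier M) (carrier N)"
  using assms by (auto simp: module_iso_def iso_def hom_def)

lemma module_iso_trans:
  assumes "f \<in> module_iso M N" "g \<in> module_iso N L"
  shows "(\<lambda>x. g (f x)) \<in> module_iso M L"
proof -
  note f = module_isoD[OF assms(1)] and g = module_isoD[OF assms(2)]
  have "bij_betw (g \<circ> f) (carrier M) (carrier L)"
    using f(4) g(4) by (rule bij_betw_trans)
  then show ?thesis
    using f(1-3) g(1-3) by (auto simp: module_iso_def iso_def hom_def comp_def)
qed

text \<open>Closure of the carrier under both operations is what inverting an isomorphism and forming a tensor
  product require of a record.\<close>

definition closed_module :: "('k, 'v) module \<Rightarrow> bool" where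
  "closed_module M \<longleftrightarrow> (\<forall>x\<in>carrier M. \<forall>y\<in>carrier M. x \<oplus>\<^bsub>M\<^esub> y \<in> carrier M) \<and>
     (\<forall>c. \<forall>x\<in>carrier M. c \<odot>\<^bsub>M\<^esub> x \<in> carrier M)"

lemma module_iso_inv:
  assumes "closed_module M" "h \<in> module_iso M N"
  shows "inv_into (carrier M) h \<in> module_iso N M"
proof -
  note h = module_isoD[OF assms(2)]
  let ?g = "inv_into (carrier M) h"
  have b: "bij_betw ?g (carrier N) (carrier M)"
    using h(4) by (rule bij_betw_inv_into)
  have g: "?g y \<in> carrier M" "h (?g y) = y" if "y \<in> carrier N" for y
    using that h(4) by (auto simp: bij_betw_def inv_into_into f_inv_into_f)
  have eq: "?g y = x" if "x \<in> carrier M" "h x = y" for x y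
    using that h(4) by (auto simp: bij_betw_def)
  have "?g (x \<oplus>\<^bsub>N\<^esub> y) = ?g x \<oplus>\<^bsub>M\<^esub> ?g y" if "x \<in> carrier N" "y \<in> carrier N" for x y
    using that g assms(1) by (intro eq) (auto simp: closed_module_def h(2))
  moreover have "?g (c \<odot>\<^bsub>N\<^esub> x) = c \<odot>\<^bsub>M\<^esub> ?g x" if "x \<in> carrier N" for c x
    using that g assms(1) by (intro eq) (auto simp: closed_module_def h(3))
  ultimately show ?thesis
    using b g(1) by (auto simp: module_iso_def iso_def hom_def)
qed

lemma closed_pm_module: "pm.subspace U \<Longrightarrow> closed_module (pm_module U)"
  by (simp add: closed_module_def pm.subspace_add pm.subspace_scale)

text \<open>The function induced by \<open>f\<close> on cosets; it is meaningful when \<open>f\<close> is constant on the coset, which is what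
  \<open>takes_value\<close> records.\<close>

definition coset_value :: "('v \<Rightarrow> 'w) \<Rightarrow> 'v set \<Rightarrow> 'w" where
  "coset_value f A = f (SOME a. a \<in> A)"

definition takes_value :: "('v \<Rightarrow> 'w) \<Rightarrow> 'v set \<Rightarrow> 'w \<Rightarrow> bool" where
  "takes_value f A c \<longleftrightarrow> A \<noteq> {} \<and> (\<forall>a\<in>A. f a = c)"

lemma coset_value_eq: "takes_value f A c \<Longrightarrow> coset_value f A = c"
  unfolding coset_value_def takes_value_def using some_in_eq[of A] by blast

lemma pm_coset: "N +>\<^bsub>pm_module F\<^esub> a = (\<lambda>n. n + a) ` N"
  by (auto simp: a_r_coset_def')

lemma carrier_quot_pm: "carrier (quot_module (pm_module F) N) = (\<lambda>a. (\<lambda>n. n + a) ` N) ` F"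
  by (auto simp: quot_module_def A_RCOSETS_def' pm_coset)

lemma quot_pm_add:
  assumes "pm.subspace N"
  shows "((\<lambda>n. n + a) ` N) \<oplus>\<^bsub>quot_module (pm_module F) N\<^esub> ((\<lambda>n. n + b) ` N) = (\<lambda>n. n + (a + b)) ` N"
proof -
  have "(\<exists>n\<in>N. \<exists>m\<in>N. x = (n + a) + (m + b)) \<longleftrightarrow> (\<exists>n\<in>N. x = n + (a + b))" for x
  proof
    assume "\<exists>n\<in>N. \<exists>m\<in>N. x = (n + a) + (m + b)"
    then obtain n m where "n \<in> N" "m \<in> N" "x = (n + a) + (m + b)" by blast
    then show "\<exists>n\<in>N. x = n + (a + b)"
      by (intro bexI[of _ "n + m"]) (auto simp: algebra_simps pm.subspace_add[OF assms])
  next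
    assume "\<exists>n\<in>N. x = n + (a + b)"
    then show "\<exists>n\<in>N. \<exists>m\<in>N. x = (n + a) + (m + b)"
      using pm.subspace_0[OF assms] by (metis add.assoc add.commute add_0)
  qed
  moreover have "x \<in> ((\<lambda>n. n + a) ` N) \<oplus>\<^bsub>quot_module (pm_module F) N\<^esub> ((\<lambda>n. n + b) ` N) \<longleftrightarrow>
      (\<exists>n\<in>N. \<exists>m\<in>N. x = (n + a) + (m + b))" for x
    by (auto simp: quot_module_def set_add_def')
  ultimately show ?thesis
    by (simp add: set_eq_iff image_iff)
qed

lemma quot_pm_scale:
  assumes "pm.subspace N"
  shows "c \<odot>\<^bsub>quot_module (pm_module F) N\<^esub> ((\<lambda>n. n + a) ` N) = (\<lambda>n. n + pscale c a) ` N"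
proof -
  have "(\<exists>m\<in>N. \<exists>n\<in>N. x = n + pscale c (m + a)) \<longleftrightarrow> (\<exists>n\<in>N. x = n + pscale c a)" for x
  proof
    assume "\<exists>m\<in>N. \<exists>n\<in>N. x = n + pscale c (m + a)"
    then obtain n m where "n \<in> N" "m \<in> N" "x = n + pscale c (m + a)" by blast
    then show "\<exists>n\<in>N. x = n + pscale c a"
      by (intro bexI[of _ "n + pscale c m"])
        (auto simp: pm.scale_right_distrib add.assoc pm.subspace_add[OF assms] pm.subspace_scale[OF assms])
  next
    assume "\<exists>n\<in>N. x = n + pscale c a"
    then show "\<exists>m\<in>N. \<exists>n\<in>N. x = n + pscale c (m + a)"
      using pm.subspace_0[OF assms] by (metis add_0)
  qed
  then show ?thesis
    by (auto simp: quot_module_def pm_coset image_iff)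
qed

lemma closed_quot_module:
  assumes "pm.subspace F" "pm.subspace N"
  shows "closed_module (quot_module (pm_module F) N)"
  using assms
  by (auto simp: closed_module_def carrier_quot_pm quot_pm_add quot_pm_scale
      intro!: imageI pm.subspace_add pm.subspace_scale)

text \<open>The first isomorphism theorem. Every isomorphism below between a quotient and a space of
  finitely supported functions arises in this way.\<close>

lemma quot_module_iso:
  assumes F: "pm.subspace F" and \<Phi>: "plinear \<Phi>" and N: "N = {a \<in> F. \<Phi> a = 0}"
  shows "coset_value \<Phi> \<in> module_iso (quot_module (pm_module F) N) (pm_module (\<Phi> ` F))"
proof -
  have sN: "pm.subspace N"
    unfolding N using F
    by (auto simp: pm.subspace_def plinear_0[OF \<Phi>] plinear_add[OF \<Phi>] plinear_scale[OF \<Phi>])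
  have val: "coset_value \<Phi> ((\<lambda>n. n + a) ` N) = \<Phi> a" for a
    using pm.subspace_0[OF sN] by (intro coset_value_eq) (auto simp: takes_value_def N plinear_add[OF \<Phi>])
  have inj: "(\<lambda>n. n + a) ` N = (\<lambda>n. n + b) ` N" if "a \<in> F" "b \<in> F" "\<Phi> a = \<Phi> b" for a b
  proof -
    have sub: "(\<lambda>n. n + a) ` N \<subseteq> (\<lambda>n. n + b) ` N" if "a \<in> F" "b \<in> F" "\<Phi> a = \<Phi> b" for a b
    proof
      fix x assume "x \<in> (\<lambda>n. n + a) ` N"
      then obtain n where n: "n \<in> N" "x = n + a" by blast
      have "a - b \<in> N"
        using that by (simp add: N plinear_diff[OF \<Phi>] pm.subspace_diff[OF F])
      then have "n + (a - b) \<in> N" "x = n + (a - b) + b"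
        using n pm.subspace_add[OF sN] by auto
      then show "x \<in> (\<lambda>n. n + b) ` N" by blast
    qed
    show ?thesis
      using sub[of a b] sub[of b a] that by auto
  qed
  show ?thesis
  proof (rule module_isoI; unfold carrier_quot_pm pm_module_simps)
    fix x y assume "x \<in> (\<lambda>a. (\<lambda>n. n + a) ` N) ` F" "y \<in> (\<lambda>a. (\<lambda>n. n + a) ` N) ` F"
    then show "coset_value \<Phi> (x \<oplus>\<^bsub>quot_module (pm_module F) N\<^esub> y) = coset_value \<Phi> x + coset_value \<Phi> y"
      and "coset_value \<Phi> x = coset_value \<Phi> y \<Longrightarrow> x = y"
      by (auto simp: quot_pm_add[OF sN] val plinear_add[OF \<Phi>] dest: inj)
  next
    fix c x assume "x \<in> (\<lambda>a. (\<lambda>n. n + a) ` N) ` F"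
    then show "coset_value \<Phi> (c \<odot>\<^bsub>quot_module (pm_module F) N\<^esub> x) = pscale c (coset_value \<Phi> x)"
      by (auto simp: quot_pm_scale[OF sN] val plinear_scale[OF \<Phi>])
  qed (auto simp: val)
qed

definition tensor_lift ::
    "('v \<Rightarrow> ('s \<Rightarrow>\<^sub>0 'k::field)) \<Rightarrow> ('w \<Rightarrow> ('t \<Rightarrow>\<^sub>0 'k)) \<Rightarrow> ('v \<times> 'w \<Rightarrow>\<^sub>0 'k) \<Rightarrow> ('s \<times> 't \<Rightarrow>\<^sub>0 'k)" where
  "tensor_lift a b = lin_ext (\<lambda>(m, n). outer (a m) (b n))"

lemma plinear_tensor_lift: "plinear (tensor_lift a b)"
  by (simp add: tensor_lift_def plinear_lin_ext)

lemma tensor_lift_bv [simp]: "tensor_lift a b (bv (m, n)) = outer (a m) (b n)"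
  by (simp add: tensor_lift_def)

lemma tensor_rel_gens:
  fixes M :: "('k::field, 'v) module" and N :: "('k, 'w) module"
  shows "u \<in> carrier M \<Longrightarrow> u' \<in> carrier M \<Longrightarrow> v \<in> carrier N \<Longrightarrow>
      bv (u \<oplus>\<^bsub>M\<^esub> u', v) - bv (u, v) - bv (u', v) \<in> tensor_rel M N"
    and "u \<in> carrier M \<Longrightarrow> v \<in> carrier N \<Longrightarrow> v' \<in> carrier N \<Longrightarrow>
      bv (u, v \<oplus>\<^bsub>N\<^esub> v') - bv (u, v) - bv (u, v') \<in> tensor_rel M N"
    and "u \<in> carrier M \<Longrightarrow> v \<in> carrier N \<Longrightarrow>
      bv (c \<odot>\<^bsub>M\<^esub> u, v) - pscale c (bv (u, v)) \<in> tensor_rel M N"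
    and "u \<in> carrier M \<Longrightarrow> v \<in> carrier N \<Longrightarrow>
      bv (u, c \<odot>\<^bsub>N\<^esub> v) - pscale c (bv (u, v)) \<in> tensor_rel M N"
  unfolding tensor_rel_def by (rule pm.span_base; blast)+

lemma tensor_rel_into:
  fixes M :: "('k::field, 'v) module" and N :: "('k, 'w) module"
  assumes "pm.subspace S"
    and "\<And>u u' v. u \<in> carrier M \<Longrightarrow> u' \<in> carrier M \<Longrightarrow> v \<in> carrier N \<Longrightarrow>
      bv (u \<oplus>\<^bsub>M\<^esub> u', v) - bv (u, v) - bv (u', v) \<in> S"
    and "\<And>u v v'. u \<in> carrier M \<Longrightarrow> v \<in> carrier N \<Longrightarrow> v' \<in> carrier N \<Longrightarrow>
      bv (u, v \<oplus>\<^bsub>N\<^esub> v') - bv (u, v) - bv (u, v') \<in> S"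
    and "\<And>c u v. u \<in> carrier M \<Longrightarrow> v \<in> carrier N \<Longrightarrow> bv (c \<odot>\<^bsub>M\<^esub> u, v) - pscale c (bv (u, v)) \<in> S"
    and "\<And>c u v. u \<in> carrier M \<Longrightarrow> v \<in> carrier N \<Longrightarrow> bv (u, c \<odot>\<^bsub>N\<^esub> v) - pscale c (bv (u, v)) \<in> S"
  shows "tensor_rel M N \<subseteq> S"
  unfolding tensor_rel_def by (rule pm.span_minimal[OF _ assms(1)]) (use assms(2-5) in auto)

text \<open>A function that is linear only modulo a subspace \<open>R\<close> takes values in \<open>R\<close> as soon as it does so on basis
  vectors. This is what replaces passing to the quotient by \<open>R\<close>.\<close>

lemma linear_mod_subspace:
  assumes R: "pm.subspace R"
    and add: "\<And>x y. D (x + y) - D x - D y \<in> R"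
    and scale: "\<And>c x. D (pscale c x) - pscale c (D x) \<in> R"
    and bv: "\<And>s. D (bv s) \<in> R"
  shows "D u \<in> R"
proof -
  have "u \<in> {u. D u \<in> R}"
  proof (rule supported_in_subspace[where K = UNIV])
    show "pm.subspace {u. D u \<in> R}"
    proof (rule pm.subspaceI)
      show "0 \<in> {u. D u \<in> R}"
        using scale[of 0 0] by simp
    next
      fix x y assume "x \<in> {u. D u \<in> R}" "y \<in> {u. D u \<in> R}"
      then show "x + y \<in> {u. D u \<in> R}"
        using pm.subspace_add[OF R pm.subspace_add[OF R add[of x y], of "D x"], of "D y"] by simp
    next
      fix c x assume "x \<in> {u. D u \<in> R}"
      then show "pscale c x \<in> {u. D u \<in> R}"
        using pm.subspace_add[OF R scale[of c x] pm.subspace_scale[OF R, of "D x" c]] by simp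
    qed
  qed (use bv in auto)
  then show ?thesis by simp
qed

lemma tensor_rel_nonempty: "tensor_rel M N \<noteq> {}"
  using pm.span_zero unfolding tensor_rel_def by blast

text \<open>Modules \<open>M\<close>, \<open>N\<close> together with identifications with spaces of finitely supported functions. For chain groups these
  are identities, for homology groups they send a class to its harmonic representative.\<close>

locale tensor_factors =
  fixes M :: "('k::field, 'v) module" and N :: "('k, 'w) module"
    and a :: "'v \<Rightarrow> ('s \<Rightarrow>\<^sub>0 'k)" and b :: "'w \<Rightarrow> ('t \<Rightarrow>\<^sub>0 'k)" and U U'
  assumes a: "a \<in> module_iso M (pm_module U)" and b: "b \<in> module_iso N (pm_module U')"
    and U: "pm.subspace U" and U': "pm.subspace U'"
    and M: "closed_module M" and N: "closed_module N"
begin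

lemma a_simps:
  "u \<in> carrier M \<Longrightarrow> a u \<in> U" "u \<in> carrier M \<Longrightarrow> a (c \<odot>\<^bsub>M\<^esub> u) = pscale c (a u)"
  "u \<in> carrier M \<Longrightarrow> u' \<in> carrier M \<Longrightarrow> a (u \<oplus>\<^bsub>M\<^esub> u') = a u + a u'"
  using module_isoD[OF a] by auto

lemma b_simps:
  "v \<in> carrier N \<Longrightarrow> b v \<in> U'" "v \<in> carrier N \<Longrightarrow> b (c \<odot>\<^bsub>N\<^esub> v) = pscale c (b v)"
  "v \<in> carrier N \<Longrightarrow> v' \<in> carrier N \<Longrightarrow> b (v \<oplus>\<^bsub>N\<^esub> v') = b v + b v'"
  using module_isoD[OF b] by auto

lemma tensor_rel_subset:
  "tensor_rel M N \<subseteq> {t. Poly_Mapping.keys t \<subseteq> carrier M \<times> carrier N \<and> tensor_lift a b t = 0}"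
proof (rule tensor_rel_into)
  let ?F = "{t :: 'v \<times> 'w \<Rightarrow>\<^sub>0 'k. Poly_Mapping.keys t \<subseteq> carrier M \<times> carrier N}"
  let ?S = "{t. Poly_Mapping.keys t \<subseteq> carrier M \<times> carrier N \<and> tensor_lift a b t = 0}"
  note F = subspace_keys[of "carrier M \<times> carrier N", where 'k = 'k]
  have "?S = ?F \<inter> {t. tensor_lift a b t \<in> {0}}"
    by auto
  then show "pm.subspace ?S"
    using pm.subspace_inter[OF F subspace_vimage[OF plinear_tensor_lift pm.subspace_single_0]] by simp
  have gen: "bv x - y - z \<in> ?S" 
    if "x \<in> carrier M \<times> carrier N" "y \<in> ?F" "z \<in> ?F" "tensor_lift a b (bv x - y - z) = 0" for x y z
    using that pm.subspace_diff[OF F pm.subspace_diff[OF F, of "bv x" y], of z] by auto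
  have gen2: "bv x - pscale c (bv y) \<in> ?S"
    if "x \<in> carrier M \<times> carrier N" "y \<in> carrier M \<times> carrier N"
      "tensor_lift a b (bv x - pscale c (bv y)) = 0" for x y c
    using that pm.subspace_diff[OF F, of "bv x" "pscale c (bv y)"] pm.subspace_scale[OF F, of "bv y" c]
    by auto
  note [simp] = plinear_diff[OF plinear_tensor_lift] plinear_scale[OF plinear_tensor_lift] a_simps b_simps
  show "bv (u \<oplus>\<^bsub>M\<^esub> u', v) - bv (u, v) - bv (u', v) \<in> ?S"
    if "u \<in> carrier M" "u' \<in> carrier M" "v \<in> carrier N" for u u' v
    using that M by (intro gen) (auto simp: closed_module_def)
  show "bv (u, v \<oplus>\<^bsub>N\<^esub> v') - bv (u, v) - bv (u, v') \<in> ?S"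
    if "u \<in> carrier M" "v \<in> carrier N" "v' \<in> carrier N" for u v v'
    using that N by (intro gen) (auto simp: closed_module_def)
  show "bv (c \<odot>\<^bsub>M\<^esub> u, v) - pscale c (bv (u, v)) \<in> ?S"
    if "u \<in> carrier M" "v \<in> carrier N" for c u v
    using that M by (intro gen2) (auto simp: closed_module_def)
  show "bv (u, c \<odot>\<^bsub>N\<^esub> v) - pscale c (bv (u, v)) \<in> ?S"
    if "u \<in> carrier M" "v \<in> carrier N" for c u v
    using that N by (intro gen2) (auto simp: closed_module_def)
qed

text \<open>Projections \<open>P\<close>, \<open>P'\<close> onto \<open>U\<close>, \<open>U'\<close> give a map \<open>G\<close> from the space with basis \<open>S \<times> T\<close> back
  to the free space, sending \<open>(s, t)\<close> to the generator \<open>(P s, P' t)\<close>. It inverts the lift modulo the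
  tensor relations, so elements in the kernel of the lift are relations. This avoids choosing bases
  of \<open>U\<close> and \<open>U'\<close>.\<close>

lemma tensor_lift_kernel:
  assumes t: "Poly_Mapping.keys t \<subseteq> carrier M \<times> carrier N" and t0: "tensor_lift a b t = 0"
  shows "t \<in> tensor_rel M N"
proof -
  obtain P where P: "plinear P" "\<And>u. P u \<in> U" "\<And>u. u \<in> U \<Longrightarrow> P u = u"
    using projection_onto[OF U] by blast
  obtain P' where P': "plinear P'" "\<And>u. P' u \<in> U'" "\<And>u. u \<in> U' \<Longrightarrow> P' u = u"
    using projection_onto[OF U'] by blast
  define a' where "a' = inv_into (carrier M) a"
  define b' where "b' = inv_into (carrier N) b"
  have "a' \<in> module_iso (pm_module U) M" "b' \<in> module_iso (pm_module U') N"
    unfolding a'_def b'_def using a b M N by (auto intro: module_iso_inv)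
  note a' = module_isoD[OF this(1), simplified] and b' = module_isoD[OF this(2), simplified]
  have inv: "a' (a m) = m" "b' (b n) = n" if "m \<in> carrier M" "n \<in> carrier N" for m n
    using that module_isoD(4)[OF a] module_isoD(4)[OF b] by (auto simp: a'_def b'_def bij_betw_def)
  have sR: "pm.subspace (tensor_rel M N)"
    by (simp add: tensor_rel_def)
  define K :: "('s \<Rightarrow>\<^sub>0 'k) \<Rightarrow> ('t \<Rightarrow>\<^sub>0 'k) \<Rightarrow> ('v \<times> 'w \<Rightarrow>\<^sub>0 'k)"
    where "K u v = bv (a' (P u), b' (P' v))" for u v
  define G where "G = lin_ext (\<lambda>(s, t). K (bv s) (bv t))"
  have G: "plinear G"
    by (simp add: G_def plinear_lin_ext)
  have K1: "K (u + u') v - K u v - K u' v \<in> tensor_rel M N"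
    and K2: "K u (v + v') - K u v - K u v' \<in> tensor_rel M N"
    and K3: "K (pscale c u) v - pscale c (K u v) \<in> tensor_rel M N"
    and K4: "K u (pscale c v) - pscale c (K u v) \<in> tensor_rel M N" for u u' v v' c
    using tensor_rel_gens(1)[of "a' (P u)" M "a' (P u')" "b' (P' v)" N]
      tensor_rel_gens(2)[of "a' (P u)" M "b' (P' v)" N "b' (P' v')"]
      tensor_rel_gens(3,4)[of "a' (P u)" M "b' (P' v)" N c]
    by (simp_all add: K_def plinear_add[OF P(1)] plinear_add[OF P'(1)] plinear_scale[OF P(1)]
      plinear_scale[OF P'(1)] a' b' P(2) P'(2))
  have GK: "G (outer u v) - K u v \<in> tensor_rel M N" for u v
  proof (rule linear_mod_subspace[OF sR, where D = "\<lambda>u. G (outer u v) - K u v"])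
    show "G (outer (x + y) v) - K (x + y) v - (G (outer x v) - K x v) - (G (outer y v) - K y v) \<in> tensor_rel M N"
      for x y
      using pm.subspace_neg[OF sR K1[of x y v]] by (simp add: plinear_add[OF G] algebra_simps)
    show "G (outer (pscale c x) v) - K (pscale c x) v - pscale c (G (outer x v) - K x v) \<in> tensor_rel M N"
      for c x
      using pm.subspace_neg[OF sR K3[of c x v]]
      by (simp add: plinear_scale[OF G] pm.scale_right_diff_distrib)
    show "G (outer (bv s) v) - K (bv s) v \<in> tensor_rel M N" for s
    proof (rule linear_mod_subspace[OF sR, where D = "\<lambda>v. G (outer (bv s) v) - K (bv s) v"])
      show "G (outer (bv s) (x + y)) - K (bv s) (x + y) - (G (outer (bv s) x) - K (bv s) x)
          - (G (outer (bv s) y) - K (bv s) y) \<in> tensor_rel M N" for x y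
        using pm.subspace_neg[OF sR K2[of "bv s" x y]] by (simp add: plinear_add[OF G] algebra_simps)
      show "G (outer (bv s) (pscale c x)) - K (bv s) (pscale c x)
          - pscale c (G (outer (bv s) x) - K (bv s) x) \<in> tensor_rel M N" for c x
        using pm.subspace_neg[OF sR K4[of "bv s" c x]]
        by (simp add: plinear_scale[OF G] pm.scale_right_diff_distrib)
      show "G (outer (bv s) (bv t)) - K (bv s) (bv t) \<in> tensor_rel M N" for t
        using pm.subspace_0[OF sR] by (simp add: G_def)
    qed
  qed
  have "t \<in> {t. G (tensor_lift a b t) - t \<in> tensor_rel M N}"
  proof (rule supported_in_subspace[OF _ t])
    show "pm.subspace {t. G (tensor_lift a b t) - t \<in> tensor_rel M N}"
      by (intro subspace_vimage sR plinear_minus plinear_compose[OF plinear_tensor_lift G] plinear_ident)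
    fix x assume "x \<in> carrier M \<times> carrier N"
    then show "bv x \<in> {t. G (tensor_lift a b t) - t \<in> tensor_rel M N}"
      using GK[of "a (fst x)" "b (snd x)"] by (auto simp: K_def P(3) P'(3) a_simps b_simps inv)
  qed
  then show ?thesis
    using pm.subspace_neg[OF sR, of "- t"] by (simp add: t0 plinear_0[OF G])
qed

lemma tensor_rel_eq:
  "tensor_rel M N = {t \<in> {t. Poly_Mapping.keys t \<subseteq> carrier M \<times> carrier N}. tensor_lift a b t = 0}"
  using tensor_rel_subset tensor_lift_kernel by blast

lemma tensor_lift_image:
  "tensor_lift a b ` {t. Poly_Mapping.keys t \<subseteq> carrier M \<times> carrier N} = tspan U U'"
proof -
  have "bij_betw a (carrier M) U" "bij_betw b (carrier N) U'"
    using module_isoD(4)[OF a] module_isoD(4)[OF b] by simp_all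
  then have "U = a ` carrier M" "U' = b ` carrier N"
    by (simp_all add: bij_betw_def)
  then have "{outer u v | u v. u \<in> U \<and> v \<in> U'} = tensor_lift a b ` bv ` (carrier M \<times> carrier N)"
    by (force simp: image_image)
  moreover have "pm.span (tensor_lift a b ` B) = tensor_lift a b ` pm.span B" for B
    using pmp.linear_span_image[OF plinear_tensor_lift] by blast
  moreover have "{t :: 'v \<times> 'w \<Rightarrow>\<^sub>0 'k. Poly_Mapping.keys t \<subseteq> carrier M \<times> carrier N} = pm.span (bv ` (carrier M \<times> carrier N))"
    by (simp add: set_eq_iff span_bv_iff)
  ultimately show ?thesis
    unfolding tspan_def by simp
qed

lemma tensor_iso: "coset_value (tensor_lift a b) \<in> module_iso (tensor M N) (pm_module (tspan U U'))"
  using quot_module_iso[OF subspace_keys plinear_tensor_lift tensor_rel_eq]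
  by (simp add: tensor_def tensor_free_def tensor_lift_image)

lemma tensor_coset_value:
  "takes_value (tensor_lift a b) (tensor_rel M N +>\<^bsub>tensor_free M N\<^esub> t) (tensor_lift a b t)"
  using tensor_rel_nonempty[of M N]
  by (auto simp: takes_value_def tensor_free_def pm_coset tensor_rel_eq plinear_add[OF plinear_tensor_lift])

lemmas coset_value_tensor_coset = coset_value_eq[OF tensor_coset_value]

lemma coset_value_pure_tensor: "coset_value (tensor_lift a b) (pure_tensor M N u v) = outer (a u) (b v)"
  by (simp add: pure_tensor_def coset_value_tensor_coset)

lemma tensor_lift_const_on_coset:
  assumes "A \<in> carrier (tensor M N)"
  shows "A \<noteq> {}" "t \<in> A \<Longrightarrow> tensor_lift a b t = coset_value (tensor_lift a b) A"
proof -
  obtain s where "A = tensor_rel M N +>\<^bsub>tensor_free M N\<^esub> s"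
    using assms by (auto simp: tensor_def tensor_free_def carrier_quot_pm pm_coset)
  then have v: "takes_value (tensor_lift a b) A (tensor_lift a b s)"
    by (simp add: tensor_coset_value)
  then show "A \<noteq> {}" "t \<in> A \<Longrightarrow> tensor_lift a b t = coset_value (tensor_lift a b) A"
    using coset_value_eq[OF v] by (auto simp: takes_value_def)
qed

lemma takes_value_add:
  assumes "takes_value (tensor_lift a b) A x" "takes_value (tensor_lift a b) B y"
  shows "takes_value (tensor_lift a b) (A \<oplus>\<^bsub>tensor M N\<^esub> B) (x + y)"
  using assms
  by (auto simp: takes_value_def tensor_def tensor_free_def quot_module_def set_add_def'
      plinear_add[OF plinear_tensor_lift])

lemma takes_value_scale:
  assumes "takes_value (tensor_lift a b) A x"
  shows "takes_value (tensor_lift a b) (c \<odot>\<^bsub>tensor M N\<^esub> A) (pscale c x)"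
  using assms tensor_rel_nonempty[of M N]
  by (auto simp: takes_value_def tensor_def tensor_free_def quot_module_def pm_coset tensor_rel_eq
      plinear_add[OF plinear_tensor_lift] plinear_scale[OF plinear_tensor_lift])

lemma coset_value_tensor_zero: "coset_value (tensor_lift a b) \<zero>\<^bsub>tensor M N\<^esub> = 0"
  using coset_value_tensor_coset[of 0] plinear_0[OF plinear_tensor_lift]
  by (simp add: tensor_free_def pm_coset tensor_def quot_module_def)

end

lemma closed_tensor: "closed_module (tensor M N)"
  unfolding tensor_def tensor_free_def
  by (rule closed_quot_module[OF subspace_keys]) (simp add: tensor_rel_def)

lemma closed_direct_sum:
  assumes "finite I" "\<And>i. i \<in> I \<Longrightarrow> closed_module (M i)"
  shows "closed_module (direct_sum I M)"
  using assms by (auto simp: closed_module_def direct_sum_def PiE_def Pi_def)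

text \<open>Subspaces \<open>S i\<close> separated by linear maps \<open>\<rho> i\<close>, which pick out one component and kill the others, form
  an internal direct sum.\<close>

lemma direct_sum_iso:
  fixes S :: "'i \<Rightarrow> ('s \<Rightarrow>\<^sub>0 'k::field) set"
  assumes I: "finite I" and h: "\<And>i. i \<in> I \<Longrightarrow> h i \<in> module_iso (M i) (pm_module (S i))"
    and S: "\<And>i. i \<in> I \<Longrightarrow> pm.subspace (S i)"
    and \<rho>: "\<And>i. i \<in> I \<Longrightarrow> plinear (\<rho> i)"
    and \<rho>_S: "\<And>i j s. i \<in> I \<Longrightarrow> j \<in> I \<Longrightarrow> s \<in> S j \<Longrightarrow> \<rho> i s = (if i = j then s else 0)"
  shows "(\<lambda>f. \<Sum>i\<in>I. h i (f i)) \<in> module_iso (direct_sum I M) (pm_module (pm.span (\<Union>i\<in>I. S i)))"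
proof (rule module_isoI)
  note hD = module_isoD[OF h, simplified]
  have carr: "carrier (direct_sum I M) = (\<Pi>\<^sub>E i\<in>I. carrier (M i))"
    using I by (auto simp: direct_sum_def)
  let ?\<Phi> = "\<lambda>f. \<Sum>i\<in>I. h i (f i)"
  have comp: "\<rho> i (?\<Phi> f) = h i (f i)" if "f \<in> carrier (direct_sum I M)" "i \<in> I" for f i
  proof -
    have "\<rho> i (?\<Phi> f) = (\<Sum>j\<in>I. \<rho> i (h j (f j)))"
      by (rule plinear_sum[OF \<rho>[OF that(2)]])
    also have "\<dots> = (\<Sum>j\<in>I. if j = i then h j (f j) else 0)"
      using that by (intro sum.cong) (auto simp: carr \<rho>_S[OF that(2)] hD PiE_def Pi_def)
    finally show ?thesis
      using that I by simp
  qed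
  show "?\<Phi> f \<in> carrier (pm_module (pm.span (\<Union>i\<in>I. S i)))" if "f \<in> carrier (direct_sum I M)" for f
  proof -
    have "h i (f i) \<in> S i" if "i \<in> I" for i
      using hD(1)[OF that, of "f i"] \<open>f \<in> _\<close> that by (auto simp: carr)
    then show ?thesis
      by (auto intro!: pm.span_sum intro: pm.span_base)
  qed
  show "?\<Phi> (f \<oplus>\<^bsub>direct_sum I M\<^esub> g) = ?\<Phi> f \<oplus>\<^bsub>pm_module (pm.span (\<Union>i\<in>I. S i))\<^esub> ?\<Phi> g"
    if "f \<in> carrier (direct_sum I M)" "g \<in> carrier (direct_sum I M)" for f g
  proof -
    have "h i (f i \<oplus>\<^bsub>M i\<^esub> g i) = h i (f i) + h i (g i)" if "i \<in> I" for i
      using that \<open>f \<in> _\<close> \<open>g \<in> _\<close> by (auto simp: carr hD PiE_def Pi_def)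
    then show ?thesis
      by (simp add: direct_sum_def sum.distrib)
  qed
  show "?\<Phi> (c \<odot>\<^bsub>direct_sum I M\<^esub> f) = c \<odot>\<^bsub>pm_module (pm.span (\<Union>i\<in>I. S i))\<^esub> ?\<Phi> f"
    if "f \<in> carrier (direct_sum I M)" for c f
  proof -
    have "h i (c \<odot>\<^bsub>M i\<^esub> f i) = pscale c (h i (f i))" if "i \<in> I" for i
      using that \<open>f \<in> _\<close> by (auto simp: carr hD PiE_def Pi_def)
    then show ?thesis
      by (simp add: direct_sum_def pm.scale_sum_right)
  qed
  show "f = g" if f: "f \<in> carrier (direct_sum I M)" and g: "g \<in> carrier (direct_sum I M)"
    and eq: "?\<Phi> f = ?\<Phi> g" for f g
  proof (rule PiE_ext)
    show "f \<in> (\<Pi>\<^sub>E i\<in>I. carrier (M i))" "g \<in> (\<Pi>\<^sub>E i\<in>I. carrier (M i))"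
      using f g by (simp_all add: carr)
    fix i assume i: "i \<in> I"
    then have "h i (f i) = h i (g i)"
      using comp[OF f i] comp[OF g i] eq by simp
    moreover have "inj_on (h i) (carrier (M i))"
      using hD(4)[OF i] by (simp add: bij_betw_def)
    ultimately show "f i = g i"
      using f g i by (auto simp: carr PiE_def Pi_def dest: inj_onD)
  qed
  show "\<exists>f\<in>carrier (direct_sum I M). ?\<Phi> f = s" if "s \<in> carrier (pm_module (pm.span (\<Union>i\<in>I. S i)))" for s
  proof -
    have s: "s \<in> pm.span (\<Union>i\<in>I. S i)"
      using that by simp
    have \<rho>s: "\<rho> i s \<in> S i" if "i \<in> I" for i
      by (rule plinear_span_into[OF \<rho>[OF that] S[OF that] _ s])
        (use that \<rho>_S pm.subspace_0[OF S] in auto)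
    have "(\<Sum>i\<in>I. \<rho> i s) = s"
    proof (rule plinear_eq_on_span[OF _ plinear_ident _ s])
      show "plinear (\<lambda>s. \<Sum>i\<in>I. \<rho> i s)"
        by (intro plinearI)
          (simp_all add: plinear_add[OF \<rho>] plinear_scale[OF \<rho>] sum.distrib pm.scale_sum_right)
      fix x assume "x \<in> (\<Union>i\<in>I. S i)"
      then obtain j where j: "j \<in> I" "x \<in> S j" by blast
      then have "(\<Sum>i\<in>I. \<rho> i x) = (\<Sum>i\<in>I. if i = j then x else 0)"
        by (intro sum.cong) (auto simp: \<rho>_S)
      then show "(\<Sum>i\<in>I. \<rho> i x) = x"
        using j I by simp
    qed
    moreover define f where "f = (\<lambda>i\<in>I. inv_into (carrier (M i)) (h i) (\<rho> i s))"
    have fi: "f i \<in> carrier (M i) \<and> h i (f i) = \<rho> i s" if "i \<in> I" for i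
      using that \<rho>s[OF that] hD(4)[OF that]
      by (auto simp: f_def bij_betw_def inv_into_into f_inv_into_f)
    ultimately have "?\<Phi> f = s"
      by (metis (mono_tags, lifting) sum.cong)
    moreover have "f \<in> carrier (direct_sum I M)"
      using fi by (auto simp: carr f_def)
    ultimately show ?thesis by blast
  qed
qed

section \<open>Graded complexes and their harmonic parts\<close>

text \<open>A grading \<open>dg\<close> of the basis vectors, and for each \<open>n\<close> a subspace supported in degree \<open>n\<close>.\<close>

locale graded_spaces =
  fixes dg :: "'s \<Rightarrow> nat" and C :: "nat \<Rightarrow> ('s \<Rightarrow>\<^sub>0 'k::field) set"
  assumes subspace_C: "pm.subspace (C n)"
    and keys_C: "u \<in> C n \<Longrightarrow> Poly_Mapping.keys u \<subseteq> {x. dg x = n}"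
begin

text \<open>A family of linear maps, one per degree, is thereby glued to a single linear map.\<close>

lemma graded_lin_ext:
  assumes "plinear (F n)" "u \<in> C n"
  shows "lin_ext (\<lambda>x. F (dg x) (bv x)) u = F n u"
  by (rule plinear_eqI[OF plinear_lin_ext assms(1) keys_C[OF assms(2)]]) simp

end

locale graded_complex = graded_spaces dg C
  for dg :: "'s \<Rightarrow> nat" and C :: "nat \<Rightarrow> ('s \<Rightarrow>\<^sub>0 'k::field) set" +
  fixes d :: "('s \<Rightarrow>\<^sub>0 'k) \<Rightarrow> ('s \<Rightarrow>\<^sub>0 'k)"
  assumes d: "plinear d"
    and d_C: "u \<in> C (Suc n) \<Longrightarrow> d u \<in> C n"
    and d_C0: "u \<in> C 0 \<Longrightarrow> d u = 0"
    and d_d: "u \<in> C n \<Longrightarrow> d (d u) = 0"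

text \<open>The data \<open>\<pi>\<close>, \<open>h\<close> exhibit the complex as the direct sum of its harmonic part \<open>\<pi> C\<close>,
  on which the differential vanishes, and a contractible complex.\<close>

locale harmonic_complex = graded_complex dg C d
  for dg :: "'s \<Rightarrow> nat" and C :: "nat \<Rightarrow> ('s \<Rightarrow>\<^sub>0 'k::field) set" and d +
  fixes \<pi> h :: "('s \<Rightarrow>\<^sub>0 'k) \<Rightarrow> ('s \<Rightarrow>\<^sub>0 'k)"
  assumes \<pi>: "plinear \<pi>" and h: "plinear h"
    and h_C: "u \<in> C n \<Longrightarrow> h u \<in> C (Suc n)"
    and \<pi>_C: "u \<in> C n \<Longrightarrow> \<pi> u \<in> C n"
    and d_\<pi>: "u \<in> C n \<Longrightarrow> d (\<pi> u) = 0"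
    and \<pi>_d: "u \<in> C n \<Longrightarrow> \<pi> (d u) = 0"
    and \<pi>_\<pi>: "u \<in> C n \<Longrightarrow> \<pi> (\<pi> u) = \<pi> u"
    and homotopy: "u \<in> C n \<Longrightarrow> d (h u) + h (d u) = u - \<pi> u"

text \<open>Let \<open>P\<close> be a projection onto the boundaries \<open>d C\<close> and \<open>\<sigma>\<close> a linear section of \<open>d\<close> over them.
  Then \<open>\<sigma> \<circ> P\<close> is a homotopy between the identity and a chain map \<open>\<pi>\<close> annihilating boundaries;
  subtracting \<open>P \<circ> \<sigma> \<circ> P\<close> makes \<open>\<pi>\<close> idempotent. Since \<open>P\<close> and \<open>\<sigma>\<close> depend on the degree, they are
  assembled from their values on basis vectors.\<close>

lemma (in graded_complex) harmonic_decomposition: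
  obtains \<pi> h where "harmonic_complex dg C d \<pi> h"
proof -
  define B where "B n = d ` C (Suc n)" for n
  have B: "pm.subspace (B n)" for n
    unfolding B_def by (rule pmp.linear_subspace_image[OF d subspace_C])
  have "\<exists>P. \<forall>n. plinear (P n) \<and> (\<forall>u. P n u \<in> B n) \<and> (\<forall>u\<in>B n. P n u = u)"
    by (rule choice) (use projection_onto[OF B] in metis)
  then obtain P where P: "\<And>n. plinear (P n)" "\<And>n u. P n u \<in> B n" "\<And>n u. u \<in> B n \<Longrightarrow> P n u = u"
    by blast
  have "\<exists>\<sigma>. \<forall>n. range (\<sigma> n) \<subseteq> C (Suc n) \<and> plinear (\<sigma> n) \<and> (\<forall>u\<in>B n. d (\<sigma> n u) = u)"
    unfolding B_def by (rule choice) (use pmp.linear_exists_right_inverse_on[OF d subspace_C] in blast)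
  then obtain \<sigma> where \<sigma>: "\<And>n u. \<sigma> n u \<in> C (Suc n)" "\<And>n. plinear (\<sigma> n)" "\<And>n u. u \<in> B n \<Longrightarrow> d (\<sigma> n u) = u"
    by (metis rangeI subsetD)
  define hn where "hn n u = \<sigma> n (P n u) - P (Suc n) (\<sigma> n (P n u))" for n u
  have hn: "plinear (hn n)" for n
    unfolding hn_def
    by (intro plinear_minus plinear_compose[OF plinear_compose[OF P(1) \<sigma>(2)] P(1)]
        plinear_compose[OF P(1) \<sigma>(2)])
  have BC: "B n \<subseteq> C n" for n
    using d_C by (auto simp: B_def)
  have dB: "d u = 0" if "u \<in> B n" for n u
    using that d_d by (auto simp: B_def)
  define h where "h = lin_ext (\<lambda>x. hn (dg x) (bv x))"
  have h: "plinear h"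
    by (simp add: h_def plinear_lin_ext)
  have h_eq: "h u = hn n u" if "u \<in> C n" for n u
    unfolding h_def by (rule graded_lin_ext[OF hn that])
  have h_C: "h u \<in> C (Suc n)" if "u \<in> C n" for n u
    unfolding h_eq[OF that] hn_def using \<sigma>(1) P(2) BC by (blast intro: pm.subspace_diff[OF subspace_C])
  have dh: "d (h u) = P n u" if "u \<in> C n" for n u
    by (simp add: h_eq[OF that] hn_def plinear_diff[OF d] \<sigma>(3) P(2) dB[OF P(2)])
  have Ph: "P (Suc n) (h u) = 0" if "u \<in> C n" for n u
    by (simp add: h_eq[OF that] hn_def plinear_diff[OF P(1)] P(2,3))
  have hd_C: "h (d u) \<in> C n" if "u \<in> C n" for n u
    using that by (cases n) (auto simp: d_C0 plinear_0[OF h] pm.subspace_0[OF subspace_C] intro: h_C d_C)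
  have dhd: "d (h (d u)) = d u" if "u \<in> C n" for n u
  proof (cases n)
    case 0
    then show ?thesis
      using that by (simp add: d_C0 plinear_0[OF h] plinear_0[OF d])
  next
    case (Suc m)
    then show ?thesis
      using that dh[of "d u" m] P(3)[of "d u" m] by (simp add: d_C B_def)
  qed
  have Phd: "P n (h (d u)) = 0" if "u \<in> C n" for n u
    using that by (cases n) (auto simp: d_C0 plinear_0[OF h] plinear_0[OF P(1)] intro: Ph d_C)
  define \<pi> where "\<pi> u = u - d (h u) - h (d u)" for u
  have \<pi>: "plinear \<pi>"
    unfolding \<pi>_def by (intro plinear_minus plinear_ident plinear_compose[OF h d] plinear_compose[OF d h])
  have \<pi>_C: "\<pi> u \<in> C n" if "u \<in> C n" for n u
    unfolding \<pi>_def using that by (intro pm.subspace_diff[OF subspace_C] hd_C d_C h_C)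
  have d_\<pi>: "d (\<pi> u) = 0" if "u \<in> C n" for n u
    using that by (simp add: \<pi>_def plinear_diff[OF d] dhd dh dB[OF P(2)])
  have "harmonic_complex dg C d \<pi> h"
  proof
    fix u n assume u: "u \<in> C n"
    show "\<pi> (d u) = 0"
      by (simp add: \<pi>_def dhd[OF u] d_d[OF u] plinear_0[OF h])
    have "P n (\<pi> u) = 0"
      using u by (simp add: \<pi>_def plinear_diff[OF P(1)] dh P(2,3) Phd)
    then show "\<pi> (\<pi> u) = \<pi> u"
      unfolding \<pi>_def[of "\<pi> u"] using u dh[OF \<pi>_C[OF u]] by (simp add: d_\<pi> plinear_0[OF h])
    show "d (h u) + h (d u) = u - \<pi> u"
      by (simp add: \<pi>_def)
  qed (auto simp: plinear_add[OF \<pi>] plinear_scale[OF \<pi>] plinear_add[OF h] plinear_scale[OF h] h_C \<pi>_C d_\<pi>)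
  then show thesis
    by (rule that)
qed

context harmonic_complex
begin

definition harm :: "nat \<Rightarrow> ('s \<Rightarrow>\<^sub>0 'k) set" where
  "harm n = \<pi> ` {u \<in> C n. d u = 0}"

lemma subspace_cycles: "pm.subspace {u \<in> C n. d u = 0}"
  using subspace_C[of n]
  by (auto simp: pm.subspace_def plinear_0[OF d] plinear_add[OF d] plinear_scale[OF d])

lemma harmD: "u \<in> harm n \<Longrightarrow> u \<in> C n \<and> d u = 0 \<and> \<pi> u = u"
  by (auto simp: harm_def \<pi>_C d_\<pi> \<pi>_\<pi>)

lemma \<pi>_harm: "u \<in> C n \<Longrightarrow> \<pi> u \<in> harm n"
  unfolding harm_def by (rule image_eqI[of _ _ "\<pi> u"]) (auto simp: \<pi>_\<pi> \<pi>_C d_\<pi>)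

lemma subspace_harm: "pm.subspace (harm n)"
  unfolding harm_def by (rule pmp.linear_subspace_image[OF \<pi> subspace_cycles])

lemma boundaries_eq_kernel: "d ` C (Suc n) = {u \<in> {u \<in> C n. d u = 0}. \<pi> u = 0}"
proof safe
  fix u assume u: "u \<in> C n" "d u = 0" "\<pi> u = 0"
  then have "u = d (h u)"
    using homotopy[OF u(1)] by (simp add: plinear_0[OF h])
  then show "u \<in> d ` C (Suc n)"
    using h_C[OF u(1)] by blast
qed (auto simp: d_C d_d \<pi>_d)

end

definition pm_complex :: "(nat \<Rightarrow> ('s \<Rightarrow>\<^sub>0 'k::field) set) \<Rightarrow> (('s \<Rightarrow>\<^sub>0 'k) \<Rightarrow> ('s \<Rightarrow>\<^sub>0 'k))
    \<Rightarrow> ('k, 's \<Rightarrow>\<^sub>0 'k) chain_cplx" where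
  "pm_complex C d = \<lparr>cobj = \<lambda>n. pm_module (C n), cdiff = \<lambda>n. d\<rparr>"

lemma pm_complex_cobj: "cobj (pm_complex C d) n = pm_module (C n)"
  by (simp add: pm_complex_def)

lemma homology_pm_complex:
  assumes "\<And>u. u \<in> C 0 \<Longrightarrow> d u = 0"
  shows "homology (pm_complex C d) n = quot_module (pm_module {u \<in> C n. d u = 0}) (d ` C (Suc n))"
proof -
  have "cycles (pm_complex C d) n = {u \<in> C n. d u = 0}"
    using assms by (auto simp: cycles_def pm_complex_def split: nat.split)
  then show ?thesis
    by (simp add: homology_def boundaries_def pm_complex_def pm_module_def)
qed

lemma (in harmonic_complex) homology_iso_harm:
  "coset_value \<pi> \<in> module_iso (homology (pm_complex C d) n) (pm_module (harm n))"
  "closed_module (homology (pm_complex C d) n)"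
proof -
  have eq: "homology (pm_complex C d) n = quot_module (pm_module {u \<in> C n. d u = 0}) (d ` C (Suc n))"
    by (rule homology_pm_complex[OF d_C0])
  show "coset_value \<pi> \<in> module_iso (homology (pm_complex C d) n) (pm_module (harm n))"
    unfolding eq harm_def by (rule quot_module_iso[OF subspace_cycles \<pi> boundaries_eq_kernel])
  show "closed_module (homology (pm_complex C d) n)"
    unfolding eq
    by (intro closed_quot_module subspace_cycles pmp.linear_subspace_image[OF d] subspace_C)
qed


section \<open>Tensor products of graded complexes\<close>

lemma finite_bidegrees: "finite (bidegrees r)"
  by (rule finite_subset[of _ "{..r} \<times> {..r}"]) (auto simp: bidegrees_def)

lemma sum_bidegrees: "(\<Sum>i\<in>bidegrees r. f i) = (\<Sum>p\<le>r. f (p, r - p))"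
proof -
  have "bidegrees r = (\<lambda>p. (p, r - p)) ` {..r}"
    by (auto simp: bidegrees_def)
  then show ?thesis
    by (simp add: sum.reindex inj_on_def)
qed

text \<open>The part of total degree \<open>r\<close> of the tensor product of two graded spaces.\<close>

definition gspan ::
    "(nat \<Rightarrow> ('s \<Rightarrow>\<^sub>0 'k::field) set) \<Rightarrow> (nat \<Rightarrow> ('t \<Rightarrow>\<^sub>0 'k) set) \<Rightarrow> nat \<Rightarrow> ('s \<times> 't \<Rightarrow>\<^sub>0 'k) set" where
  "gspan C C' r = pm.span (\<Union>(p, q)\<in>bidegrees r. tspan (C p) (C' q))"

lemma subspace_gspan: "pm.subspace (gspan C C' r)"
  by (simp add: gspan_def)

lemma tspan_subset_gspan: "tspan (C p) (C' q) \<subseteq> gspan C C' (p + q)"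
proof
  fix c assume "c \<in> tspan (C p) (C' q)"
  then show "c \<in> gspan C C' (p + q)"
    unfolding gspan_def by (intro pm.span_base) (auto simp: bidegrees_def)
qed

lemma outer_in_gspan: "u \<in> C p \<Longrightarrow> v \<in> C' q \<Longrightarrow> p + q = r \<Longrightarrow> outer u v \<in> gspan C C' r"
  using tspan_subset_gspan outer_in_tspan by blast

lemma gspan_into:
  assumes F: "plinear F" and S: "pm.subspace S"
    and gen: "\<And>p q u v. p + q = r \<Longrightarrow> u \<in> C p \<Longrightarrow> v \<in> C' q \<Longrightarrow> F (outer u v) \<in> S"
    and c: "c \<in> gspan C C' r"
  shows "F c \<in> S"
  using c unfolding gspan_def
proof (rule plinear_span_into[OF F S, rotated])
  fix x assume "x \<in> (\<Union>(p, q)\<in>bidegrees r. tspan (C p) (C' q))"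
  then obtain p q where "p + q = r" "x \<in> tspan (C p) (C' q)"
    by (auto simp: bidegrees_def)
  then show "F x \<in> S"
    using gen by (blast intro: tspan_into[OF F S])
qed

lemma gspan_eqI:
  assumes F: "plinear F" and G: "plinear G"
    and gen: "\<And>p q u v. p + q = r \<Longrightarrow> u \<in> C p \<Longrightarrow> v \<in> C' q \<Longrightarrow> F (outer u v) = G (outer u v)"
    and c: "c \<in> gspan C C' r"
  shows "F c = G c"
proof -
  have "F c - G c \<in> {0}"
    by (rule gspan_into[OF plinear_minus[OF F G] pm.subspace_single_0 _ c]) (simp add: gen)
  then show ?thesis
    by simp
qed

definition bidegree_part :: "('s \<Rightarrow> nat) \<Rightarrow> ('t \<Rightarrow> nat) \<Rightarrow> nat \<times> nat \<Rightarrow> ('s \<times> 't \<Rightarrow>\<^sub>0 'k::field) \<Rightarrow> ('s \<times> 't \<Rightarrow>\<^sub>0 'k)" where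
  "bidegree_part dg dg' i = lin_ext (\<lambda>(x, y). if (dg x, dg' y) = i then bv (x, y) else 0)"

lemma keys_tspan:
  assumes "\<And>u. u \<in> U \<Longrightarrow> Poly_Mapping.keys u \<subseteq> K" "\<And>v. v \<in> U' \<Longrightarrow> Poly_Mapping.keys v \<subseteq> L"
    and "c \<in> tspan U U'"
  shows "Poly_Mapping.keys c \<subseteq> K \<times> L"
proof -
  have "c \<in> {c. Poly_Mapping.keys c \<subseteq> K \<times> L}"
  proof (rule tspan_into[OF plinear_ident subspace_keys _ assms(3)])
    fix u v assume "u \<in> U" "v \<in> U'"
    then show "outer u v \<in> {c. Poly_Mapping.keys c \<subseteq> K \<times> L}"
      using assms(1,2) by (fastforce simp: in_keys_iff)
  qed
  then show ?thesis by simp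
qed

lemma bidegree_part_tspan:
  assumes "graded_spaces dg C" "graded_spaces dg' C'" and c: "c \<in> tspan (C p) (C' q)"
  shows "bidegree_part dg dg' i c = (if i = (p, q) then c else 0)"
proof -
  interpret C: graded_spaces dg C by fact
  interpret C': graded_spaces dg' C' by fact
  have k: "Poly_Mapping.keys c \<subseteq> {x. dg x = p} \<times> {y. dg' y = q}"
    by (rule keys_tspan[OF C.keys_C C'.keys_C c])
  have "plinear (\<lambda>c. if i = (p, q) then c else 0)"
    by (cases "i = (p, q)") (simp_all add: plinear_ident plinear_zero)
  then show ?thesis
    by (intro plinear_eqI[OF _ _ k, of "bidegree_part dg dg' i"])
      (auto simp: bidegree_part_def plinear_lin_ext)
qed

text \<open>Tensor products in different bidegrees have disjoint supports, so restricting to pairs of given degrees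
  separates the summands.\<close>

lemma tensor_direct_sum_iso:
  assumes C: "graded_spaces dg C" and C': "graded_spaces dg' C'"
    and fac: "\<And>p q. tensor_factors (M p) (N q) (a p) (b q) (C p) (C' q)"
  shows "(\<lambda>f. \<Sum>(p, q)\<in>bidegrees r. coset_value (tensor_lift (a p) (b q)) (f (p, q)))
    \<in> module_iso (direct_sum (bidegrees r) (\<lambda>(p, q). tensor (M p) (N q))) (pm_module (gspan C C' r))"
proof -
  have "(\<lambda>f. \<Sum>i\<in>bidegrees r. (case i of (p, q) \<Rightarrow> coset_value (tensor_lift (a p) (b q))) (f i))
    \<in> module_iso (direct_sum (bidegrees r) (\<lambda>(p, q). tensor (M p) (N q)))
        (pm_module (pm.span (\<Union>i\<in>bidegrees r. case i of (p, q) \<Rightarrow> tspan (C p) (C' q))))"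
  proof (rule direct_sum_iso[where \<rho> = "bidegree_part dg dg'"])
    show "plinear (bidegree_part dg dg' i)" for i
      by (simp add: bidegree_part_def plinear_lin_ext)
    show "bidegree_part dg dg' i s = (if i = j then s else 0)"
      if "s \<in> (case j of (p, q) \<Rightarrow> tspan (C p) (C' q))" for i j s
      using that bidegree_part_tspan[OF C C'] by (cases j) auto
  qed (auto simp: finite_bidegrees subspace_tspan intro: tensor_factors.tensor_iso[OF fac])
  then show ?thesis
    by (simp add: gspan_def case_prod_unfold)
qed

locale tensor_complexes =
  A: graded_complex dg C d + B: graded_complex dg' C' d'
  for dg :: "'s \<Rightarrow> nat" and C :: "nat \<Rightarrow> ('s \<Rightarrow>\<^sub>0 'k::field) set" and d
    and dg' :: "'t \<Rightarrow> nat" and C' :: "nat \<Rightarrow> ('t \<Rightarrow>\<^sub>0 'k) set" and d'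
begin

text \<open>The operator \<open>u \<mapsto> (-1)\<^sup>p u\<close> on degree \<open>p\<close> carries the sign of the tensor differential, which can then be
  written without reference to degrees as \<open>d \<otimes> id + sg \<otimes> d'\<close>.\<close>

definition sg :: "('s \<Rightarrow>\<^sub>0 'k) \<Rightarrow> ('s \<Rightarrow>\<^sub>0 'k)" where
  "sg = lin_ext (\<lambda>x. pscale ((-1) ^ dg x) (bv x))"

lemma plinear_sg: "plinear sg"
  by (simp add: sg_def plinear_lin_ext)

lemma sg_C: "u \<in> C n \<Longrightarrow> sg u = pscale ((-1) ^ n) u"
  unfolding sg_def by (rule A.graded_lin_ext) (intro plinear_scaled plinear_ident)

definition D :: "('s \<times> 't \<Rightarrow>\<^sub>0 'k) \<Rightarrow> ('s \<times> 't \<Rightarrow>\<^sub>0 'k)" where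
  "D c = tmap d id c + tmap sg d' c"

lemma plinear_D: "plinear D"
  unfolding D_def by (intro plinear_plus plinear_tmap)

lemma D_outer:
  assumes "u \<in> C p"
  shows "D (outer u v) = outer (d u) v + pscale ((-1) ^ p) (outer u (d' v))"
  using sg_C[OF assms] by (simp add: D_def tmap_outer A.d B.d plinear_id plinear_sg)

lemma D_gspan_0: "c \<in> gspan C C' 0 \<Longrightarrow> D c = 0"
  by (rule gspan_eqI[OF plinear_D plinear_zero]) (auto simp: D_outer A.d_C0 B.d_C0)

lemma D_gspan:
  assumes "c \<in> gspan C C' (Suc r)"
  shows "D c \<in> gspan C C' r"
proof (rule gspan_into[OF plinear_D subspace_gspan _ assms])
  fix p q u v assume pq: "p + q = Suc r" and u: "u \<in> C p" and v: "v \<in> C' q"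
  have "outer (d u) v \<in> gspan C C' r"
    using u v pq A.d_C by (cases p) (auto simp: A.d_C0 pm.subspace_0[OF subspace_gspan] intro: outer_in_gspan)
  moreover have "outer u (d' v) \<in> gspan C C' r"
    using u v pq B.d_C by (cases q) (auto simp: B.d_C0 pm.subspace_0[OF subspace_gspan] intro: outer_in_gspan)
  ultimately show "D (outer u v) \<in> gspan C C' r"
    unfolding D_outer[OF u] by (intro pm.subspace_add[OF subspace_gspan] pm.subspace_scale[OF subspace_gspan])
qed

lemma factors: "tensor_factors (pm_module (C p)) (pm_module (C' q)) (\<lambda>u. u) (\<lambda>v. v) (C p) (C' q)"
  by unfold_locales
    (auto simp: A.subspace_C B.subspace_C closed_pm_module intro!: module_isoI)

lemma d_tspan_0: "c \<in> tspan (C 0) (C' q) \<Longrightarrow> tmap d id c = 0"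
  by (rule tspan_eqI[OF plinear_tmap plinear_zero]) (simp_all add: tmap_outer A.d plinear_id A.d_C0)

lemma d'_tspan_0: "c \<in> tspan (C p) (C' 0) \<Longrightarrow> tmap id d' c = 0"
  by (rule tspan_eqI[OF plinear_tmap plinear_zero]) (simp_all add: tmap_outer B.d plinear_id B.d_C0)

lemma D_tspan:
  assumes "c \<in> tspan (C p) (C' q)"
  shows "D c = tmap d id c + pscale ((-1) ^ p) (tmap id d' c)"
  by (rule tspan_eqI[OF plinear_D _ _ assms])
    (auto simp: D_outer tmap_outer A.d B.d plinear_id plinear_ident intro!: plinear_plus plinear_scaled plinear_tmap)

abbreviation tval :: "(('s \<Rightarrow>\<^sub>0 'k) \<times> ('t \<Rightarrow>\<^sub>0 'k) \<Rightarrow>\<^sub>0 'k) set \<Rightarrow> ('s \<times> 't \<Rightarrow>\<^sub>0 'k)" where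
  "tval \<equiv> coset_value (tensor_lift (\<lambda>u. u) (\<lambda>v. v))"

text \<open>All elements of the union of cosets \<open>tensor_map f g A\<close> have the same image, namely \<open>f \<otimes> g\<close> applied to the
  image of \<open>A\<close>.\<close>

lemma tensor_map_value:
  assumes f: "plinear f" and g: "plinear g"
    and A: "A \<in> carrier (tensor (pm_module (C p)) (pm_module (C' q)))"
  shows "takes_value (tensor_lift (\<lambda>u. u) (\<lambda>v. v))
    (tensor_map (pm_module (C p')) (pm_module (C' q')) f g A) (tmap f g (tval A))"
proof -
  interpret F: tensor_factors "pm_module (C p)" "pm_module (C' q)" "\<lambda>u. u" "\<lambda>v. v" "C p" "C' q"
    by (rule factors)
  interpret F': tensor_factors "pm_module (C p')" "pm_module (C' q')" "\<lambda>u. u" "\<lambda>v. v" "C p'" "C' q'"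
    by (rule factors)
  let ?F = "\<lambda>t. \<Sum>(u, v)\<in>Poly_Mapping.keys t. Poly_Mapping.single (f u, g v) (Poly_Mapping.lookup t (u, v))"
  have F_eq: "?F t = lin_ext (\<lambda>(u, v). bv (f u, g v)) t" for t :: "('s \<Rightarrow>\<^sub>0 'k) \<times> ('t \<Rightarrow>\<^sub>0 'k) \<Rightarrow>\<^sub>0 'k"
    unfolding lin_ext_def by (intro sum.cong) (auto simp: pscale_bv)
  have lift_F: "tensor_lift (\<lambda>u. u) (\<lambda>v. v) (?F t) = tmap f g (tensor_lift (\<lambda>u. u) (\<lambda>v. v) t)" for t
    unfolding F_eq
    by (rule plinear_eqI[OF plinear_compose[OF plinear_lin_ext plinear_tensor_lift]
          plinear_compose[OF plinear_tensor_lift plinear_tmap] subset_UNIV])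
      (auto simp: tmap_outer f g)
  have "tensor_lift (\<lambda>u. u) (\<lambda>v. v) (?F t) = tmap f g (tval A)" if "t \<in> A" for t
    using F.tensor_lift_const_on_coset(2)[OF A that] by (simp only: lift_F)
  moreover have "A \<noteq> {}"
    by (rule F.tensor_lift_const_on_coset(1)[OF A])
  ultimately show ?thesis
    using F'.tensor_coset_value unfolding tensor_map_def takes_value_def by fastforce
qed

text \<open>Bidegrees \<open>(p + 1, q)\<close> and \<open>(p, q + 1)\<close> with \<open>p + q = r\<close> miss \<open>(0, r + 1)\<close> and \<open>(r + 1, 0)\<close>,
  respectively, where \<open>d \<otimes> id\<close> and \<open>id \<otimes> d'\<close> vanish.\<close>

lemma tensor_complex_chain_map:
  assumes w: "w \<in> carrier (cobj (tensor_complex (pm_complex C d) (pm_complex C' d')) (Suc r))"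
  shows "(\<Sum>(p, q)\<in>bidegrees r. tval (cdiff (tensor_complex (pm_complex C d) (pm_complex C' d')) r w (p, q)))
    = D (\<Sum>(p, q)\<in>bidegrees (Suc r). tval (w (p, q)))"
proof -
  have w_carr: "w (p, q) \<in> carrier (tensor (pm_module (C p)) (pm_module (C' q)))" if "p + q = Suc r" for p q
    using w that by (auto simp: tensor_complex_def pm_complex_def direct_sum_def bidegrees_def)
  define x where "x p q = tval (w (p, q))" for p q
  have x: "x p q \<in> tspan (C p) (C' q)" if "p + q = Suc r" for p q
    using module_isoD(1)[OF tensor_factors.tensor_iso[OF factors] w_carr[OF that]] by (simp add: x_def)
  have comp: "tval (cdiff (tensor_complex (pm_complex C d) (pm_complex C' d')) r w (p, q))
      = tmap d id (x (Suc p) q) + pscale ((-1) ^ p) (tmap id d' (x p (Suc q)))" (is "tval ?A = ?v")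
    if pq: "p + q = r" for p q
  proof -
    interpret F: tensor_factors "pm_module (C p)" "pm_module (C' q)" "\<lambda>u. u" "\<lambda>v. v" "C p" "C' q"
      by (rule factors)
    have "takes_value (tensor_lift (\<lambda>u. u) (\<lambda>v. v)) ?A ?v"
      unfolding x_def using pq
      by (simp add: tensor_complex_def pm_complex_def bidegrees_def F.takes_value_add F.takes_value_scale
          tensor_map_value[OF A.d plinear_id w_carr] tensor_map_value[OF plinear_id B.d w_carr])
    then show ?thesis
      by (rule coset_value_eq)
  qed
  have "(\<Sum>(p, q)\<in>bidegrees r. tval (cdiff (tensor_complex (pm_complex C d) (pm_complex C' d')) r w (p, q)))
      = (\<Sum>p\<le>r. tmap d id (x (Suc p) (r - p))) + (\<Sum>p\<le>r. pscale ((-1) ^ p) (tmap id d' (x p (Suc (r - p)))))"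
    by (simp add: sum_bidegrees comp sum.distrib)
  also have "(\<Sum>p\<le>r. tmap d id (x (Suc p) (r - p))) = (\<Sum>p\<le>Suc r. tmap d id (x p (Suc r - p)))"
    using d_tspan_0[OF x] by (simp add: sum.atMost_Suc_shift del: sum.atMost_Suc)
  also have "(\<Sum>p\<le>r. pscale ((-1) ^ p) (tmap id d' (x p (Suc (r - p)))))
      = (\<Sum>p\<le>Suc r. pscale ((-1) ^ p) (tmap id d' (x p (Suc r - p))))"
    using d'_tspan_0[OF x[of "Suc r" 0]] by (simp add: Suc_diff_le)
  also have "(\<Sum>p\<le>Suc r. tmap d id (x p (Suc r - p))) + (\<Sum>p\<le>Suc r. pscale ((-1) ^ p) (tmap id d' (x p (Suc r - p))))
      = (\<Sum>p\<le>Suc r. D (x p (Suc r - p)))"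
    unfolding sum.distrib[symmetric] by (rule sum.cong) (simp_all add: D_tspan[OF x])
  also have "\<dots> = D (\<Sum>p\<le>Suc r. x p (Suc r - p))"
    by (rule plinear_sum[OF plinear_D, symmetric])
  finally show ?thesis
    by (simp add: sum_bidegrees x_def)
qed

lemma tensor_complex_iso:
  "(\<lambda>w. \<Sum>(p, q)\<in>bidegrees r. tval (w (p, q)))
    \<in> module_iso (cobj (tensor_complex (pm_complex C d) (pm_complex C' d')) r) (pm_module (gspan C C' r))"
  using tensor_direct_sum_iso[OF A.graded_spaces_axioms B.graded_spaces_axioms factors]
  by (simp add: tensor_complex_def pm_complex_def)

end


section \<open>A homotopy onto the harmonic part of a tensor product\<close>

locale tensor_harmonic =
  A: harmonic_complex dg C d \<pi> h + B: harmonic_complex dg' C' d' \<pi>' h'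
  for dg :: "'s \<Rightarrow> nat" and C :: "nat \<Rightarrow> ('s \<Rightarrow>\<^sub>0 'k::field) set" and d \<pi> h
    and dg' :: "'t \<Rightarrow> nat" and C' :: "nat \<Rightarrow> ('t \<Rightarrow>\<^sub>0 'k) set" and d' \<pi>' h'
begin

sublocale tensor_complexes dg C d dg' C' d' ..

text \<open>\<open>id - \<pi> \<otimes> \<pi>' = (id - \<pi>) \<otimes> id + \<pi> \<otimes> (id - \<pi>')\<close>: the homotopy \<open>h\<close> accounts for the first
  summand and \<open>h'\<close>, with the sign from moving it past an element of the first factor, for the
  second.\<close>

definition S :: "('s \<times> 't \<Rightarrow>\<^sub>0 'k) \<Rightarrow> ('s \<times> 't \<Rightarrow>\<^sub>0 'k)" where
  "S c = tmap h id c + tmap (\<lambda>u. sg (\<pi> u)) h' c"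

lemma plinear_S: "plinear S"
  unfolding S_def by (intro plinear_plus plinear_tmap)

lemma S_outer: "S (outer u v) = outer (h u) v + outer (sg (\<pi> u)) (h' v)"
  by (simp add: S_def tmap_outer A.h B.h plinear_id plinear_compose[OF A.\<pi> plinear_sg])

lemma S_gspan: "c \<in> gspan C C' r \<Longrightarrow> S c \<in> gspan C C' (Suc r)"
proof (rule gspan_into[OF plinear_S subspace_gspan])
  fix p q u v assume "p + q = r" "u \<in> C p" "v \<in> C' q"
  then show "S (outer u v) \<in> gspan C C' (Suc r)"
    unfolding S_outer
    by (auto intro!: pm.subspace_add[OF subspace_gspan] pm.subspace_scale[OF subspace_gspan]
        intro: outer_in_gspan A.h_C B.h_C A.\<pi>_C simp: sg_C[OF A.\<pi>_C])
qed

lemma D_homotopy: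
  assumes "c \<in> gspan C C' r"
  shows "D (S c) + S (D c) = c - tmap \<pi> \<pi>' c"
proof (rule gspan_eqI[OF _ _ _ assms])
  show "plinear (\<lambda>c. D (S c) + S (D c))" "plinear (\<lambda>c. c - tmap \<pi> \<pi>' c)"
    by (intro plinear_plus plinear_minus plinear_compose[OF plinear_S plinear_D]
        plinear_compose[OF plinear_D plinear_S] plinear_ident plinear_tmap)+
  fix p q u v assume "p + q = r" and u: "u \<in> C p" and v: "v \<in> C' q"
  have sq: "pscale ((-1) ^ p) (pscale ((-1) ^ p) c) = c" for c :: "'s \<times> 't \<Rightarrow>\<^sub>0 'k"
    by (simp flip: power_mult_distrib)
  have DS: "D (S (outer u v)) = outer (d (h u)) v - pscale ((-1) ^ p) (outer (h u) (d' v))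
      + outer (\<pi> u) (d' (h' v))"
    by (simp add: S_outer sg_C[OF A.\<pi>_C[OF u]] plinear_add[OF plinear_D] plinear_scale[OF plinear_D]
        D_outer[OF A.h_C[OF u]] D_outer[OF A.\<pi>_C[OF u]] A.d_\<pi>[OF u] sq del: pm.scale_scale)
  have SD: "S (D (outer u v)) = outer (h (d u)) v + pscale ((-1) ^ p) (outer (h u) (d' v))
      + outer (\<pi> u) (h' (d' v))"
    by (simp add: D_outer[OF u] plinear_add[OF plinear_S] plinear_scale[OF plinear_S] S_outer
        A.\<pi>_d[OF u] plinear_0[OF plinear_sg] sg_C[OF A.\<pi>_C[OF u]] pm.scale_right_distrib sq
        del: pm.scale_scale)
  have "D (S (outer u v)) + S (D (outer u v)) = outer (d (h u) + h (d u)) v + outer (\<pi> u) (d' (h' v) + h' (d' v))"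
    by (simp add: DS SD)
  also have "\<dots> = outer (u - \<pi> u) v + outer (\<pi> u) (v - \<pi>' v)"
    by (simp only: A.homotopy[OF u] B.homotopy[OF v])
  also have "\<dots> = outer u v - tmap \<pi> \<pi>' (outer u v)"
    by (simp add: tmap_outer A.\<pi> B.\<pi>)
  finally show "D (S (outer u v)) + S (D (outer u v)) = outer u v - tmap \<pi> \<pi>' (outer u v)" .
qed

lemma \<pi>_D: "c \<in> gspan C C' r \<Longrightarrow> tmap \<pi> \<pi>' (D c) = 0"
  by (rule gspan_eqI[OF plinear_compose[OF plinear_D plinear_tmap] plinear_zero])
    (auto simp: D_outer plinear_add[OF plinear_tmap] plinear_scale[OF plinear_tmap] tmap_outer A.\<pi> B.\<pi>
      A.\<pi>_d B.\<pi>_d)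

lemma cycle_is_boundary:
  assumes "c \<in> gspan C C' r" "D c = 0" "tmap \<pi> \<pi>' c = 0"
  shows "D (S c) = c"
  using D_homotopy[OF assms(1)] assms(2,3) by (simp add: plinear_0[OF plinear_S])

lemma \<pi>_cycles: "tmap \<pi> \<pi>' ` {c \<in> gspan C C' r. D c = 0} = gspan A.harm B.harm r"
proof (rule antisym)
  have "tmap \<pi> \<pi>' c \<in> gspan A.harm B.harm r" if "c \<in> gspan C C' r" for c
    by (rule gspan_into[OF plinear_tmap subspace_gspan _ that])
      (auto simp: tmap_outer A.\<pi> B.\<pi> intro!: outer_in_gspan A.\<pi>_harm B.\<pi>_harm)
  then show "tmap \<pi> \<pi>' ` {c \<in> gspan C C' r. D c = 0} \<subseteq> gspan A.harm B.harm r"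
    by blast
  show "gspan A.harm B.harm r \<subseteq> tmap \<pi> \<pi>' ` {c \<in> gspan C C' r. D c = 0}"
  proof
    fix c assume c: "c \<in> gspan A.harm B.harm r"
    have "tmap \<pi> \<pi>' c = c"
      by (rule gspan_eqI[OF plinear_tmap plinear_ident _ c])
        (auto simp: tmap_outer A.\<pi> B.\<pi> dest!: A.harmD B.harmD)
    moreover have "c \<in> gspan C C' r"
      by (rule gspan_into[OF plinear_ident subspace_gspan _ c])
        (auto intro: outer_in_gspan dest!: A.harmD B.harmD)
    moreover have "D c = 0"
    proof (rule gspan_eqI[OF plinear_D plinear_zero _ c])
      fix p q u v assume "u \<in> A.harm p" "v \<in> B.harm q"
      then show "D (outer u v) = 0"
        using A.harmD[of u p] B.harmD[of v q] by (simp add: D_outer[of u p])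
    qed
    ultimately show "c \<in> tmap \<pi> \<pi>' ` {c \<in> gspan C C' r. D c = 0}"
      by (intro image_eqI[of _ _ c]) auto
  qed
qed

text \<open>A homology class is identified with the value of \<open>\<pi>\<close> on any of its cycles.\<close>

lemma homology_tensor_iso:
  "(\<lambda>f. \<Sum>(p, q)\<in>bidegrees r. coset_value (tensor_lift (coset_value \<pi>) (coset_value \<pi>')) (f (p, q)))
    \<in> module_iso
        (direct_sum (bidegrees r)
          (\<lambda>(p, q). tensor (homology (pm_complex C d) p) (homology (pm_complex C' d') q)))
        (pm_module (gspan A.harm B.harm r))"
proof (rule tensor_direct_sum_iso)
  show "graded_spaces dg A.harm" "graded_spaces dg' B.harm"
    using A.keys_C A.harmD B.keys_C B.harmD
    by (auto intro!: graded_spaces.intro A.subspace_harm B.subspace_harm) blast+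
  show "tensor_factors (homology (pm_complex C d) p) (homology (pm_complex C' d') q)
      (coset_value \<pi>) (coset_value \<pi>') (A.harm p) (B.harm q)" for p q
    by unfold_locales
      (simp_all add: A.homology_iso_harm B.homology_iso_harm A.subspace_harm B.subspace_harm)
qed

end

section \<open>The boundary operator on regular paths\<close>

definition cons_path :: "'a \<Rightarrow> ('a list \<Rightarrow>\<^sub>0 'k::field) \<Rightarrow> ('a list \<Rightarrow>\<^sub>0 'k)" where
  "cons_path a = lin_ext (\<lambda>y. if distinct_adj (a # y) then bv (a # y) else 0)"

text \<open>The augmented boundary \<open>aug\<close> keeps
  the empty path as the boundary of a point; unlike \<open>path_boundary\<close> it satisfies the recursion
  \<open>\<partial>(a x) = x - a \<partial>x\<close> for all regular paths. The two differ only on single vertices.\<close>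

definition aug :: "'a list \<Rightarrow> ('a list \<Rightarrow>\<^sub>0 'k::field)" where
  "aug x = (\<Sum>q<length x. if distinct_adj (delete_nth q x)
      then pscale ((-1) ^ q) (bv (delete_nth q x)) else 0)"

definition aug_bd :: "('a list \<Rightarrow>\<^sub>0 'k::field) \<Rightarrow> ('a list \<Rightarrow>\<^sub>0 'k)" where
  "aug_bd = lin_ext aug"

lemma boundary_eq_lin_ext: "boundary = lin_ext path_boundary"
  by (simp add: fun_eq_iff boundary_def lin_ext_def)

lemma plinear_boundary: "plinear boundary"
  and plinear_aug_bd: "plinear aug_bd"
  and plinear_cons_path: "plinear (cons_path a)"
  by (simp_all add: boundary_eq_lin_ext aug_bd_def cons_path_def plinear_lin_ext)

lemmas path_linear_simps =
  plinear_add[OF plinear_aug_bd] plinear_add[OF plinear_cons_path]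
  plinear_scale[OF plinear_aug_bd] plinear_scale[OF plinear_cons_path]
  plinear_0[OF plinear_aug_bd] plinear_0[OF plinear_cons_path]
  plinear_diff[OF plinear_aug_bd] plinear_diff[OF plinear_cons_path]

lemma boundary_bv [simp]: "boundary (bv x) = path_boundary x"
  by (simp add: boundary_eq_lin_ext)

lemma aug_bd_bv [simp]: "aug_bd (bv x) = aug x"
  by (simp add: aug_bd_def)

lemma cons_path_bv: "cons_path a (bv x) = (if distinct_adj (a # x) then bv (a # x) else 0)"
  by (simp add: cons_path_def)

lemma path_boundary_eq_aug: "path_boundary x = (if length x \<le> 1 then 0 else aug x)"
  by (simp add: path_boundary_def aug_def)

lemma aug_Nil [simp]: "aug [] = 0"
  by (simp add: aug_def)

lemma aug_Cons: "aug (a # x) = (if distinct_adj x then bv x else 0) - cons_path a (aug x)"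
proof -
  have "aug (a # x) = (if distinct_adj x then bv x else 0) + (\<Sum>q<length x. if distinct_adj (a # delete_nth q x)
      then - pscale ((-1) ^ q) (bv (a # delete_nth q x)) else 0)"
    unfolding aug_def[of "a # x"]
    by (simp add: sum.lessThan_Suc_shift delete_nth_def del: sum.lessThan_Suc cong: if_cong)
  also have "(\<Sum>q<length x. if distinct_adj (a # delete_nth q x)
      then - pscale ((-1) ^ q) (bv (a # delete_nth q x)) else 0) = - cons_path a (aug x)"
    unfolding aug_def plinear_sum[OF plinear_cons_path] sum_negf[symmetric]
    by (intro sum.cong) (auto simp: path_linear_simps cons_path_bv distinct_adj_Cons)
  finally show ?thesis
    by simp
qed

lemma keys_aug: "Poly_Mapping.keys (aug x) \<subseteq> {y. distinct_adj y \<and> Suc (length y) = length x}"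
  unfolding aug_def
proof -
  have "(\<Sum>q<length x. if distinct_adj (delete_nth q x)
      then pscale ((-1) ^ q) (bv (delete_nth q x)) else 0)
      \<in> {u. Poly_Mapping.keys u \<subseteq> {y. distinct_adj y \<and> Suc (length y) = length x}}"
    by (intro pm.subspace_sum subspace_keys)
      (auto simp: delete_nth_def in_keys_iff lookup_single when_def split: if_splits)
  then show "Poly_Mapping.keys (\<Sum>q<length x. if distinct_adj (delete_nth q x)
      then pscale ((-1) ^ q) (bv (delete_nth q x)) else 0 :: 'a list \<Rightarrow>\<^sub>0 'b)
      \<subseteq> {y. distinct_adj y \<and> Suc (length y) = length x}"
    by simp
qed

lemma lookup_cons_path:
  "Poly_Mapping.lookup (cons_path a u) z =
    (case z of [] \<Rightarrow> 0 | b # z' \<Rightarrow> if b = a \<and> distinct_adj z then Poly_Mapping.lookup u z' else 0)"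
proof -
  have "Poly_Mapping.lookup (cons_path a u) z = (\<Sum>y\<in>Poly_Mapping.keys u. 
      if z = a # y then (if distinct_adj z then Poly_Mapping.lookup u y else 0) else 0)"
    unfolding cons_path_def lookup_lin_ext
    by (rule sum.cong) (auto simp: lookup_single when_def)
  also have "\<dots> = (case z of [] \<Rightarrow> 0 | b # z' \<Rightarrow> if b = a \<and> distinct_adj z then Poly_Mapping.lookup u z' else 0)"
    by (cases z) (auto simp: in_keys_iff intro!: sum.neutral)
  finally show ?thesis .
qed

lemma cons_path_cons_path: "cons_path a (cons_path a u) = 0"
  by (rule poly_mapping_eqI) (auto simp: lookup_cons_path distinct_adj_Cons split: list.split)

text \<open>The recursion survives the truncation: if \<open>u = e\<^sub>x\<close> with \<open>x = a x'\<close>, then \<open>a u = 0\<close>, and the right-hand side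
  \<open>x - a (x' - a \<partial>x')\<close> vanishes as well, because \<open>a (a v) = 0\<close>. Hence \<open>\<partial>\<close> squares to zero on regular paths
  by induction.\<close>

lemma aug_bd_cons_path:
  assumes "Poly_Mapping.keys u \<subseteq> {x. distinct_adj x}"
  shows "aug_bd (cons_path a u) = u - cons_path a (aug_bd u)"
proof (rule plinear_eqI[OF _ _ assms])
  show "plinear (\<lambda>u. aug_bd (cons_path a u))" "plinear (\<lambda>u. u - cons_path a (aug_bd u))"
    by (intro plinear_minus plinear_ident plinear_compose[OF plinear_cons_path plinear_aug_bd]
        plinear_compose[OF plinear_aug_bd plinear_cons_path])+
  fix x :: "'a list" assume x: "x \<in> {x. distinct_adj x}"
  show "aug_bd (cons_path a (bv x)) = (bv x :: 'a list \<Rightarrow>\<^sub>0 'b) - cons_path a (aug_bd (bv x))"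
  proof (cases "distinct_adj (a # x)")
    case True
    then show ?thesis
      using x by (simp add: cons_path_bv aug_Cons)
  next
    case False
    then obtain x' where x': "x = a # x'"
      using x by (cases x) auto
    moreover have "distinct_adj x'"
      using x x' by (cases x') auto
    ultimately show ?thesis
      using x False by (simp add: cons_path_bv aug_Cons path_linear_simps cons_path_cons_path)
  qed
qed

lemma aug_aug: "distinct_adj x \<Longrightarrow> aug_bd (aug x) = (0 :: 'a list \<Rightarrow>\<^sub>0 'k::field)"
proof (induction x)
  case (Cons a x)
  then have x: "distinct_adj x"
    by (cases x) auto
  have k: "Poly_Mapping.keys (aug x :: 'a list \<Rightarrow>\<^sub>0 'k) \<subseteq> {x. distinct_adj x}"
    using keys_aug by blast
  show ?case
    using Cons.IH[OF x] x by (simp add: aug_Cons path_linear_simps aug_bd_cons_path[OF k])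
qed (simp add: path_linear_simps)

lemma boundary_eq_aug_bd: "Poly_Mapping.keys u \<subseteq> {x. 1 < length x} \<Longrightarrow> boundary u = aug_bd u"
  by (rule plinear_eqI[OF plinear_boundary plinear_aug_bd]) (auto simp: path_boundary_eq_aug)

lemma boundary_eq_0: "Poly_Mapping.keys u \<subseteq> {x. length x \<le> 1} \<Longrightarrow> boundary u = 0"
  by (rule plinear_eqI[OF plinear_boundary plinear_zero]) (auto simp: path_boundary_eq_aug)

lemma boundary_boundary:
  assumes "Poly_Mapping.keys u \<subseteq> {x. distinct_adj x}"
  shows "boundary (boundary u) = 0"
proof (rule plinear_eqI[OF plinear_compose[OF plinear_boundary plinear_boundary] plinear_zero assms])
  fix x :: "'a list" assume x: "x \<in> {x. distinct_adj x}"
  have k: "Poly_Mapping.keys (aug x :: 'a list \<Rightarrow>\<^sub>0 'b) \<subseteq> {y. Suc (length y) = length x}"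
    using keys_aug by blast
  consider "length x \<le> 1" | "length x = 2" | "length x > 2"
    by linarith
  then show "boundary (boundary (bv x)) = (0 :: 'a list \<Rightarrow>\<^sub>0 'b)"
  proof cases
    case 1
    then show ?thesis by (simp add: path_boundary_eq_aug plinear_0[OF plinear_boundary])
  next
    case 2
    then have "boundary (aug x) = (0 :: 'a list \<Rightarrow>\<^sub>0 'b)"
      by (intro boundary_eq_0) (use k in auto)
    then show ?thesis using 2 by (simp add: path_boundary_eq_aug)
  next
    case 3
    then have "boundary (aug x) = (aug_bd (aug x) :: 'a list \<Rightarrow>\<^sub>0 'b)"
      by (intro boundary_eq_aug_bd) (use k in auto)
    then show ?thesis using 3 x by (simp add: path_boundary_eq_aug aug_aug)
  qed
qed


section \<open>The cross product and the product rule\<close>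

lemma step_like_Nil [simp]: "step_like []"
  and step_like_single [simp]: "step_like [c]"
  and step_like_Cons_Cons: "step_like (c # c' # z) \<longleftrightarrow>
    c \<noteq> c' \<and> (fst c = fst c' \<or> snd c = snd c') \<and> step_like (c' # z)"
  by (auto simp: step_like_def)

lemma proj_X_simps [simp]:
  "proj_X [] = []" "proj_X [c] = [fst c]"
  "proj_X (c # c' # z) = (if fst c = fst c' then proj_X (c' # z) else fst c # proj_X (c' # z))"
  by (simp_all add: proj_X_def)

lemma proj_Y_simps [simp]:
  "proj_Y [] = []" "proj_Y [c] = [snd c]"
  "proj_Y (c # c' # z) = (if snd c = snd c' then proj_Y (c' # z) else snd c # proj_Y (c' # z))"
  by (simp_all add: proj_Y_def)

lemma proj_X_hd: "\<exists>x. proj_X (c # z) = fst c # x"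
  by (induction z arbitrary: c) auto

lemma proj_Y_hd: "\<exists>y. proj_Y (c # z) = snd c # y"
  by (induction z arbitrary: c) auto

definition horizontals :: "('a \<times> 'b) list \<Rightarrow> nat set" where
  "horizontals z = {l. Suc l < length z \<and> snd (z ! l) = snd (z ! Suc l)}"

lemma finite_horizontals: "finite (horizontals z)"
  by (rule finite_subset[of _ "{..<length z}"]) (auto simp: horizontals_def)

text \<open>Each horizontal couple of a step-like path adds one vertex to its projection onto \<open>X\<close>.\<close>

lemma card_horizontals: "step_like z \<Longrightarrow> card (horizontals z) = length (proj_X z) - 1"
proof (induction z rule: induct_list012)
  case (3 c c' z)
  have "horizontals (c # c' # z) = Suc ` horizontals (c' # z) \<union> (if snd c = snd c' then {0} else {})"
  proof (rule Set.set_eqI)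
    fix l show "l \<in> horizontals (c # c' # z) \<longleftrightarrow>
        l \<in> Suc ` horizontals (c' # z) \<union> (if snd c = snd c' then {0} else {})"
      by (cases l) (auto simp: horizontals_def image_iff)
  qed
  moreover have "card (Suc ` horizontals (c' # z)) = card (horizontals (c' # z))"
    by (rule card_image) simp
  moreover have "0 \<notin> Suc ` horizontals (c' # z)"
    by auto
  moreover have "fst c \<noteq> fst c' \<longleftrightarrow> snd c = snd c'" "step_like (c' # z)"
    using "3.prems" by (auto simp: step_like_Cons_Cons prod_eq_iff)
  moreover obtain x where "proj_X (c' # z) = fst c' # x"
    using proj_X_hd by blast
  ultimately show ?case
    using "3.IH" finite_horizontals[of "c' # z"] by auto
qed (auto simp: horizontals_def)

lemma elevation_Cons:
  assumes "step_like (c' # z)"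
  shows "elevation (c # c' # z) = elevation (c' # z)
    + (if fst c = fst c' then length (proj_X (c' # z)) - 1 else 0)"
proof -
  define E where "E w = {(k, l). k < l \<and> Suc l < length w \<and>
      fst (w ! k) = fst (w ! Suc k) \<and> snd (w ! l) = snd (w ! Suc l)}" for w :: "('a \<times> 'b) list"
  have el: "elevation w = card (E w)" for w
    by (simp add: elevation_def E_def)
  have fin: "finite (E w)" for w
    by (rule finite_subset[of _ "{..<length w} \<times> {..<length w}"]) (auto simp: E_def)
  let ?A = "map_prod Suc Suc ` E (c' # z)"
  let ?B = "if fst c = fst c' then (\<lambda>l. (0 :: nat, Suc l)) ` horizontals (c' # z) else {}"
  have card_B: "card ((\<lambda>l. (0 :: nat, Suc l)) ` horizontals (c' # z)) = card (horizontals (c' # z))"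
    by (rule card_image) (auto simp: inj_on_def)
  have E_eq: "E (c # c' # z) = ?A \<union> ?B"
  proof (rule Set.set_eqI)
    fix i show "i \<in> E (c # c' # z) \<longleftrightarrow> i \<in> ?A \<union> ?B"
    proof (cases i)
      case (Pair k l)
      then show ?thesis
        by (cases k; cases l) (auto simp: E_def horizontals_def image_iff)
    qed
  qed
  have "card (E (c # c' # z)) = card ?A + card ?B"
    unfolding E_eq by (rule card_Un_disjoint) (use fin finite_horizontals in auto)
  moreover have "card ?A = card (E (c' # z))"
    by (rule card_image) (auto simp: inj_on_def)
  ultimately show ?thesis
    using card_B card_horizontals[OF assms] by (simp add: el)
qed

lemma elevation_short [simp]: "elevation [] = 0" "elevation [c] = 0"
  by (simp_all add: elevation_def)

lemma lookup_cross:
  "Poly_Mapping.lookup (cross u v) z = (if step_like z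
    then (-1) ^ elevation z * Poly_Mapping.lookup u (proj_X z) * Poly_Mapping.lookup v (proj_Y z) else 0)"
  by (simp add: cross.rep_eq)

lemma plinear_cross_left: "plinear (\<lambda>u. cross u v)" and plinear_cross_right: "plinear (cross u)"
  by (auto intro!: plinearI poly_mapping_eqI simp: lookup_cross lookup_add algebra_simps)

lemmas cross_linear_simps =
  plinear_add[OF plinear_cross_left] plinear_add[OF plinear_cross_right]
  plinear_scale[OF plinear_cross_left] plinear_scale[OF plinear_cross_right]
  plinear_0[OF plinear_cross_left] plinear_0[OF plinear_cross_right]
  plinear_diff[OF plinear_cross_left] plinear_diff[OF plinear_cross_right]

lemma proj_empty_iff [simp]: "proj_X z = [] \<longleftrightarrow> z = []" "proj_Y z = [] \<longleftrightarrow> z = []"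
  "[] = proj_X z \<longleftrightarrow> z = []" "[] = proj_Y z \<longleftrightarrow> z = []"
  by (simp_all add: proj_X_def proj_Y_def eq_commute[of "[]"])

lemma keys_cross_bv:
  "z \<in> Poly_Mapping.keys (cross (bv x) (bv y)) \<longleftrightarrow> step_like z \<and> proj_X z = x \<and> proj_Y z = y"
  by (auto simp: in_keys_iff lookup_cross lookup_single when_def)

lemma cross_Nil_left: "Poly_Mapping.lookup v [] = 0 \<Longrightarrow> cross (bv []) v = 0"
  and cross_Nil_right: "Poly_Mapping.lookup u [] = 0 \<Longrightarrow> cross u (bv []) = 0"
  by (auto intro!: poly_mapping_eqI simp: lookup_cross lookup_single when_def)

lemma cross_points: "cross (bv [a]) (bv [b]) = (bv [(a, b)] :: _ \<Rightarrow>\<^sub>0 'k::field)"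
proof (rule poly_mapping_eqI)
  fix z :: "('a \<times> 'b) list"
  show "Poly_Mapping.lookup (cross (bv [a]) (bv [b])) z = Poly_Mapping.lookup (bv [(a, b)] :: _ \<Rightarrow>\<^sub>0 'k) z"
  proof (cases "z = [(a, b)]")
    case True
    then show ?thesis
      by (simp add: lookup_cross)
  next
    case False
    have "z \<notin> Poly_Mapping.keys (cross (bv [a]) (bv [b]) :: _ \<Rightarrow>\<^sub>0 'k)"
    proof
      assume "z \<in> Poly_Mapping.keys (cross (bv [a]) (bv [b]) :: _ \<Rightarrow>\<^sub>0 'k)"
      then have z: "step_like z" "proj_X z = [a]" "proj_Y z = [b]"
        by (simp_all add: keys_cross_bv)
      then have "z = [(a, b)]"
        using step_like_length[of z] by (cases z rule: remdups_adj.cases) auto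
      then show False
        using False by blast
    qed
    then show ?thesis
      using False by (simp add: in_keys_iff lookup_single_not_eq)
  qed
qed

text \<open>A step-like path over \<open>a x\<close> and \<open>b y\<close> starts at \<open>(a, b)\<close> and moves on either
  horizontally or vertically. A vertical first couple lies before all \<open>|x|\<close> horizontal ones, which
  accounts for the sign. The excluded case is that of two points.\<close>

lemma cross_Cons:
  fixes a :: 'a and b :: 'b
  assumes "x \<noteq> [] \<or> y \<noteq> []" "distinct_adj (a # x)" "distinct_adj (b # y)"
  shows "cross (bv (a # x)) (bv (b # y)) =
    cons_path (a, b) (cross (bv x) (bv (b # y)) +
      pscale ((-1) ^ length x) (cross (bv (a # x)) (bv y)) :: _ \<Rightarrow>\<^sub>0 'k::field)"
proof (rule poly_mapping_eqI)
  fix z :: "('a \<times> 'b) list"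
  let ?L = "Poly_Mapping.lookup (cross (bv (a # x)) (bv (b # y)) :: _ \<Rightarrow>\<^sub>0 'k) z"
  let ?R = "Poly_Mapping.lookup (cons_path (a, b)
    (cross (bv x) (bv (b # y)) + pscale ((-1) ^ length x) (cross (bv (a # x)) (bv y))) :: _ \<Rightarrow>\<^sub>0 'k) z"
  consider "z = []" | c where "z = [c]" | c c' w where "z = c # c' # w"
    by (cases z rule: remdups_adj.cases) auto
  then show "?L = ?R"
  proof cases
    case 1
    then show ?thesis
      by (simp add: lookup_cons_path lookup_cross lookup_single)
  next
    case 2
    then show ?thesis
      using assms(1) by (auto simp: lookup_cons_path lookup_cross lookup_single lookup_add when_def)
  next
    case 3
    obtain xs where xs: "proj_X (c' # w) = fst c' # xs"
      using proj_X_hd by blast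
    obtain ys where ys: "proj_Y (c' # w) = snd c' # ys"
      using proj_Y_hd by blast
    show ?thesis
    proof (cases "step_like (c' # w)")
      case False
      then show ?thesis
        by (simp add: 3 lookup_cons_path lookup_cross lookup_add step_like_Cons_Cons)
    next
      case True
      then have da: "distinct_adj z \<longleftrightarrow> c \<noteq> c'"
        by (simp add: 3 step_like_def)
      show ?thesis
        using True da elevation_Cons[OF True, of c] assms(2,3)
        by (auto simp: 3 xs ys lookup_cons_path lookup_cross lookup_add lookup_single when_def
            step_like_Cons_Cons prod_eq_iff power_add)
    qed
  qed
qed

lemma cons_path_cross_same_start:
  fixes a :: 'a and b :: 'b
  shows "cons_path (a, b) (cross (bv (a # x)) (bv (b # y)) :: _ \<Rightarrow>\<^sub>0 'k::field) = 0"
proof (rule poly_mapping_eqI)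
  fix z :: "('a \<times> 'b) list"
  have "Poly_Mapping.lookup (cross (bv (a # x)) (bv (b # y)) :: _ \<Rightarrow>\<^sub>0 'k) w = 0"
    if "distinct_adj ((a, b) # w)" for w
  proof (cases w)
    case (Cons c w')
    then show ?thesis
      using that proj_X_hd[of c w'] proj_Y_hd[of c w']
      by (auto simp: lookup_cross lookup_single when_def prod_eq_iff)
  qed (simp add: lookup_cross lookup_single)
  then show "Poly_Mapping.lookup (cons_path (a, b) (cross (bv (a # x)) (bv (b # y)))) z
      = Poly_Mapping.lookup (0 :: _ \<Rightarrow>\<^sub>0 'k) z"
    by (auto simp: lookup_cons_path split: list.split)
qed

text \<open>The recursion for chains \<open>u\<close>, \<open>v\<close>, including the degenerate terms in which a path of \<open>u\<close> already starts with \<open>a\<close>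
  or one of \<open>v\<close> with \<open>b\<close>.\<close>

lemma cross_cons_path:
  fixes u :: "'a list \<Rightarrow>\<^sub>0 'k::field" and v :: "'b list \<Rightarrow>\<^sub>0 'k"
  assumes u: "Poly_Mapping.keys u \<subseteq> {x. distinct_adj x \<and> length x = m}"
    and v: "Poly_Mapping.keys v \<subseteq> {y. distinct_adj y \<and> length y = n}"
    and mn: "0 < m + n"
  shows "cross (cons_path a u) (cons_path b v) = cons_path (a, b)
    (cross u (cons_path b v) + pscale ((-1) ^ m) (cross (cons_path a u) v))"
proof (rule bilinear_eqI[OF _ _ _ _ u v])
  show "plinear (\<lambda>u. cross (cons_path a u) (cons_path b v))"
    and "plinear (\<lambda>u. cons_path (a, b) (cross u (cons_path b v) + pscale ((-1) ^ m) (cross (cons_path a u) v)))"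
    for v :: "'b list \<Rightarrow>\<^sub>0 'k"
    by (auto intro!: plinearI simp: path_linear_simps cross_linear_simps pm.scale_right_distrib mult.commute)
  show "plinear (\<lambda>v. cross (cons_path a u) (cons_path b v))"
    and "plinear (\<lambda>v. cons_path (a, b) (cross u (cons_path b v) + pscale ((-1) ^ m) (cross (cons_path a u) v)))"
    for u :: "'a list \<Rightarrow>\<^sub>0 'k"
    by (auto intro!: plinearI simp: path_linear_simps cross_linear_simps pm.scale_right_distrib mult.commute)
  fix x :: "'a list" and y :: "'b list"
  assume x: "x \<in> {x. distinct_adj x \<and> length x = m}" and y: "y \<in> {y. distinct_adj y \<and> length y = n}"
  have start: "\<exists>z'. z = c # z'" if "\<not> distinct_adj (c # z)" "distinct_adj z" for c :: 'a and z
    using that by (cases z) auto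
  have start': "\<exists>z'. z = c # z'" if "\<not> distinct_adj (c # z)" "distinct_adj z" for c :: 'b and z
    using that by (cases z) auto
  show "cross (cons_path a (bv x)) (cons_path b (bv y)) = cons_path (a, b)
    (cross (bv x) (cons_path b (bv y)) + pscale ((-1) ^ m) (cross (cons_path a (bv x)) (bv y :: _ \<Rightarrow>\<^sub>0 'k)))"
  proof (cases "distinct_adj (a # x) \<and> distinct_adj (b # y)")
    case True
    then show ?thesis
      using x y mn cross_Cons[of x y a b] by (auto simp: cons_path_bv)
  next
    case False
    then show ?thesis
      using x y by (cases x; cases y)
        (auto simp: cons_path_bv path_linear_simps cross_linear_simps cons_path_cross_same_start)
  qed
qed

lemma keys_cross_regular: "Poly_Mapping.keys (cross u v) \<subseteq> {z. distinct_adj z}"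
  by (auto simp: in_keys_iff lookup_cross step_like_def split: if_splits)

lemma lookup_aug_Nil: "length x \<noteq> 1 \<Longrightarrow> Poly_Mapping.lookup (aug x) [] = 0"
  using keys_aug[of x] by (force simp: in_keys_iff)

text \<open>The product rule for augmented boundaries, by expanding both sides with the recursions in the first
  vertices. The bound on the lengths excludes products of two points, where the augmentation spoils the rule, but it
  admits an empty path on one side, where all terms vanish; this lets the induction pass through
  \<open>cross_Cons\<close> without case distinctions on the degrees.\<close>

lemma aug_bd_cross:
  fixes x :: "'a list" and y :: "'b list"
  assumes "distinct_adj x" "distinct_adj y" "3 \<le> length x + length y"
  shows "aug_bd (cross (bv x) (bv y)) = cross (aug x) (bv y)
    + pscale ((-1) ^ Suc (length x)) (cross (bv x) (aug y) :: _ \<Rightarrow>\<^sub>0 'k::field)"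
  using assms
proof (induction "length x + length y" arbitrary: x y rule: less_induct)
  case less
  show ?case
  proof (cases "x = [] \<or> y = []")
    case True
    then consider "x = []" "y \<noteq> []" "length y \<noteq> 1" | "y = []" "x \<noteq> []" "length x \<noteq> 1"
      using less.prems(3) by fastforce
    then show ?thesis
      by cases (auto simp: cross_Nil_left cross_Nil_right lookup_aug_Nil lookup_single path_linear_simps
          cross_linear_simps)
  next
    case False
    then obtain a x' b y' where xy: "x = a # x'" "y = b # y'"
      by (metis neq_Nil_conv)
    have reg: "distinct_adj x'" "distinct_adj y'"
      using less.prems xy by (auto simp: distinct_adj_Cons)
    define W where "W = cross (bv x') (bv y) + pscale ((-1) ^ length x') (cross (bv x) (bv y') :: _ \<Rightarrow>\<^sub>0 'k)"
    have xy_W: "cross (bv x) (bv y) = cons_path (a, b) W"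
      unfolding W_def xy using less.prems xy by (intro cross_Cons) auto
    have kW: "Poly_Mapping.keys W \<subseteq> {z. distinct_adj z}"
    proof -
      have "W \<in> {u. Poly_Mapping.keys u \<subseteq> {z. distinct_adj z}}"
        unfolding W_def
        by (intro pm.subspace_add[OF subspace_keys] pm.subspace_scale[OF subspace_keys])
          (simp_all add: keys_cross_regular)
      then show ?thesis by simp
    qed
    have L: "aug_bd (cross (bv x) (bv y)) = W - cons_path (a, b) (aug_bd W)"
      unfolding xy_W by (rule aug_bd_cons_path[OF kW])
    have aug_x: "cons_path a (aug x') = (bv x' - aug x :: _ \<Rightarrow>\<^sub>0 'k)"
      and aug_y: "cons_path b (aug y') = (bv y' - aug y :: _ \<Rightarrow>\<^sub>0 'k)"
      using reg by (simp_all add: xy aug_Cons)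
    have bx: "cons_path a (bv x') = (bv x :: _ \<Rightarrow>\<^sub>0 'k)"
      and "by": "cons_path b (bv y') = (bv y :: _ \<Rightarrow>\<^sub>0 'k)"
      using less.prems by (simp_all add: xy cons_path_bv)
    (* in total length 3, the path in one factor is a point and the induction hypothesis does not apply *)
    consider "length x' + length y' \<ge> 2" | "length x' = 1" "y' = []" | "x' = []" "length y' = 1"
    proof -
      have "length x' + length y' \<ge> 2 \<or> length x' = 1 \<and> length y' = 0 \<or> length x' = 0 \<and> length y' = 1"
        using less.prems(3) unfolding xy length_Cons by linarith
      then show ?thesis
        using that by auto
    qed
    then show ?thesis
    proof cases
      case 1
      have IH1: "aug_bd (cross (bv x') (bv y)) = cross (aug x') (bv y)
          + pscale ((-1) ^ Suc (length x')) (cross (bv x') (aug y) :: _ \<Rightarrow>\<^sub>0 'k)"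
        by (rule less.hyps) (use reg less.prems 1 xy in auto)
      have IH2: "aug_bd (cross (bv x) (bv y')) = cross (aug x) (bv y')
          + pscale ((-1) ^ length x') (cross (bv x) (aug y') :: _ \<Rightarrow>\<^sub>0 'k)"
        using less.hyps[of x y'] reg less.prems 1 xy by auto
      have E1: "cross (cons_path a (aug x')) (bv y) = cons_path (a, b) (cross (aug x') (bv y)
          + pscale ((-1) ^ Suc (length x')) (cross (cons_path a (aug x')) (bv y')) :: _ \<Rightarrow>\<^sub>0 'k)"
      proof (cases x')
        case (Cons a' x'')
        have "Poly_Mapping.keys (aug x' :: _ \<Rightarrow>\<^sub>0 'k) \<subseteq> {z. distinct_adj z \<and> length z = length x''}"
          using keys_aug[of x'] Cons by auto
        moreover have "Poly_Mapping.keys (bv y' :: _ \<Rightarrow>\<^sub>0 'k) \<subseteq> {z. distinct_adj z \<and> length z = length y'}"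
          using reg by simp
        moreover have "0 < length x'' + length y'"
          using 1 unfolding Cons length_Cons by linarith
        ultimately show ?thesis
          using cross_cons_path[of "aug x' :: _ \<Rightarrow>\<^sub>0 'k" "length x''" "bv y'" "length y'" a b]
          by (simp add: Cons "by")
      qed (simp add: path_linear_simps cross_linear_simps)
      have E2: "cross (bv x) (cons_path b (aug y')) = cons_path (a, b) (cross (bv x') (cons_path b (aug y'))
          + pscale ((-1) ^ length x') (cross (bv x) (aug y')) :: _ \<Rightarrow>\<^sub>0 'k)"
      proof (cases y')
        case (Cons b' y'')
        have "Poly_Mapping.keys (aug y' :: _ \<Rightarrow>\<^sub>0 'k) \<subseteq> {z. distinct_adj z \<and> length z = length y''}"
          using keys_aug[of y'] Cons by auto
        moreover have "Poly_Mapping.keys (bv x' :: _ \<Rightarrow>\<^sub>0 'k) \<subseteq> {z. distinct_adj z \<and> length z = length x'}"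
          using reg by simp
        moreover have "0 < length x' + length y''"
          using 1 unfolding Cons length_Cons by linarith
        ultimately show ?thesis
          using cross_cons_path[of "bv x' :: _ \<Rightarrow>\<^sub>0 'k" "length x'" "aug y'" "length y''" a b]
          by (simp add: Cons bx)
      qed (simp add: path_linear_simps cross_linear_simps)
      have sq: "pscale ((-1) ^ n) (pscale ((-1) ^ n) c) = c" for n and c :: "('a \<times> 'b) list \<Rightarrow>\<^sub>0 'k"
        by (simp flip: power_mult_distrib)
      have "cons_path (a, b) (aug_bd W) = cross (cons_path a (aug x')) (bv y)
          + pscale ((-1) ^ length x') (cross (bv x) (cons_path b (aug y')))"
        unfolding E1 E2 W_def
        by (simp add: path_linear_simps cross_linear_simps IH1 IH2 aug_x aug_y pm.scale_right_distrib
            pm.scale_right_diff_distrib sq del: pm.scale_scale)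
      then show ?thesis
        unfolding L W_def aug_x aug_y
        by (simp add: cross_linear_simps xy pm.scale_right_diff_distrib)
    next
      case 2
      then obtain a' where x': "x' = [a']"
        by (cases x') auto
      show ?thesis
        unfolding L W_def using 2 less.prems
        by (simp add: xy x' cross_Nil_right lookup_single aug_Cons cross_points path_linear_simps
            cross_linear_simps cons_path_bv)
    next
      case 3
      then obtain b' where y': "y' = [b']"
        by (cases y') auto
      show ?thesis
        unfolding L W_def using 3 less.prems
        by (simp add: xy y' cross_Nil_left lookup_single aug_Cons cross_points path_linear_simps
            cross_linear_simps cons_path_bv)
    qed
  qed
qed

lemma boundary_cross_bv:
  assumes "distinct_adj x" "distinct_adj y" "x \<noteq> []" "y \<noteq> []"
  shows "boundary (cross (bv x) (bv y)) = cross (path_boundary x) (bv y)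
    + pscale ((-1) ^ (length x - 1)) (cross (bv x) (path_boundary y))"
proof (cases "length x = 1 \<and> length y = 1")
  case True
  then obtain a b where "x = [a]" "y = [b]"
    by (auto simp: length_Suc_conv)
  then show ?thesis
    by (simp add: cross_points path_boundary_eq_aug cross_linear_simps)
next
  case False
  have len: "3 \<le> length x + length y"
    using False assms(3,4) by (cases x; cases y) (auto simp: Suc_le_eq)
  have "Poly_Mapping.keys (cross (bv x) (bv y) :: _ \<Rightarrow>\<^sub>0 'c) \<subseteq> {z. 1 < length z}"
  proof
    fix z assume "z \<in> Poly_Mapping.keys (cross (bv x) (bv y) :: _ \<Rightarrow>\<^sub>0 'c)"
    then have z: "step_like z" "proj_X z = x" "proj_Y z = y"
      by (simp_all add: keys_cross_bv)
    then have "z \<noteq> []"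
      using assms(3) by auto
    then show "z \<in> {z. 1 < length z}"
      using step_like_length[OF z(1)] z len by simp
  qed
  then have "boundary (cross (bv x) (bv y) :: _ \<Rightarrow>\<^sub>0 'c) = aug_bd (cross (bv x) (bv y))"
    by (rule boundary_eq_aug_bd)
  also have "\<dots> = cross (aug x) (bv y) + pscale ((-1) ^ (length x - 1)) (cross (bv x) (aug y))"
    using assms(3) aug_bd_cross[OF assms(1,2) len] by (cases x) simp_all
  also have "cross (aug x) (bv y) = (cross (path_boundary x) (bv y) :: _ \<Rightarrow>\<^sub>0 'c)"
    using assms(3,4)
    by (cases x) (auto simp: path_boundary_eq_aug aug_Cons path_linear_simps cross_linear_simps
        cross_Nil_left lookup_single)
  also have "cross (bv x) (aug y) = (cross (bv x) (path_boundary y) :: _ \<Rightarrow>\<^sub>0 'c)"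
    using assms(3,4)
    by (cases y) (auto simp: path_boundary_eq_aug aug_Cons path_linear_simps cross_linear_simps
        cross_Nil_right lookup_single)
  finally show ?thesis .
qed

section \<open>Invariant chains\<close>

lemma regular_path_complex_distinct_adj:
  assumes P: "regular_path_complex V P"
  shows "x \<in> P \<Longrightarrow> distinct_adj x"
proof (induction x rule: induct_list012)
  case (3 a b x)
  have prefix: "y \<in> P" if "y @ w \<in> P" for y w
    using that
  proof (induction w rule: rev_induct)
    case (snoc c w)
    then have "butlast (y @ w @ [c]) \<in> P"
      using P by (auto simp: regular_path_complex_def path_complex_def)
    then have "y @ w \<in> P"
      by (simp add: butlast_append)
    then show ?case
      by (rule snoc.IH)
  qed simp
  have "[a, b] \<in> P"
    using prefix[of "[a, b]" x] "3.prems" by simp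
  then have "a \<noteq> b"
    using P by (auto simp: regular_path_complex_def)
  moreover have "b # x \<in> P"
    using "3.prems" P by (force simp: regular_path_complex_def path_complex_def)
  ultimately show ?case
    using "3.IH" by simp
qed simp_all

lemma allowed_chains_iff:
  "u \<in> allowed_chains P n \<longleftrightarrow> Poly_Mapping.keys u \<subseteq> {x \<in> P. length x = Suc n}"
  using span_bv_iff[of u "{x \<in> P. length x = Suc n}"] by (simp add: allowed_chains_def setcompr_eq_image)

lemma Omega_set_keys:
  assumes "u \<in> Omega_set P n"
  shows "Poly_Mapping.keys u \<subseteq> {x \<in> P. length x = Suc n}" "Poly_Mapping.keys (boundary u) \<subseteq> P"
  using assms by (auto simp: Omega_set_def allowed_chains_iff split: nat.splits)

lemma keys_boundary:
  assumes "Poly_Mapping.keys u \<subseteq> {x. length x = Suc (Suc n)}"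
  shows "Poly_Mapping.keys (boundary u) \<subseteq> {x. distinct_adj x \<and> length x = Suc n}"
proof -
  have "u \<in> {u. boundary u \<in> {v. Poly_Mapping.keys v \<subseteq> {x. distinct_adj x \<and> length x = Suc n}}}"
  proof (rule supported_in_subspace[OF _ assms])
    fix x :: "'a list" assume x: "x \<in> {x. length x = Suc (Suc n)}"
    show "bv x \<in> {u. boundary u \<in> {v. Poly_Mapping.keys v \<subseteq> {x. distinct_adj x \<and> length x = Suc n}}}"
      using keys_aug[of x] x by (auto simp: path_boundary_eq_aug)
  qed (intro subspace_vimage plinear_boundary subspace_keys)
  then show ?thesis by simp
qed

lemma Omega_setI:
  assumes k: "Poly_Mapping.keys u \<subseteq> {x \<in> P. length x = Suc n}" and b: "Poly_Mapping.keys (boundary u) \<subseteq> P"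
  shows "u \<in> Omega_set P n"
proof (cases n)
  case 0
  have "boundary u = 0"
    by (rule boundary_eq_0) (use k 0 in auto)
  then show ?thesis
    using 0 k by (simp add: Omega_set_def allowed_chains_iff)
next
  case (Suc m)
  have "Poly_Mapping.keys (boundary u) \<subseteq> {x. distinct_adj x \<and> length x = Suc m}"
    by (rule keys_boundary) (use k Suc in auto)
  then show ?thesis
    using Suc k b by (auto simp: Omega_set_def allowed_chains_iff)
qed

definition pdeg :: "'a list \<Rightarrow> nat" where "pdeg x = length x - 1"

lemma graded_complex_Omega:
  assumes P: "\<And>x. x \<in> P \<Longrightarrow> distinct_adj x"
  shows "graded_complex pdeg (Omega_set P :: nat \<Rightarrow> ('a list \<Rightarrow>\<^sub>0 'k::field) set) boundary"
proof (unfold_locales; (intro plinear_add[OF plinear_boundary] plinear_scale[OF plinear_boundary])?)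
  fix n
  have s: "pm.subspace (allowed_chains P n :: ('a list \<Rightarrow>\<^sub>0 'k) set)" for n
    by (simp add: allowed_chains_def)
  have s': "pm.subspace ((case n of 0 \<Rightarrow> {0} | Suc m \<Rightarrow> allowed_chains P m) :: ('a list \<Rightarrow>\<^sub>0 'k) set)"
    using s by (cases n) (auto simp: pm.subspace_single_0)
  have "Omega_set P n = allowed_chains P n \<inter>
      {u. boundary u \<in> ((case n of 0 \<Rightarrow> {0} | Suc m \<Rightarrow> allowed_chains P m) :: ('a list \<Rightarrow>\<^sub>0 'k) set)}"
    by (auto simp: Omega_set_def)
  then show "pm.subspace (Omega_set P n :: ('a list \<Rightarrow>\<^sub>0 'k) set)"
    using pm.subspace_inter[OF s subspace_vimage[OF plinear_boundary s']] by simp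
next
  fix n and u :: "'a list \<Rightarrow>\<^sub>0 'k"
  have bb: "boundary (boundary u) = 0" if "u \<in> Omega_set P n" for n
    by (rule boundary_boundary) (use P Omega_set_keys(1)[OF that] in auto)
  show "u \<in> Omega_set P n \<Longrightarrow> Poly_Mapping.keys u \<subseteq> {x. pdeg x = n}"
    using Omega_set_keys(1) by (fastforce simp: pdeg_def)
  show "u \<in> Omega_set P 0 \<Longrightarrow> boundary u = 0"
    by (simp add: Omega_set_def)
  show "u \<in> Omega_set P n \<Longrightarrow> boundary (boundary u) = 0"
    by (rule bb)
  show "boundary u \<in> Omega_set P n" if u: "u \<in> Omega_set P (Suc n)"
  proof (rule Omega_setI)
    show "Poly_Mapping.keys (boundary u) \<subseteq> {x \<in> P. length x = Suc n}"
      using u by (simp add: Omega_set_def allowed_chains_iff)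
  qed (simp add: bb[OF u])
qed

lemma Omega_eq_pm_complex: "Omega TYPE('k::field) P = pm_complex (Omega_set P) boundary"
  by (simp add: Omega_def pm_complex_def)


section \<open>Staircases\<close>

text \<open>The staircase that first runs horizontally over all of \<open>x\<close> and then vertically over all of \<open>y\<close>. Its elevation is
  zero.\<close>

fun canon :: "'a list \<Rightarrow> 'b list \<Rightarrow> ('a \<times> 'b) list" where
  "canon [] y = []"
| "canon [a] y = map (Pair a) y"
| "canon (a # a' # x) y = (a, hd y) # canon (a' # x) y"

lemma canon_hd: "\<exists>w. canon (a # x) (b # y) = (a, b) # w"
  by (cases x) auto

lemma vertical_path:
  assumes "distinct_adj (b # y)"
  shows "step_like (map (Pair a) (b # y)) \<and> proj_X (map (Pair a) (b # y)) = [a] \<and>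
    proj_Y (map (Pair a) (b # y)) = b # y \<and> elevation (map (Pair a) (b # y)) = 0"
  using assms
proof (induction y arbitrary: b)
  case (Cons b' y)
  then show ?case
    using Cons.IH[of b'] elevation_Cons[of "(a, b')" "map (Pair a) y" "(a, b)"]
    by (simp add: step_like_Cons_Cons)
qed simp

lemma canon_props:
  assumes "distinct_adj x" "distinct_adj y" "x \<noteq> []" "y \<noteq> []"
  shows "step_like (canon x y) \<and> proj_X (canon x y) = x \<and> proj_Y (canon x y) = y \<and>
    elevation (canon x y) = 0"
  using assms
proof (induction x y rule: canon.induct)
  case (2 a y)
  then show ?case
    using vertical_path[of "hd y" "tl y" a] by (cases y) auto
next
  case (3 a a' x y)
  obtain b y' where y: "y = b # y'"
    using 3 by (cases y) auto
  obtain w where "canon (a' # x) y = (a', b) # w"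
    using canon_hd[of a' x b y'] y by blast
  then show ?case
    using 3 y elevation_Cons[of "(a', b)" w "(a, b)"] by (auto simp: step_like_Cons_Cons)
qed simp

text \<open>Replacing a vertical-horizontal corner by the opposite one removes exactly one cell below the staircase.\<close>

lemma flip_corner:
  fixes a a' :: 'a and b b' :: 'b
  defines "z \<equiv> \<lambda>z1 z2. z1 @ [(a, b), (a, b'), (a', b')] @ z2"
    and "z' \<equiv> \<lambda>z1 z2. z1 @ [(a, b), (a', b), (a', b')] @ z2"
  assumes "a \<noteq> a'" "b \<noteq> b'" "step_like (z z1 z2)"
  shows "step_like (z' z1 z2) \<and> proj_X (z' z1 z2) = proj_X (z z1 z2) \<and>
    proj_Y (z' z1 z2) = proj_Y (z z1 z2) \<and> elevation (z z1 z2) = Suc (elevation (z' z1 z2))"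
  using assms(5)
proof (induction z1)
  case Nil
  obtain xs where xs: "proj_X ((a', b') # z2) = a' # xs"
    using proj_X_hd by fastforce
  have s: "step_like ((a', b') # z2)"
    using Nil by (simp add: z_def step_like_Cons_Cons)
  then have s1: "step_like ((a, b') # (a', b') # z2)" "step_like ((a', b) # (a', b') # z2)"
    using assms(3,4) by (auto simp: step_like_Cons_Cons)
  show ?case
    using assms(3,4) s s1 elevation_Cons[OF s1(1), of "(a, b)"] elevation_Cons[OF s1(2), of "(a, b)"]
      elevation_Cons[OF s, of "(a, b')"] elevation_Cons[OF s, of "(a', b)"] xs
    by (simp add: z_def z'_def step_like_Cons_Cons)
next
  case (Cons c z1)
  obtain c1 w w' where w: "z z1 z2 = c1 # w" "z' z1 z2 = c1 # w'"
    by (cases z1) (auto simp: z_def z'_def)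
  have cons: "z (c # z1) z2 = c # c1 # w" "z' (c # z1) z2 = c # c1 # w'"
    using w by (simp_all add: z_def z'_def)
  have s: "step_like (c1 # w)"
    using Cons.prems by (simp add: cons step_like_Cons_Cons)
  then have IH: "step_like (c1 # w')" "proj_X (c1 # w') = proj_X (c1 # w)"
      "proj_Y (c1 # w') = proj_Y (c1 # w)" "elevation (c1 # w) = Suc (elevation (c1 # w'))"
    using Cons.IH w by auto
  then show ?case
    using Cons.prems elevation_Cons[OF s, of c] elevation_Cons[OF IH(1), of c]
    by (simp add: cons step_like_Cons_Cons)
qed

text \<open>A staircase in which no vertical couple is followed by a horizontal one first moves
  horizontally and then vertically.\<close>

lemma no_corner_imp_canon:
  assumes "step_like z" "z \<noteq> []"
    and "\<And>z1 a b b' a' z2. z = z1 @ [(a, b), (a, b'), (a', b')] @ z2 \<Longrightarrow> a \<noteq> a' \<Longrightarrow> b \<noteq> b' \<Longrightarrow> False"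
  shows "z = canon (proj_X z) (proj_Y z)"
  using assms
proof (induction z rule: induct_list012)
  case (3 c c' w)
  have nc: "False" if "c' # w = z1 @ [(a, b), (a, b'), (a', b')] @ z2" "a \<noteq> a'" "b \<noteq> b'" for z1 a b b' a' z2
    using "3.prems"(3)[of "c # z1"] that by simp
  have s: "step_like (c' # w)" and cc: "c \<noteq> c'" "fst c = fst c' \<or> snd c = snd c'"
    using "3.prems" by (auto simp: step_like_Cons_Cons)
  have IH: "c' # w = canon (proj_X (c' # w)) (proj_Y (c' # w))"
    by (rule "3.IH"(2)[OF s _ nc]) auto
  obtain xs where xs: "proj_X (c' # w) = fst c' # xs"
    using proj_X_hd by blast
  obtain ys where ys: "proj_Y (c' # w) = snd c' # ys"
    using proj_Y_hd by blast
  show ?case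
  proof (cases "fst c = fst c'")
    case False
    then have "proj_X (c # c' # w) = fst c # fst c' # xs" "proj_Y (c # c' # w) = snd c' # ys" "snd c = snd c'"
      using cc xs ys by auto
    moreover have "canon (fst c' # xs) (snd c' # ys) = c' # w"
      using IH by (simp only: xs ys)
    ultimately show ?thesis
      by (simp add: prod_eq_iff del: proj_X_simps proj_Y_simps)
  next
    case True
    then have v: "snd c \<noteq> snd c'"
      using cc by (auto simp: prod_eq_iff)
    have "xs = []"
    proof (rule ccontr)
      assume "xs \<noteq> []"
      then obtain a' xs' where xs': "xs = a' # xs'"
        by (cases xs) auto
      have "distinct_adj (proj_X (c' # w))"
        by (simp add: proj_X_def)
      then have "fst c' \<noteq> a'"
        by (simp add: xs xs')
      obtain w' where "canon (a' # xs') (snd c' # ys) = (a', snd c') # w'"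
        using canon_hd[of a' xs' "snd c'" ys] by blast
      then have "w = (a', snd c') # w'"
        using IH xs ys xs' by simp
      then show False
        using "3.prems"(3)[of "[]" "fst c" "snd c" "snd c'" a' w'] True v \<open>fst c' \<noteq> a'\<close> 
        by (cases c; cases c') auto
    qed
    then have "canon (proj_X (c # c' # w)) (proj_Y (c # c' # w)) = (fst c, snd c) # canon [fst c'] (snd c' # ys)"
      using True v xs ys by simp
    then show ?thesis
      using IH xs ys \<open>xs = []\<close> True v by (cases c) simp
  qed
qed simp_all

lemma step_like_nth:
  "step_like x \<Longrightarrow> Suc i < length x \<Longrightarrow> fst (x ! i) = fst (x ! Suc i) \<or> snd (x ! i) = snd (x ! Suc i)"
  by (auto simp: step_like_def successively_conv_nth)

lemma length_delete_nth: "q < length x \<Longrightarrow> length (delete_nth q x) = length x - 1"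
  by (simp add: delete_nth_def)

lemma delete_nth_before: "q < length x \<Longrightarrow> i < q \<Longrightarrow> delete_nth q x ! i = x ! i"
  and delete_nth_after: "q < length x \<Longrightarrow> q \<le> i \<Longrightarrow> Suc i < length x \<Longrightarrow> delete_nth q x ! i = x ! Suc i"
  by (simp_all add: delete_nth_def nth_append)

text \<open>Only the two fillings of a diagonal step are step-like.\<close>

lemma delete_nth_diagonal:
  assumes x: "step_like x" and q: "q < length x"
    and del: "delete_nth q x = z1 @ [(a, b), (a', b')] @ z2" and ne: "a \<noteq> a'" "b \<noteq> b'"
  shows "q = Suc (length z1) \<and>
    (x = z1 @ [(a, b), (a, b'), (a', b')] @ z2 \<or> x = z1 @ [(a, b), (a', b), (a', b')] @ z2)"
proof -
  define m where "m = length z1"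
  have len: "length x = m + 3 + length z2"
    using length_delete_nth[OF q] q by (simp add: del m_def)
  have t: "delete_nth q x ! m = (a, b)" "delete_nth q x ! Suc m = (a', b')"
    by (simp_all add: del m_def nth_append)
  have "q = Suc m"
  proof (rule ccontr)
    assume "q \<noteq> Suc m"
    then consider "q \<le> m" | "Suc m < q"
      by linarith
    then show False
    proof cases
      case 1
      then have "x ! Suc m = (a, b)" "x ! Suc (Suc m) = (a', b')"
        using t delete_nth_after[OF q, of m] delete_nth_after[OF q, of "Suc m"] len by auto
      then show False
        using step_like_nth[OF x, of "Suc m"] ne len by simp
    next
      case 2
      then have "x ! m = (a, b)" "x ! Suc m = (a', b')"
        using t delete_nth_before[OF q, of m] delete_nth_before[OF q, of "Suc m"] by auto
      then show False
        using step_like_nth[OF x, of m] ne len by simp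
    qed
  qed
  have "take (Suc m) x @ drop (Suc (Suc m)) x = (z1 @ [(a, b)]) @ ((a', b') # z2)"
    using del by (simp add: delete_nth_def \<open>q = Suc m\<close>)
  moreover have "length (take (Suc m) x) = length (z1 @ [(a, b)])"
    using len by (simp add: m_def)
  ultimately have "take (Suc m) x = z1 @ [(a, b)]" "drop (Suc (Suc m)) x = (a', b') # z2"
    using append_eq_append_conv by blast+
  then have x_eq: "x = z1 @ [(a, b)] @ x ! Suc m # (a', b') # z2"
    using id_take_nth_drop[of "Suc m" x] len by simp
  define v where "v = x ! Suc m"
  have "x ! m = (a, b)" "x ! Suc (Suc m) = (a', b')"
    by (subst x_eq; simp add: m_def nth_append)+
  then have "(a = fst v \<or> b = snd v) \<and> (fst v = a' \<or> snd v = b')"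
    using step_like_nth[OF x, of m] step_like_nth[OF x, of "Suc m"] len by (simp add: v_def)
  then have "v = (a, b') \<or> v = (a', b)"
    using ne by (cases v) auto
  then show ?thesis
    using x_eq \<open>q = Suc m\<close> unfolding v_def m_def by auto
qed

text \<open>The diagonal step obtained by deleting the middle vertex of a corner is not step-like, so its
  coefficient in the boundary of an invariant chain vanishes; only the two fillings contribute to it,
  with the same sign.\<close>

lemma Omega_corner:
  fixes w :: "('a \<times> 'b) list \<Rightarrow>\<^sub>0 'k::field"
  assumes w: "w \<in> Omega_set (PX \<boxplus> PY) r" and ne: "a \<noteq> a'" "b \<noteq> b'"
    and s: "step_like (z1 @ [(a, b), (a, b'), (a', b')] @ z2)"
  shows "Poly_Mapping.lookup w (z1 @ [(a, b), (a, b'), (a', b')] @ z2)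
    = - Poly_Mapping.lookup w (z1 @ [(a, b), (a', b), (a', b')] @ z2)"
proof -
  let ?z = "z1 @ [(a, b), (a, b'), (a', b')] @ z2" and ?z' = "z1 @ [(a, b), (a', b), (a', b')] @ z2"
  define t where "t = z1 @ [(a, b), (a', b')] @ z2"
  define n where "n = Suc (length z1)"
  have zz: "?z \<noteq> ?z'"
    using ne by simp
  have "\<not> step_like t"
    using ne step_like_nth[of t "length z1"] by (auto simp: t_def nth_append)
  then have "t \<notin> PX \<boxplus> PY"
    by (simp add: cart_prod_def)
  then have "Poly_Mapping.lookup (boundary w) t = 0"
    using Omega_set_keys(2)[OF w] by (auto simp: in_keys_iff)
  have "distinct_adj t"
    using s ne unfolding step_like_def t_def
    by (auto simp: distinct_adj_append_iff split: if_splits)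
  have coeff: "Poly_Mapping.lookup (path_boundary x :: _ \<Rightarrow>\<^sub>0 'k) t = (if x = ?z \<or> x = ?z' then (-1) ^ n else 0)"
    if x: "step_like x" for x
  proof -
    have "Poly_Mapping.lookup (aug x :: _ \<Rightarrow>\<^sub>0 'k) t
        = (\<Sum>q<length x. if delete_nth q x = t then (-1) ^ q else 0)"
      unfolding aug_def lookup_sum using \<open>distinct_adj t\<close>
      by (intro sum.cong) (auto simp: lookup_single when_def)
    also have "\<dots> = (\<Sum>q<length x. if q = n then (if x = ?z \<or> x = ?z' then (-1) ^ n else 0) else 0)"
    proof (rule sum.cong)
      fix q assume "q \<in> {..<length x}"
      then have "delete_nth q x = t \<longleftrightarrow> q = n \<and> (x = ?z \<or> x = ?z')"
        using delete_nth_diagonal[OF x _ _ ne, of q z1 z2]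
        by (auto simp: t_def n_def) (auto simp: delete_nth_def)
      then show "(if delete_nth q x = t then (-1) ^ q else 0)
          = (if q = n then (if x = ?z \<or> x = ?z' then (-1 :: 'k) ^ n else 0) else 0)"
        by auto
    qed simp
    also have "\<dots> = (if x = ?z \<or> x = ?z' then (-1) ^ n else 0)"
      by (auto simp: n_def)
    finally show ?thesis
      by (auto simp: path_boundary_eq_aug)
  qed
  have "0 = (\<Sum>x\<in>Poly_Mapping.keys w. Poly_Mapping.lookup w x * Poly_Mapping.lookup (path_boundary x) t)"
    using \<open>Poly_Mapping.lookup (boundary w) t = 0\<close> by (simp add: boundary_eq_lin_ext lookup_lin_ext)
  also have "\<dots> = (\<Sum>x\<in>Poly_Mapping.keys w. (if x = ?z then Poly_Mapping.lookup w ?z * (-1) ^ n else 0)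
      + (if x = ?z' then Poly_Mapping.lookup w ?z' * (-1) ^ n else 0))"
  proof (rule sum.cong)
    fix x assume "x \<in> Poly_Mapping.keys w"
    then have "step_like x"
      using Omega_set_keys(1)[OF w] by (auto simp: cart_prod_def)
    then show "Poly_Mapping.lookup w x * Poly_Mapping.lookup (path_boundary x) t =
        (if x = ?z then Poly_Mapping.lookup w ?z * (-1) ^ n else 0)
        + (if x = ?z' then Poly_Mapping.lookup w ?z' * (-1) ^ n else 0)"
      using zz ne by (auto simp: coeff)
  qed simp
  also have "\<dots> = (Poly_Mapping.lookup w ?z + Poly_Mapping.lookup w ?z') * (-1) ^ n"
    by (simp add: sum.distrib in_keys_iff algebra_simps)
  finally have "Poly_Mapping.lookup w ?z + Poly_Mapping.lookup w ?z' = 0"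
    by simp
  then show ?thesis
    by (simp add: eq_neg_iff_add_eq_0)
qed

text \<open>Induction on the elevation: a staircase other than the canonical one has a corner, and flipping it lowers the elevation by
  one while changing the sign of the coefficient.\<close>

lemma Omega_canon:
  fixes w :: "('a \<times> 'b) list \<Rightarrow>\<^sub>0 'k::field"
  assumes w: "w \<in> Omega_set (PX \<boxplus> PY) r"
  shows "step_like z \<Longrightarrow> z \<noteq> [] \<Longrightarrow>
    Poly_Mapping.lookup w z = (-1) ^ elevation z * Poly_Mapping.lookup w (canon (proj_X z) (proj_Y z))"
proof (induction "elevation z" arbitrary: z rule: less_induct)
  case less
  show ?case
  proof (cases "\<exists>z1 a b b' a' z2. z = z1 @ [(a, b), (a, b'), (a', b')] @ z2 \<and> a \<noteq> a' \<and> b \<noteq> b'")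
    case True
    then obtain z1 a b b' a' z2 where z: "z = z1 @ [(a, b), (a, b'), (a', b')] @ z2" and ne: "a \<noteq> a'" "b \<noteq> b'"
      by blast
    define z' where "z' = z1 @ [(a, b), (a', b), (a', b')] @ z2"
    have f: "step_like z'" "proj_X z' = proj_X z" "proj_Y z' = proj_Y z" "elevation z = Suc (elevation z')"
      using flip_corner[OF ne, of z1 z2] less.prems(1) by (auto simp: z z'_def)
    have "Poly_Mapping.lookup w z = - Poly_Mapping.lookup w z'"
      using Omega_corner[OF w ne, of z1 z2] less.prems(1) by (simp add: z z'_def)
    moreover have "z' \<noteq> []"
      by (simp add: z'_def)
    ultimately show ?thesis
      using less.hyps[of z'] f by simp
  next
    case False
    then have "z = canon (proj_X z) (proj_Y z)"
      by (intro no_corner_imp_canon less.prems) blast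
    moreover have "elevation (canon (proj_X z) (proj_Y z)) = 0"
      using canon_props[of "proj_X z" "proj_Y z"] less.prems(2) by (auto simp: proj_X_def proj_Y_def)
    ultimately show ?thesis
      by simp
  qed
qed


section \<open>The cross product as a map on the tensor product\<close>

text \<open>The linear map induced by the bilinear cross product.\<close>

definition chi :: "('a list \<times> 'b list \<Rightarrow>\<^sub>0 'k::field) \<Rightarrow> (('a \<times> 'b) list \<Rightarrow>\<^sub>0 'k)" where
  "chi = lin_ext (\<lambda>(x, y). cross (bv x) (bv y))"

lemma plinear_chi: "plinear chi"
  by (simp add: chi_def plinear_lin_ext)

lemma chi_bv [simp]: "chi (bv (x, y)) = cross (bv x) (bv y)"
  by (simp add: chi_def)

lemma chi_outer: "chi (outer u v) = cross u v"
  by (rule bilinear_eqI[where F = "\<lambda>u v. chi (outer u v)" and G = cross and K = UNIV and L = UNIV])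
    (auto intro: plinear_compose[OF plinear_outer_left plinear_chi]
      plinear_compose[OF plinear_outer_right plinear_chi] plinear_cross_left plinear_cross_right)

lemma lookup_chi:
  "Poly_Mapping.lookup (chi c) z =
    (if step_like z then (-1) ^ elevation z * Poly_Mapping.lookup c (proj_X z, proj_Y z) else 0)"
proof -
  have "Poly_Mapping.lookup (chi c) z = (\<Sum>i\<in>Poly_Mapping.keys c. if i = (proj_X z, proj_Y z)
      then (if step_like z then (-1) ^ elevation z * Poly_Mapping.lookup c i else 0) else 0)"
    unfolding chi_def lookup_lin_ext
    by (rule sum.cong) (auto simp: lookup_cross lookup_single when_def split: if_splits)
  then show ?thesis
    by (simp add: in_keys_iff)
qed

abbreviation reg_paths :: "'a list set" where
  "reg_paths \<equiv> {x. distinct_adj x \<and> x \<noteq> []}"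

lemma lookup_chi_canon:
  assumes "x \<in> reg_paths" "y \<in> reg_paths"
  shows "Poly_Mapping.lookup (chi c) (canon x y) = Poly_Mapping.lookup c (x, y)"
  using canon_props[of x y] assms by (simp add: lookup_chi)

lemma chi_inj:
  assumes "Poly_Mapping.keys c \<subseteq> reg_paths \<times> reg_paths" "chi c = 0"
  shows "c = 0"
proof (rule outer_eqI)
  fix x y
  show "Poly_Mapping.lookup c (x, y) = Poly_Mapping.lookup 0 (x, y)"
  proof (cases "(x, y) \<in> reg_paths \<times> reg_paths")
    case True
    then show ?thesis
      using lookup_chi_canon[of x y c] assms(2) by simp
  next
    case False
    then have "(x, y) \<notin> Poly_Mapping.keys c"
      using assms(1) by blast
    then show ?thesis
      by (simp add: in_keys_iff)
  qed
qed

section \<open>Invariant chains on a product\<close>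

locale path_product =
  tensor_harmonic pdeg "Omega_set PX :: nat \<Rightarrow> ('a list \<Rightarrow>\<^sub>0 'k::field) set" boundary \<pi> h
    pdeg "Omega_set PY :: nat \<Rightarrow> ('b list \<Rightarrow>\<^sub>0 'k) set" boundary \<pi>' h'
  for PX :: "'a list set" and PY :: "'b list set" and \<pi> h \<pi>' h' +
  assumes PX: "x \<in> PX \<Longrightarrow> distinct_adj x" and PY: "y \<in> PY \<Longrightarrow> distinct_adj y"
begin

lemma boundary_chi:
  assumes "Poly_Mapping.keys c \<subseteq> reg_paths \<times> reg_paths"
  shows "boundary (chi c) = chi (D c)"
proof (rule plinear_eqI[OF _ _ assms])
  show "plinear (\<lambda>c. boundary (chi c))" "plinear (\<lambda>c. chi (D c))"
    by (intro plinear_compose[OF plinear_chi plinear_boundary] plinear_compose[OF plinear_D plinear_chi])+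
  fix i :: "'a list \<times> 'b list" assume i: "i \<in> reg_paths \<times> reg_paths"
  obtain x y where xy: "i = (x, y)"
    by (cases i)
  have D_xy: "D (bv (x, y)) = outer (path_boundary x) (bv y)
      + pscale ((-1) ^ pdeg x) (outer (bv x) (path_boundary y))"
    by (simp add: D_def tmap_def sg_def)
  show "boundary (chi (bv i)) = chi (D (bv i))"
    unfolding xy D_xy using i xy
    by (simp add: boundary_cross_bv chi_outer plinear_add[OF plinear_chi] plinear_scale[OF plinear_chi]
        pdeg_def flip: outer_bv)
qed

lemma keys_gspan:
  fixes c :: "'a list \<times> 'b list \<Rightarrow>\<^sub>0 'k"
  assumes "c \<in> gspan (Omega_set PX) (Omega_set PY) r"
  shows "Poly_Mapping.keys c \<subseteq> reg_paths \<times> reg_paths"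
proof -
  have "c \<in> {c. Poly_Mapping.keys c \<subseteq> reg_paths \<times> reg_paths}"
  proof (rule gspan_into[OF plinear_ident subspace_keys _ assms])
    fix p q and u :: "'a list \<Rightarrow>\<^sub>0 'k" and v :: "'b list \<Rightarrow>\<^sub>0 'k"
    assume "u \<in> Omega_set PX p" "v \<in> Omega_set PY q"
    then have "outer u v \<in> tspan {u} {v}" "Poly_Mapping.keys u \<subseteq> reg_paths" "Poly_Mapping.keys v \<subseteq> reg_paths"
      using Omega_set_keys(1)[of u PX p] Omega_set_keys(1)[of v PY q] PX PY
      by (auto intro: outer_in_tspan)
    then show "outer u v \<in> {c. Poly_Mapping.keys c \<subseteq> reg_paths \<times> reg_paths}"
      using keys_tspan[of "{u}" reg_paths "{v}" reg_paths] by blast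
  qed
  then show ?thesis by simp
qed

lemma cross_Omega:
  fixes u :: "'a list \<Rightarrow>\<^sub>0 'k"
  assumes u: "u \<in> Omega_set PX p" and v: "v \<in> Omega_set PY q"
  shows "cross u v \<in> Omega_set (PX \<boxplus> PY) (p + q)"
proof (rule Omega_setI)
  have keys_cross: "Poly_Mapping.keys (cross u v) \<subseteq> PX \<boxplus> PY"
    if "Poly_Mapping.keys u \<subseteq> PX" "Poly_Mapping.keys v \<subseteq> PY" for u :: "'a list \<Rightarrow>\<^sub>0 'k" and v
    using that by (auto simp: in_keys_iff lookup_cross cart_prod_def split: if_splits)
  note ku = Omega_set_keys[OF u] and kv = Omega_set_keys[OF v]
  show "Poly_Mapping.keys (cross u v) \<subseteq> {z \<in> PX \<boxplus> PY. length z = Suc (p + q)}"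
  proof
    fix z assume z: "z \<in> Poly_Mapping.keys (cross u v)"
    then have "step_like z" "proj_X z \<in> Poly_Mapping.keys u" "proj_Y z \<in> Poly_Mapping.keys v"
      by (auto simp: in_keys_iff lookup_cross split: if_splits)
    then have "step_like z" "length (proj_X z) = Suc p" "length (proj_Y z) = Suc q" "z \<noteq> []"
      using ku kv by auto
    then have "length z = Suc (p + q)"
      using step_like_length[of z] by simp
    then show "z \<in> {z \<in> PX \<boxplus> PY. length z = Suc (p + q)}"
      using keys_cross[of u v] ku kv z by blast
  qed
  have "outer u v \<in> gspan (Omega_set PX) (Omega_set PY) (p + q)"
    by (rule outer_in_gspan) (use u v in simp_all)
  then have "boundary (cross u v) = chi (D (outer u v))"
    using boundary_chi[OF keys_gspan] by (simp flip: chi_outer)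
  also have "\<dots> = cross (boundary u) v + pscale ((-1) ^ p) (cross u (boundary v))"
    by (simp add: D_outer[OF u] plinear_add[OF plinear_chi] plinear_scale[OF plinear_chi] chi_outer)
  also have "\<dots> \<in> {w. Poly_Mapping.keys w \<subseteq> PX \<boxplus> PY}"
    using keys_cross[of "boundary u" v] keys_cross[of u "boundary v"] ku kv
    by (intro pm.subspace_add[OF subspace_keys] pm.subspace_scale[OF subspace_keys]) blast+
  finally show "Poly_Mapping.keys (boundary (cross u v)) \<subseteq> PX \<boxplus> PY"
    by simp
qed

lemma slice_right_tmap_sg:
  fixes c :: "'a list \<times> 'b list \<Rightarrow>\<^sub>0 'k"
  shows "slice_right x (tmap sg boundary c) = pscale ((-1) ^ pdeg x) (boundary (slice_right x c))"
proof (rule plinear_eqI[where f = "\<lambda>c. slice_right x (tmap sg boundary c)"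
      and g = "\<lambda>c. pscale ((-1) ^ pdeg x) (boundary (slice_right x c))" and u = c and K = UNIV])
  have sl: "plinear (slice_right x)"
    by (simp add: slice_right_def plinear_lin_ext)
  show "plinear (\<lambda>c. slice_right x (tmap sg boundary c))"
    "plinear (\<lambda>c. pscale ((-1) ^ pdeg x) (boundary (slice_right x c)))"
    by (intro plinear_scaled plinear_compose[OF sl plinear_boundary] plinear_compose[OF plinear_tmap sl])+
  fix i :: "'a list \<times> 'b list"
  obtain x' y where i: "i = (x', y)"
    by (cases i)
  have "slice_right x (outer (bv x') v) = (if x' = x then v else 0)" for v :: "'b list \<Rightarrow>\<^sub>0 'k"
    by (rule poly_mapping_eqI) (auto simp: lookup_single when_def)
  then have "slice_right x (tmap sg boundary (bv i)) = (if x' = x then pscale ((-1) ^ pdeg x) (path_boundary y) else 0)"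
    by (simp add: i tmap_def sg_def plinear_scale[OF sl])
  moreover have "slice_right x (bv i :: _ \<Rightarrow>\<^sub>0 'k) = (if x' = x then bv y else 0)"
    by (simp add: i slice_right_def)
  ultimately show "slice_right x (tmap sg boundary (bv i)) = pscale ((-1) ^ pdeg x) (boundary (slice_right x (bv i)))"
    by (simp add: plinear_0[OF plinear_boundary])
qed auto

lemma keys_D_parts:
  fixes c :: "'a list \<times> 'b list \<Rightarrow>\<^sub>0 'k"
  assumes "Poly_Mapping.keys c \<subseteq> PX \<times> PY"
  shows "x \<notin> PX \<Longrightarrow> Poly_Mapping.lookup (tmap sg boundary c) (x, y) = 0"
    and "y \<notin> PY \<Longrightarrow> Poly_Mapping.lookup (tmap boundary id c) (x, y) = 0"
proof -
  assume "x \<notin> PX"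
  then have "slice_right x c = 0"
    using assms by (intro poly_mapping_eqI) (auto simp: in_keys_iff)
  then show "Poly_Mapping.lookup (tmap sg boundary c) (x, y) = 0"
    using arg_cong[OF slice_right_tmap_sg[of x c], of "\<lambda>v. Poly_Mapping.lookup v y"]
    by (simp add: plinear_0[OF plinear_boundary])
next
  assume "y \<notin> PY"
  then have "slice_left y c = 0"
    using assms by (intro poly_mapping_eqI) (auto simp: in_keys_iff)
  then show "Poly_Mapping.lookup (tmap boundary id c) (x, y) = 0"
    using arg_cong[OF slice_left_tmap[OF plinear_boundary, of y c], of "\<lambda>v. Poly_Mapping.lookup v x"]
    by (simp add: plinear_0[OF plinear_boundary])
qed

text \<open>Coefficients of \<open>D c\<close> at pairs with exactly one allowed entry see only one of the two summands
  of \<open>D\<close>, so their vanishing says that the slices of \<open>c\<close> have allowed boundaries.\<close>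

lemma gspan_if_chi_Omega:
  fixes c :: "'a list \<times> 'b list \<Rightarrow>\<^sub>0 'k"
  assumes kc: "Poly_Mapping.keys c \<subseteq> {(x, y). x \<in> PX \<and> y \<in> PY \<and> x \<noteq> [] \<and> y \<noteq> [] \<and> pdeg x + pdeg y = r}"
    and b: "Poly_Mapping.keys (boundary (chi c)) \<subseteq> PX \<boxplus> PY"
  shows "c \<in> gspan (Omega_set PX) (Omega_set PY) r"
proof -
  have kr: "Poly_Mapping.keys c \<subseteq> reg_paths \<times> reg_paths" and kP: "Poly_Mapping.keys c \<subseteq> PX \<times> PY"
    using kc PX PY by auto
  have D0: "Poly_Mapping.lookup (D c) (x, y) = 0"
    if xy: "x \<in> reg_paths" "y \<in> reg_paths" and n: "x \<notin> PX \<or> y \<notin> PY" for x y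
  proof -
    have "canon x y \<notin> PX \<boxplus> PY"
      using canon_props[of x y] xy n by (auto simp: cart_prod_def)
    then have "Poly_Mapping.lookup (boundary (chi c)) (canon x y) = 0"
      using b by (auto simp: in_keys_iff)
    then show ?thesis
      using xy by (simp add: boundary_chi[OF kr] lookup_chi_canon)
  qed
  have bnd: "Poly_Mapping.keys (boundary u) \<subseteq> reg_paths" if k: "Poly_Mapping.keys u \<subseteq> {x. length x = Suc n}"
    for u :: "'c list \<Rightarrow>\<^sub>0 'k" and n
  proof (cases n)
    case 0
    then have "boundary u = 0"
      using k by (intro boundary_eq_0) auto
    then show ?thesis by simp
  next
    case (Suc m)
    then show ?thesis
      using keys_boundary[of u m] k by auto
  qed
  have left: "slice_left y c \<in> Omega_set PX p" if y: "y \<in> PY" "y \<noteq> []" "p + pdeg y = r" for y p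
  proof (rule Omega_setI)
    show k: "Poly_Mapping.keys (slice_left y c) \<subseteq> {x \<in> PX. length x = Suc p}"
    proof
      fix x assume "x \<in> Poly_Mapping.keys (slice_left y c)"
      then have "(x, y) \<in> Poly_Mapping.keys c"
        by (simp add: in_keys_iff)
      then have "x \<in> PX" "x \<noteq> []" "pdeg x + pdeg y = r"
        using kc by auto
      then show "x \<in> {x \<in> PX. length x = Suc p}"
        using y by (cases x) (auto simp: pdeg_def)
    qed
    show "Poly_Mapping.keys (boundary (slice_left y c)) \<subseteq> PX"
    proof
      fix x assume x: "x \<in> Poly_Mapping.keys (boundary (slice_left y c))"
      then have xr: "x \<in> reg_paths"
        using bnd[of "slice_left y c" p] k by blast
      show "x \<in> PX"
      proof (rule ccontr)
        assume n: "x \<notin> PX"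
        have "Poly_Mapping.lookup (D c) (x, y) = Poly_Mapping.lookup (boundary (slice_left y c)) x"
          unfolding D_def lookup_add keys_D_parts(1)[OF kP n]
          by (simp flip: slice_left_tmap[OF plinear_boundary])
        then show False
          using D0[OF xr, of y] n y PY x by (simp add: in_keys_iff)
      qed
    qed
  qed
  have right: "slice_right x c \<in> Omega_set PY q" if x: "x \<in> PX" "x \<noteq> []" "pdeg x + q = r" for x q
  proof (rule Omega_setI)
    show k: "Poly_Mapping.keys (slice_right x c) \<subseteq> {y \<in> PY. length y = Suc q}"
    proof
      fix y assume "y \<in> Poly_Mapping.keys (slice_right x c)"
      then have "(x, y) \<in> Poly_Mapping.keys c"
        by (simp add: in_keys_iff)
      then have "y \<in> PY" "y \<noteq> []" "pdeg x + pdeg y = r"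
        using kc by auto
      then show "y \<in> {y \<in> PY. length y = Suc q}"
        using x by (cases y) (auto simp: pdeg_def)
    qed
    show "Poly_Mapping.keys (boundary (slice_right x c)) \<subseteq> PY"
    proof
      fix y assume y: "y \<in> Poly_Mapping.keys (boundary (slice_right x c))"
      then have yr: "y \<in> reg_paths"
        using bnd[of "slice_right x c" q] k by blast
      show "y \<in> PY"
      proof (rule ccontr)
        assume n: "y \<notin> PY"
        have "Poly_Mapping.lookup (D c) (x, y) = Poly_Mapping.lookup (slice_right x (tmap sg boundary c)) y"
          unfolding D_def lookup_add keys_D_parts(2)[OF kP n] by simp
        also have "\<dots> = (-1) ^ pdeg x * Poly_Mapping.lookup (boundary (slice_right x c)) y"
          by (simp only: slice_right_tmap_sg lookup_pscale)
        finally show False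
          using D0[OF _ yr, of x] n x PX y by (simp add: in_keys_iff)
      qed
    qed
  qed
  let ?part = "bidegree_part pdeg pdeg"
  have lookup_part: "Poly_Mapping.lookup (?part i c) (x, y)
      = (if (pdeg x, pdeg y) = i then Poly_Mapping.lookup c (x, y) else 0)" for i x y
  proof -
    have "Poly_Mapping.lookup (?part i c) (x, y) = (\<Sum>j\<in>Poly_Mapping.keys c. if j = (x, y) then
        (if (pdeg x, pdeg y) = i then Poly_Mapping.lookup c (x, y) else 0) else 0)"
      unfolding bidegree_part_def lookup_lin_ext
      by (rule sum.cong) (auto simp: lookup_single when_def split: if_splits)
    then show ?thesis
      by (simp add: in_keys_iff)
  qed
  have part: "?part (p, q) c \<in> tspan (Omega_set PX p) (Omega_set PY q)" if pq: "p + q = r" for p q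
  proof (rule slices_imp_tspan[OF A.subspace_C B.subspace_C])
    fix y
    show "slice_left y (?part (p, q) c) \<in> Omega_set PX p"
    proof (cases "y \<in> PY \<and> y \<noteq> [] \<and> pdeg y = q")
      case True
      have "slice_left y (?part (p, q) c) = slice_left y c"
      proof (rule poly_mapping_eqI)
        fix x
        show "Poly_Mapping.lookup (slice_left y (?part (p, q) c)) x = Poly_Mapping.lookup (slice_left y c) x"
          using kc True pq by (cases "(x, y) \<in> Poly_Mapping.keys c") (auto simp: lookup_part in_keys_iff)
      qed
      then show ?thesis
        using left[of y p] True pq by simp
    next
      case False
      then have "slice_left y (?part (p, q) c) = 0"
        using kc by (intro poly_mapping_eqI) (auto simp: lookup_part in_keys_iff)
      then show ?thesis
        by (simp add: pm.subspace_0[OF A.subspace_C])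
    qed
  next
    fix x
    show "slice_right x (?part (p, q) c) \<in> Omega_set PY q"
    proof (cases "x \<in> PX \<and> x \<noteq> [] \<and> pdeg x = p")
      case True
      have "slice_right x (?part (p, q) c) = slice_right x c"
      proof (rule poly_mapping_eqI)
        fix y
        show "Poly_Mapping.lookup (slice_right x (?part (p, q) c)) y = Poly_Mapping.lookup (slice_right x c) y"
          using kc True pq by (cases "(x, y) \<in> Poly_Mapping.keys c") (auto simp: lookup_part in_keys_iff)
      qed
      then show ?thesis
        using right[of x q] True pq by simp
    next
      case False
      then have "slice_right x (?part (p, q) c) = 0"
        using kc by (intro poly_mapping_eqI) (auto simp: lookup_part in_keys_iff)
      then show ?thesis
        by (simp add: pm.subspace_0[OF B.subspace_C])
    qed
  qed
  have "c = (\<Sum>i\<in>bidegrees r. ?part i c)"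
  proof (rule outer_eqI)
    fix x y
    have "Poly_Mapping.lookup (\<Sum>i\<in>bidegrees r. ?part i c) (x, y)
        = (if pdeg x + pdeg y = r then Poly_Mapping.lookup c (x, y) else 0)"
      by (simp add: lookup_sum lookup_part finite_bidegrees) (simp add: bidegrees_def)
    then show "Poly_Mapping.lookup c (x, y) = Poly_Mapping.lookup (\<Sum>i\<in>bidegrees r. ?part i c) (x, y)"
      using kc by (auto simp: in_keys_iff)
  qed
  moreover have "(\<Sum>i\<in>bidegrees r. ?part i c) \<in> gspan (Omega_set PX) (Omega_set PY) r"
    by (rule pm.subspace_sum[OF subspace_gspan])
      (use part tspan_subset_gspan in \<open>fastforce simp: bidegrees_def\<close>)
  ultimately show ?thesis
    by simp
qed

text \<open>The candidate \<open>c(x, y)\<close> is the coefficient of \<open>w\<close> at the canonical staircase over \<open>(x, y)\<close>, where the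
  sign \<open>(-1)\<^sup>L\<close> is trivial.\<close>

lemma chi_surj:
  fixes w :: "('a \<times> 'b) list \<Rightarrow>\<^sub>0 'k"
  assumes w: "w \<in> Omega_set (PX \<boxplus> PY) r"
  shows "\<exists>c\<in>gspan (Omega_set PX) (Omega_set PY) r. chi c = w"
proof -
  define c where "c = lin_ext (\<lambda>z. if z = canon (proj_X z) (proj_Y z) then bv (proj_X z, proj_Y z) else 0) w"
  note kw = Omega_set_keys[OF w]
  have lookup_c: "Poly_Mapping.lookup c (x, y) = (if proj_X (canon x y) = x \<and> proj_Y (canon x y) = y
      then Poly_Mapping.lookup w (canon x y) else 0)" for x y
  proof -
    have "Poly_Mapping.lookup c (x, y) = (\<Sum>z\<in>Poly_Mapping.keys w. if z = canon x y then
        (if proj_X z = x \<and> proj_Y z = y then Poly_Mapping.lookup w z else 0) else 0)"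
      unfolding c_def lookup_lin_ext by (rule sum.cong) (auto simp: lookup_single when_def)
    then show ?thesis
      by (simp add: in_keys_iff)
  qed
  have kc: "Poly_Mapping.keys c \<subseteq> {(x, y). x \<in> PX \<and> y \<in> PY \<and> x \<noteq> [] \<and> y \<noteq> [] \<and> pdeg x + pdeg y = r}"
  proof (intro subsetI, clarify)
    fix x y assume "(x, y) \<in> Poly_Mapping.keys c"
    then have p: "proj_X (canon x y) = x" "proj_Y (canon x y) = y" and "canon x y \<in> Poly_Mapping.keys w"
      by (auto simp: in_keys_iff lookup_c split: if_splits)
    then have z: "canon x y \<in> PX \<boxplus> PY" "length (canon x y) = Suc r"
      using kw by auto
    then have ne: "canon x y \<noteq> []"
      by auto
    then have xy: "x \<noteq> []" "y \<noteq> []"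
      using p by (metis proj_empty_iff(1), metis proj_empty_iff(2))
    have "length x + length y = Suc (Suc r)"
      using step_like_length[of "canon x y"] z ne p by (simp add: cart_prod_def)
    then show "x \<in> PX \<and> y \<in> PY \<and> x \<noteq> [] \<and> y \<noteq> [] \<and> pdeg x + pdeg y = r"
      using z p xy by (cases x; cases y) (auto simp: cart_prod_def pdeg_def)
  qed
  have "chi c = w"
  proof (rule poly_mapping_eqI)
    fix z
    show "Poly_Mapping.lookup (chi c) z = Poly_Mapping.lookup w z"
    proof (cases "step_like z \<and> z \<noteq> []")
      case True
      then have "proj_X (canon (proj_X z) (proj_Y z)) = proj_X z \<and> proj_Y (canon (proj_X z) (proj_Y z)) = proj_Y z"
        using canon_props[of "proj_X z" "proj_Y z"] by (simp add: proj_X_def proj_Y_def)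
      then show ?thesis
        using True Omega_canon[OF w, of z] by (simp add: lookup_chi lookup_c)
    next
      case False
      then have "z \<notin> Poly_Mapping.keys w"
        using kw(1) by (auto simp: cart_prod_def)
      moreover have "([], []) \<notin> Poly_Mapping.keys c"
        using kc by auto
      ultimately show ?thesis
        using False by (auto simp: lookup_chi in_keys_iff)
    qed
  qed
  then show ?thesis
    using gspan_if_chi_Omega[OF kc] kw(2) by blast
qed

lemma chi_iso: "chi \<in> module_iso (pm_module (gspan (Omega_set PX) (Omega_set PY) r))
    (pm_module (Omega_set (PX \<boxplus> PY) r :: (_ \<Rightarrow>\<^sub>0 'k) set))"
proof (rule module_isoI; unfold pm_module_simps)
  have Z: "\<And>z. z \<in> PX \<boxplus> PY \<Longrightarrow> distinct_adj z"
    by (simp add: cart_prod_def step_like_def)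
  interpret Z: graded_complex pdeg "Omega_set (PX \<boxplus> PY) :: nat \<Rightarrow> (_ \<Rightarrow>\<^sub>0 'k) set" boundary
    by (rule graded_complex_Omega[OF Z])
  show "chi c \<in> Omega_set (PX \<boxplus> PY) r" if "c \<in> gspan (Omega_set PX) (Omega_set PY) r" for c :: "_ \<Rightarrow>\<^sub>0 'k"
    by (rule gspan_into[OF plinear_chi Z.subspace_C _ that]) (auto simp: chi_outer intro: cross_Omega)
  show "x = y" if "x \<in> gspan (Omega_set PX) (Omega_set PY) r" "y \<in> gspan (Omega_set PX) (Omega_set PY) r"
    "chi x = chi y" for x y :: "_ \<Rightarrow>\<^sub>0 'k"
    using chi_inj[OF keys_gspan[OF pm.subspace_diff[OF subspace_gspan that(1,2)]]] that(3)
    by (simp add: plinear_diff[OF plinear_chi])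
qed (use chi_surj in \<open>auto simp: plinear_add[OF plinear_chi] plinear_scale[OF plinear_chi]\<close>)

text \<open>Taking the coefficients \<open>\<psi> w\<close> of a cycle \<open>w\<close> and projecting them to the harmonic part kills exactly the
  boundaries, because it does so for cycles of the tensor product.\<close>

lemma homology_product_iso:
  assumes \<psi>: "plinear \<psi>" and \<psi>_chi: "\<And>c. Poly_Mapping.keys c \<subseteq> reg_paths \<times> reg_paths \<Longrightarrow> \<psi> (chi c) = c"
  shows "coset_value (\<lambda>w. tmap \<pi> \<pi>' (\<psi> w))
    \<in> module_iso (homology (pm_complex (Omega_set (PX \<boxplus> PY)) boundary) r) (pm_module (gspan A.harm B.harm r))"
proof -
  have Z: "\<And>z. z \<in> PX \<boxplus> PY \<Longrightarrow> distinct_adj z"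
    by (simp add: cart_prod_def step_like_def)
  interpret Z: graded_complex pdeg "Omega_set (PX \<boxplus> PY) :: nat \<Rightarrow> (_ \<Rightarrow>\<^sub>0 'k) set" boundary
    by (rule graded_complex_Omega[OF Z])
  let ?G = "gspan (Omega_set PX) (Omega_set PY)" and ?Z = "\<lambda>r. Omega_set (PX \<boxplus> PY) r :: (_ \<Rightarrow>\<^sub>0 'k) set"
  let ?cyc = "{w \<in> ?Z r. boundary w = 0}" and ?\<Phi> = "\<lambda>w. tmap \<pi> \<pi>' (\<psi> w)"
  have hom: "homology (pm_complex ?Z boundary) r = quot_module (pm_module ?cyc) (boundary ` ?Z (Suc r))"
    by (rule homology_pm_complex[OF Z.d_C0])
  have cyc: "pm.subspace ?cyc"
    using Z.subspace_C[of r]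
    by (auto simp: pm.subspace_def plinear_0[OF Z.d] plinear_add[OF Z.d] plinear_scale[OF Z.d])
  have chi_Z: "?Z r = chi ` ?G r" for r
    using module_isoD(4)[OF chi_iso, of r] by (simp add: bij_betw_def)
  have \<psi>_G: "\<psi> (chi c) = c" if "c \<in> ?G r" for c r
    by (rule \<psi>_chi[OF keys_gspan[OF that]])
  have bd: "boundary (chi c) = chi (D c)" if "c \<in> ?G r" for c r
    by (rule boundary_chi[OF keys_gspan[OF that]])
  have "chi (D c) = 0 \<longleftrightarrow> D c = 0" if "c \<in> ?G r" for c
  proof (cases r)
    case 0
    then show ?thesis
      using that D_gspan_0 by (simp add: plinear_0[OF plinear_chi])
  next
    case (Suc n)
    then show ?thesis
      using that chi_inj[OF keys_gspan[OF D_gspan]] by (auto simp: plinear_0[OF plinear_chi])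
  qed
  then have cyc_eq: "?cyc = chi ` {c \<in> ?G r. D c = 0}"
    using bd[of _ r] by (auto simp: chi_Z plinear_0[OF plinear_chi])
  have "boundary ` ?Z (Suc r) = {w \<in> ?cyc. ?\<Phi> w = 0}"
  proof (intro equalityI subsetI)
    fix w assume "w \<in> boundary ` ?Z (Suc r)"
    then obtain c where c: "c \<in> ?G (Suc r)" "w = boundary (chi c)"
      by (auto simp: chi_Z)
    then have "chi c \<in> ?Z (Suc r)"
      by (simp add: chi_Z)
    then have "w \<in> ?cyc"
      using c(2) by (simp add: Z.d_C Z.d_d)
    moreover have "?\<Phi> w = 0"
      using c by (simp add: bd \<psi>_G[OF D_gspan] \<pi>_D)
    ultimately show "w \<in> {w \<in> ?cyc. ?\<Phi> w = 0}"
      by simp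
  next
    fix w assume w: "w \<in> {w \<in> ?cyc. ?\<Phi> w = 0}"
    then obtain c where c: "c \<in> ?G r" "D c = 0" "w = chi c"
      using cyc_eq by auto
    then have "D (S c) = c"
      using w by (intro cycle_is_boundary) (auto simp: \<psi>_G)
    then have "w = boundary (chi (S c))"
      using bd[OF S_gspan[OF c(1)]] c(3) by simp
    then show "w \<in> boundary ` ?Z (Suc r)"
      using S_gspan[OF c(1)] by (simp add: chi_Z)
  qed
  moreover have "?\<Phi> ` ?cyc = gspan A.harm B.harm r"
    unfolding cyc_eq image_image \<pi>_cycles[symmetric] by (rule image_cong) (auto simp: \<psi>_G)
  ultimately show ?thesis
    unfolding hom
    using quot_module_iso[OF cyc plinear_compose[OF \<psi> plinear_tmap[of \<pi> \<pi>']], of "boundary ` ?Z (Suc r)"]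
    by simp
qed

lemma kunneth:
  "isomorphic_modules (homology (pm_complex (Omega_set (PX \<boxplus> PY) :: nat \<Rightarrow> (_ \<Rightarrow>\<^sub>0 'k) set) boundary) r)
    (direct_sum (bidegrees r)
      (\<lambda>(p, q). tensor (homology (pm_complex (Omega_set PX) boundary :: ('k, _) chain_cplx) p)
        (homology (pm_complex (Omega_set PY) boundary) q)))"
proof -
  have "inj_on chi {c :: 'a list \<times> 'b list \<Rightarrow>\<^sub>0 'k. Poly_Mapping.keys c \<subseteq> reg_paths \<times> reg_paths}"
  proof (rule inj_onI)
    fix c c' :: "'a list \<times> 'b list \<Rightarrow>\<^sub>0 'k"
    assume "c \<in> {c. Poly_Mapping.keys c \<subseteq> reg_paths \<times> reg_paths}"
      "c' \<in> {c. Poly_Mapping.keys c \<subseteq> reg_paths \<times> reg_paths}" "chi c = chi c'"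
    then show "c = c'"
      using chi_inj[of "c - c'"] pm.subspace_diff[OF subspace_keys, of c "reg_paths \<times> reg_paths" c']
      by (simp add: plinear_diff[OF plinear_chi])
  qed
  then have "\<exists>\<psi>. range \<psi> \<subseteq> {c. Poly_Mapping.keys c \<subseteq> reg_paths \<times> reg_paths} \<and> plinear \<psi> \<and>
      (\<forall>c\<in>{c :: 'a list \<times> 'b list \<Rightarrow>\<^sub>0 'k. Poly_Mapping.keys c \<subseteq> reg_paths \<times> reg_paths}. \<psi> (chi c) = c)"
    by (rule pmp.linear_exists_left_inverse_on[OF plinear_chi subspace_keys])
  then obtain \<psi> where \<psi>: "plinear \<psi>"
      "\<And>c :: 'a list \<times> 'b list \<Rightarrow>\<^sub>0 'k. Poly_Mapping.keys c \<subseteq> reg_paths \<times> reg_paths \<Longrightarrow> \<psi> (chi c) = c"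
    by auto
  let ?T = "\<lambda>(p, q). tensor (homology (pm_complex (Omega_set PX) boundary :: ('k, _) chain_cplx) p)
    (homology (pm_complex (Omega_set PY) boundary) q)"
  have "closed_module (direct_sum (bidegrees r) ?T)"
    by (intro closed_direct_sum finite_bidegrees) (auto simp: closed_tensor)
  then show ?thesis
    using module_iso_trans[OF homology_product_iso[OF \<psi>] module_iso_inv[OF _ homology_tensor_iso]]
    unfolding isomorphic_modules_def by blast
qed

definition cross_map :: "nat \<Rightarrow> _ \<Rightarrow> _" where
  "cross_map r w = chi (\<Sum>(p, q)\<in>bidegrees r. tval (w (p, q)))"

lemma cross_map_chain_iso:
  "cross_map \<in> chain_iso (tensor_complex (pm_complex (Omega_set PX) boundary) (pm_complex (Omega_set PY) boundary))
    (pm_complex (Omega_set (PX \<boxplus> PY)) boundary)"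
proof -
  let ?T = "tensor_complex (pm_complex (Omega_set PX) boundary :: ('k, _) chain_cplx)
    (pm_complex (Omega_set PY) boundary)"
  let ?Z = "pm_complex (Omega_set (PX \<boxplus> PY)) boundary :: ('k, _) chain_cplx"
  have "cross_map r \<in> module_iso (cobj ?T r) (cobj ?Z r)" for r
    using module_iso_trans[OF tensor_complex_iso chi_iso, of r] by (simp add: pm_complex_def cross_map_def[abs_def])
  moreover have "cross_map r (cdiff ?T r x) = cdiff ?Z r (cross_map (Suc r) x)"
    if x: "x \<in> carrier (cobj ?T (Suc r))" for r x
  proof -
    have "(\<Sum>(p, q)\<in>bidegrees (Suc r). tval (x (p, q))) \<in> gspan (Omega_set PX) (Omega_set PY) (Suc r)"
      using module_isoD(1)[OF tensor_complex_iso x] by simp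
    then show ?thesis
      using tensor_complex_chain_map[OF x] boundary_chi[OF keys_gspan]
      by (simp add: cross_map_def pm_complex_def)
  qed
  ultimately show ?thesis
    unfolding chain_iso_def by blast
qed

lemma cross_map_pure:
  assumes "u \<in> Omega_set PX p" "v \<in> Omega_set PY q"
  shows "cross_map (p + q) (direct_sum_incl (bidegrees (p + q))
      (\<lambda>(p, q). tensor (pm_module (Omega_set PX p)) (pm_module (Omega_set PY q))) (p, q)
      (pure_tensor (pm_module (Omega_set PX p)) (pm_module (Omega_set PY q)) u v)) = cross u v"
proof -
  let ?x = "pure_tensor (pm_module (Omega_set PX p)) (pm_module (Omega_set PY q)) u v"
  let ?T = "\<lambda>(p, q). tensor (pm_module (Omega_set PX p)) (pm_module (Omega_set PY q))"
  have "tval (direct_sum_incl (bidegrees (p + q)) ?T (p, q) ?x i) = (if i = (p, q) then outer u v else 0)"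
    if "i \<in> bidegrees (p + q)" for i
    using that
    by (cases i) (auto simp: direct_sum_incl_def tensor_factors.coset_value_pure_tensor[OF factors]
        tensor_factors.coset_value_tensor_zero[OF factors])
  then have "(\<Sum>i\<in>bidegrees (p + q). tval (direct_sum_incl (bidegrees (p + q)) ?T (p, q) ?x i)) = outer u v"
    by (simp add: finite_bidegrees) (simp add: bidegrees_def)
  then show ?thesis
    by (simp add: cross_map_def chi_outer case_prod_unfold)
qed

end


section \<open>The Kuenneth formula for path complexes\<close>

theorem theorem7p6:
  fixes X :: "'a set" and Y :: "'b set"
    and PX :: "'a list set" and PY :: "'b list set"
  assumes "finite X" and "finite Y"
    and "regular_path_complex X PX" and "regular_path_complex Y PY"
  shows "(\<exists>\<phi> \<in> chain_iso (tensor_complex (Omega TYPE('k::field) PX) (Omega TYPE('k) PY))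
                        (Omega TYPE('k) (PX \<boxplus> PY)).
           \<forall>p q. \<forall>u\<in>Omega_set PX p. \<forall>v\<in>Omega_set PY q.
             \<phi> (p + q)
               (direct_sum_incl (bidegrees (p + q))
                 (\<lambda>(p, q). tensor (cobj (Omega TYPE('k) PX) p) (cobj (Omega TYPE('k) PY) q))
                 (p, q)
                 (pure_tensor (cobj (Omega TYPE('k) PX) p) (cobj (Omega TYPE('k) PY) q) u v))
             = cross u v)
         \<and> (\<forall>r. isomorphic_modules
                (homology (Omega TYPE('k) (PX \<boxplus> PY)) r)
                (direct_sum (bidegrees r)
                  (\<lambda>(p, q). tensor (homology (Omega TYPE('k) PX) p)
                                  (homology (Omega TYPE('k) PY) q))))"
proof -
  note PX = regular_path_complex_distinct_adj[OF assms(3)]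
    and PY = regular_path_complex_distinct_adj[OF assms(4)]
  obtain \<pi> h where X: "harmonic_complex pdeg (Omega_set PX :: nat \<Rightarrow> (_ \<Rightarrow>\<^sub>0 'k) set) boundary \<pi> h"
    using graded_complex.harmonic_decomposition[OF graded_complex_Omega[OF PX]] .
  obtain \<pi>' h' where Y: "harmonic_complex pdeg (Omega_set PY :: nat \<Rightarrow> (_ \<Rightarrow>\<^sub>0 'k) set) boundary \<pi>' h'"
    using graded_complex.harmonic_decomposition[OF graded_complex_Omega[OF PY]] .
  interpret path_product PX PY \<pi> h \<pi>' h'
    by (intro path_product.intro tensor_harmonic.intro path_product_axioms.intro X Y PX PY)
  show ?thesis
    unfolding Omega_eq_pm_complex pm_complex_cobj
    using cross_map_chain_iso cross_map_pure kunneth by blast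
qed

end
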